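(* Let $\frac{\pi}{2}<\alpha,\beta,\gamma<\pi$ and let $Q(\alpha,\beta,\gamma)$ be a spherical Lambert cube with essential angles $\alpha,\beta,\gamma$. Then its volume is $$V(\alpha,\beta,\gamma)=\frac14\left(\delta(\alpha,\theta)+\delta(\beta,\theta)+\delta(\gamma,\theta)-2\,\delta\!\left(\tfrac{\pi}{2},\theta\right)-\delta(0,\theta)\right),$$ where $$\delta(\alpha,\theta)=\int_{\theta}^{\pi/2}\log\left(1-\cos 2\alpha\cos 2\tau\right)\frac{d\tau}{\cos 2\tau}$$ and $\theta$, $\frac{\pi}{2}<\theta<\pi$, is the principal parameter defined by $$\tan^2\theta=-p+\sqrt{p^2+L^2M^2N^2},\qquad p=\frac{L^2+M^2+N^2+1}{2},$$ $$L=\tan\alpha,\quad M=\tan\beta,\quad N=\tan\gamma.$$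
   Context: The spherical space $\mathbb{S}^3$ is the unit 3-sphere with its metric of constant curvature $1$. A spherical Lambert cube $Q(\alpha,\beta,\gamma)$ is a (convex) polyhedron in $\mathbb{S}^3$ that is combinatorially a cube, with interior dihedral angles $\alpha,\beta,\gamma$ at three mutually non-coplanar edges (no two of them lie in a common face plane) and interior dihedral angle $\frac{\pi}{2}$ at each of the remaining nine edges; $\alpha,\beta,\gamma$ are its essential angles. The integrand defining $\delta$ is extended by continuity at points where $\cos 2\tau=0$; possible logarithmic singularities are integrable. *)

theory Defs
  imports "HOL-Analysis.Analysis"
begin

(* The sphere S^3 is sphere 0 1 in real^4.  A subset P of S^3 is studied through conic hull P, the
   union of the rays from the origin through P: intersecting with S^3 turns a k-dimensional linear
   object of real^4 into a (k-1)-dimensional spherical one. *)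

text \<open>A convex polyhedron in the 3-sphere: a finite intersection of closed hemispheres that has
  interior points.\<close>

definition spherical_polyhedron :: "(real^4) set \<Rightarrow> bool" where
  "spherical_polyhedron P \<longleftrightarrow>
     (\<exists>H. finite H \<and> 0 \<notin> H \<and> P = {x \<in> sphere 0 1. \<forall>a\<in>H. a \<bullet> x \<le> 0}) \<and>
     interior (conic hull P) \<noteq> {}"

text \<open>The empty face and the whole polyhedron count as faces, as in the library notion
  \<open>face_of\<close>. For a polyhedron without antipodal points the empty face comes from both the empty
  face and the face \<open>{0}\<close> of the cone.\<close>

definition spherical_face :: "(real^4) set \<Rightarrow> (real^4) set \<Rightarrow> bool" where
  "spherical_face P F \<longleftrightarrow> (\<exists>G. G face_of (conic hull P) \<and> F = G \<inter> sphere 0 1)"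

definition spherical_facet :: "(real^4) set \<Rightarrow> (real^4) set \<Rightarrow> bool" where
  "spherical_facet P F \<longleftrightarrow> spherical_face P F \<and> dim F = 3"

definition spherical_edge :: "(real^4) set \<Rightarrow> (real^4) set \<Rightarrow> bool" where
  "spherical_edge P e \<longleftrightarrow> spherical_face P e \<and> dim e = 2"

text \<open>The face lattice is isomorphic to that of the Euclidean cube.\<close>

definition combinatorial_cube :: "(real^4) set \<Rightarrow> bool" where
  "combinatorial_cube P \<longleftrightarrow>
     (\<exists>\<phi> :: (real^4) set \<Rightarrow> (real^3) set.
        bij_betw \<phi> {F. spherical_face P F} {F. F face_of (cbox 0 One)} \<and>
        (\<forall>F G. spherical_face P F \<longrightarrow> spherical_face P G \<longrightarrow> (F \<subseteq> G \<longleftrightarrow> \<phi> F \<subseteq> \<phi> G)))"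

definition outward_unit_normal :: "(real^4) set \<Rightarrow> (real^4) set \<Rightarrow> real^4 \<Rightarrow> bool" where
  "outward_unit_normal P F n \<longleftrightarrow>
     norm n = 1 \<and> (\<forall>x\<in>P. n \<bullet> x \<le> 0) \<and> F = {x \<in> P. n \<bullet> x = 0}"

text \<open>The interior dihedral angle at an edge is the supplement of the angle between the outward
  unit normals of the two facets that meet there.\<close>

definition has_dihedral_angle :: "(real^4) set \<Rightarrow> (real^4) set \<Rightarrow> real \<Rightarrow> bool" where
  "has_dihedral_angle P e a \<longleftrightarrow>
     (\<exists>F G m n. spherical_facet P F \<and> spherical_facet P G \<and> F \<noteq> G \<and> e = F \<inter> G \<and>
        outward_unit_normal P F m \<and> outward_unit_normal P G n \<and>
        a = pi - arccos (m \<bullet> n))"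

text \<open>The face plane of a facet \<open>F\<close> is the great 2-sphere \<open>span F \<inter> sphere 0 1\<close>.\<close>

definition face_coplanar :: "(real^4) set \<Rightarrow> (real^4) set \<Rightarrow> (real^4) set \<Rightarrow> bool" where
  "face_coplanar P e e' \<longleftrightarrow> (\<exists>F. spherical_facet P F \<and> e \<subseteq> span F \<and> e' \<subseteq> span F)"

definition spherical_lambert_cube :: "(real^4) set \<Rightarrow> real \<Rightarrow> real \<Rightarrow> real \<Rightarrow> bool" where
  "spherical_lambert_cube Q \<alpha> \<beta> \<gamma> \<longleftrightarrow>
     spherical_polyhedron Q \<and> combinatorial_cube Q \<and>
     (\<exists>e1 e2 e3.
        spherical_edge Q e1 \<and> spherical_edge Q e2 \<and> spherical_edge Q e3 \<and>
        \<not> face_coplanar Q e1 e2 \<and> \<not> face_coplanar Q e1 e3 \<and> \<not> face_coplanar Q e2 e3 \<and>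
        has_dihedral_angle Q e1 \<alpha> \<and> has_dihedral_angle Q e2 \<beta> \<and> has_dihedral_angle Q e3 \<gamma> \<and>
        (\<forall>e. spherical_edge Q e \<longrightarrow> e \<notin> {e1, e2, e3} \<longrightarrow> has_dihedral_angle Q e (pi / 2)))"

text \<open>Surface measure of the unit 3-sphere, by the cone formula: the solid unit cone over \<open>A\<close> has
  Lebesgue measure \<open>\<integral>\<^sub>0\<^sup>1 r\<^sup>3 dr = 1/4\<close> times the surface measure of \<open>A\<close>.\<close>

definition spherical_volume :: "(real^4) set \<Rightarrow> real" where
  "spherical_volume A = 4 * measure lebesgue (conic hull A \<inter> cball 0 1)"

text \<open>The value at \<open>cos (2 * t) = 0\<close> is the continuous extension, since \<open>ln (1 - c * x) / x\<close> tends to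
  \<open>- c\<close> as \<open>x\<close> tends to 0. The integral is oriented: it is minus the integral over
  \<open>{pi / 2..\<theta>}\<close> when \<open>\<theta> > pi / 2\<close>.\<close>

definition delta_integrand :: "real \<Rightarrow> real \<Rightarrow> real" where
  "delta_integrand a t =
     (if cos (2 * t) = 0 then - cos (2 * a)
      else ln (1 - cos (2 * a) * cos (2 * t)) / cos (2 * t))"

definition delta :: "real \<Rightarrow> real \<Rightarrow> real" where
  "delta a \<theta> = (LBINT t=ereal \<theta>..ereal (pi / 2). delta_integrand a t)"

end

theory Submission
  imports Defs "HOL-Real_Asymp.Real_Asymp"
begin

text \<open>Let \<open>l\<close> be the length of the edge with angle \<open>\<alpha>\<close>. In cylindrical coordinates about this edge the two
  faces at its ends are coordinate surfaces, and the cube is bounded radially by the remaining two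
  faces, which are orthogonal to each other. Joining their common edge to the axis splits the cube
  into two pieces of the same kind, with parameters \<open>\<kappa>\<close> and \<open>\<kappa>'\<close> (the tangents of the
  lengths of two edges at the axis). If \<open>\<alpha>\<close> and \<open>l\<close> are kept fixed, then so are \<open>\<kappa> * \<kappa>'\<close> and \<open>tan \<theta> = tan \<alpha> / tan l\<close>,
  while \<open>\<beta>\<close> depends on \<open>\<kappa>\<close> alone and \<open>\<gamma>\<close> on \<open>\<kappa>'\<close> alone. The derivative of a piece in its parameter is
  the Schlaefli term (half the edge length times the derivative of the angle), which is a quarter of
  the derivative of \<open>delta\<close>, plus a remainder; the remainders of the two pieces cancel because they are
  exchanged by the reflection of the edge. Letting \<open>\<kappa>\<close> tend to infinity, the volume tends to
  \<open>l * (\<alpha> - pi / 2) / 2\<close>, and this limit is expressed by \<open>delta\<close> through differentiation in \<open>\<alpha>\<close>,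
  starting from \<open>\<alpha> = pi\<close>.\<close>

section \<open>Delta as a function of the angle\<close>

text \<open>The cube is known only through its face lattice and its angles, so no smooth family of
  cubes is at hand to which Schlaefli's formula could be applied. The volume is therefore first
  turned into two explicit integrals, and only these are differentiated. An edge with an essential
  angle serves as axis because its length and angle determine \<theta>: with both fixed, every
  \<open>delta\<close> keeps the same second argument. The constraint on
  \<open>\<kappa> * \<kappa>'\<close> is the orthogonality of the two outer faces. The analytic
  obstacle is \<open>delta (pi / 2) \<theta>\<close>, whose integrand has a logarithmic singularity
  at \<open>t = pi / 2\<close>; it is reached only as a one-sided limit from larger angles. The
  combinatorial part has to supply six normals in cyclic arrangement. The products of opposite
  normals remain unknown; one of them is the negative cosine of the length of the axis and is
  eliminated by the equation for \<theta>. That the essential angles are obtuse fixes the signs of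
  all frame coordinates, so that the cube lies in one gnomonic chart.\<close>

lemma cos2_less:
  fixes a t \<theta> :: real
  assumes "pi / 2 < a" "a < 3 * pi / 2" "pi / 2 \<le> t" "t \<le> \<theta>" "\<theta> < pi"
  shows "cos (2 * a) * cos (2 * t) < 1"
proof -
  have "cos a < 0"
    using assms cos_gt_zero_pi[of "pi - a"] by simp
  then have a: "- 1 < cos (2 * a)"
    by (simp add: cos_double_cos)
  have "sin t > 0"
    using assms by (intro sin_gt_zero) auto
  then have t: "cos (2 * t) < 1"
    by (simp add: cos_double_sin)
  have "cos (2 * a) \<le> 1" "- 1 \<le> cos (2 * t)" by simp_all
  show ?thesis
  proof (cases "cos (2 * t) \<ge> 0")
    case True
    then have "cos (2 * a) * cos (2 * t) \<le> 1 * cos (2 * t)"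
      by (intro mult_right_mono) auto
    with t show ?thesis by simp
  next
    case False
    then have "(- cos (2 * a)) * (- cos (2 * t)) < 1 * (- cos (2 * t))"
      using a by (intro mult_strict_right_mono) auto
    then have "cos (2 * a) * cos (2 * t) < - cos (2 * t)" by simp
    with \<open>- 1 \<le> cos (2 * t)\<close> show ?thesis by linarith
  qed
qed

lemma tan_neg:
  assumes "pi / 2 < a" "a < pi"
  shows "tan a < 0"
proof -
  have "cos a < 0" using assms cos_gt_zero_pi[of "pi - a"] by simp
  moreover have "sin a > 0" using assms by (intro sin_gt_zero) auto
  ultimately show ?thesis by (simp add: tan_def divide_pos_neg)
qed

lemma isCont_ln_quotient:
  fixes x :: real
  assumes "x < 1"
  shows "isCont (\<lambda>x. if x = 0 then 1 else - ln (1 - x) / x) x"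
proof (cases "x = 0")
  case False
  have "\<forall>\<^sub>F y in nhds x. y \<noteq> 0"
    using False by (simp add: t1_space_nhds)
  then have "\<forall>\<^sub>F y in nhds x. - ln (1 - y) / y = (if y = 0 then 1 else - ln (1 - y) / y)"
    by eventually_elim auto
  moreover have "isCont (\<lambda>y. - ln (1 - y) / y) x"
    using False assms by (intro continuous_intros) auto
  ultimately show ?thesis
    by (subst (asm) isCont_cong) auto
next
  case True
  have "((\<lambda>y. - ln (1 - y)) has_real_derivative 1) (at 0)"
    by (auto intro!: derivative_eq_intros)
  then have "(\<lambda>y::real. - ln (1 - y) / y) \<midarrow>0\<rightarrow> 1"
    by (simp add: DERIV_def)
  then have "(\<lambda>y::real. if y = 0 then 1 else - ln (1 - y) / y) \<midarrow>0\<rightarrow> 1"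
    by (rule Lim_transform_eventually) (auto simp: eventually_at_filter)
  then show ?thesis
    using True by (simp add: isCont_def)
qed

text \<open>All removable singularities are moved into one function of the single variable
  \<open>cos (2 * a) * cos (2 * t)\<close>, so continuity in \<open>a\<close> and in
  \<open>t\<close> follows by composition without a case split.\<close>

lemma delta_integrand_eq:
  "delta_integrand a t =
     - cos (2 * a) * (\<lambda>x. if x = 0 then 1 else - ln (1 - x) / x) (cos (2 * a) * cos (2 * t))"
  by (simp add: delta_integrand_def)

lemma isCont_delta_integrand:
  assumes "cos (2 * a) * cos (2 * t) < 1"
  shows "isCont (delta_integrand a) t" "isCont (\<lambda>a. delta_integrand a t) a"
proof -
  note * = isCont_o2[where g = "\<lambda>x. if x = 0 then 1 else - ln (1 - x) / x", OF _ isCont_ln_quotient]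
  show "isCont (delta_integrand a) t"
    unfolding delta_integrand_eq[abs_def] using assms
    by (intro continuous_intros *) auto
  show "isCont (\<lambda>a. delta_integrand a t) a"
    unfolding delta_integrand_eq[abs_def] using assms
    by (intro continuous_intros *) auto
qed

lemma delta_integrand_has_derivative:
  assumes "cos (2 * a) * cos (2 * t) < 1"
  shows "((\<lambda>a. delta_integrand a t) has_real_derivative
           2 * sin (2 * a) / (1 - cos (2 * a) * cos (2 * t))) (at a)"
proof (cases "cos (2 * t) = 0")
  case True
  then show ?thesis
    by (auto simp: delta_integrand_def intro!: derivative_eq_intros)
next
  case False
  then show ?thesis
    using assms unfolding delta_integrand_def
    by (auto intro!: derivative_eq_intros simp: field_simps)
qed

text \<open>The direction does not depend on the sign of \<open>cos (2 * t)\<close>, because the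
  division reverses the order exactly when the logarithm does. This supplies the monotone sequence
  in \<open>delta_tendsto_at_right\<close>.\<close>

lemma delta_integrand_antimono:
  assumes "cos (2 * a) \<le> cos (2 * a')" "cos (2 * a) * cos (2 * t) < 1" "cos (2 * a') * cos (2 * t) < 1"
  shows "delta_integrand a' t \<le> delta_integrand a t"
proof -
  consider "cos (2 * t) = 0" | "cos (2 * t) > 0" | "cos (2 * t) < 0" by linarith
  then show ?thesis
  proof cases
    case 1
    then show ?thesis using assms by (simp add: delta_integrand_def)
  next
    case 2
    then have "ln (1 - cos (2 * a') * cos (2 * t)) \<le> ln (1 - cos (2 * a) * cos (2 * t))"
      using assms by (intro ln_mono) auto
    then show ?thesis using 2 by (simp add: delta_integrand_def divide_right_mono)
  next
    case 3
    then have "ln (1 - cos (2 * a) * cos (2 * t)) \<le> ln (1 - cos (2 * a') * cos (2 * t))"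
      using assms by (intro ln_mono) auto
    then show ?thesis using 3 by (simp add: delta_integrand_def divide_right_mono_neg)
  qed
qed

lemma delta_eq_set_integral:
  assumes "pi / 2 < \<theta>"
  shows "delta a \<theta> = - (LINT t:{pi / 2..\<theta>}|lborel. delta_integrand a t)"
  unfolding delta_def
  by (subst interval_integral_endpoints_reverse) (use assms in \<open>simp add: interval_integral_Icc\<close>)

lemma delta_integrand_set_integrable:
  assumes "pi / 2 < a" "a < 3 * pi / 2" "\<theta> < pi"
  shows "set_integrable lborel {pi / 2..\<theta>} (delta_integrand a)"
  by (intro borel_integrable_atLeastAtMost' continuous_at_imp_continuous_on ballI
        isCont_delta_integrand cos2_less[OF assms(1,2)])
     (use assms in auto)

lemma delta_eq_integral:
  assumes "pi / 2 < a" "a < 3 * pi / 2" "pi / 2 < \<theta>" "\<theta> < pi"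
  shows "delta a \<theta> = - integral (cbox (pi / 2) \<theta>) (delta_integrand a)"
  using delta_integrand_set_integrable[of a \<theta>] assms
  by (simp add: delta_eq_set_integral set_borel_integral_eq_integral)

lemma delta_has_derivative_integral:
  assumes "pi / 2 < a" "a < 3 * pi / 2" and \<theta>: "pi / 2 < \<theta>" "\<theta> < pi"
  shows "((\<lambda>a. delta a \<theta>) has_real_derivative
     - integral (cbox (pi / 2) \<theta>) (\<lambda>t. 2 * sin (2 * a) / (1 - cos (2 * a) * cos (2 * t)))) (at a)"
proof -
  \<comment> \<open>The interval extends past \<open>pi\<close> so that \<open>pi\<close>, the
    starting point of \<open>delta_add_delta_complement\<close>, is an interior point. Its left end
    stays open: at \<open>a = pi / 2\<close> and \<open>t = pi / 2\<close> the denominator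
    vanishes.\<close>
  define U where "U = {pi / 2<..<3 * pi / 2}"
  have a: "a \<in> U" "open U" using assms by (auto simp: U_def)
  have less: "cos (2 * x) * cos (2 * t) < 1" if "x \<in> U" "t \<in> cbox (pi / 2) \<theta>" for x t
    using that \<theta> by (intro cos2_less[of x t \<theta>]) (auto simp: U_def)
  have neq: "1 - cos (2 * x) * cos (2 * t) \<noteq> 0" if "x \<in> U" "t \<in> cbox (pi / 2) \<theta>" for x t
    using less[OF that] by simp
  have "((\<lambda>a. integral (cbox (pi / 2) \<theta>) (delta_integrand a)) has_real_derivative
     integral (cbox (pi / 2) \<theta>) (\<lambda>t. 2 * sin (2 * a) / (1 - cos (2 * a) * cos (2 * t)))) (at a within U)"
  proof (rule leibniz_rule_field_derivative)
    show "((\<lambda>x. delta_integrand x t) has_real_derivative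
             2 * sin (2 * x) / (1 - cos (2 * x) * cos (2 * t))) (at x within U)"
      if "x \<in> U" "t \<in> cbox (pi / 2) \<theta>" for x t
      using delta_integrand_has_derivative[OF less[OF that]] by (rule has_field_derivative_at_within)
    show "delta_integrand x integrable_on cbox (pi / 2) \<theta>" if "x \<in> U" for x
      using delta_integrand_set_integrable[of x \<theta>] that assms
      by (auto simp: U_def intro: set_borel_integral_eq_integral)
    show "continuous_on (U \<times> cbox (pi / 2) \<theta>)
        (\<lambda>(x, t). 2 * sin (2 * x) / (1 - cos (2 * x) * cos (2 * t)))"
      unfolding case_prod_beta
      by (intro continuous_intros ballI) (use neq in auto)
    show "convex U" by (simp add: U_def)
  qed (use a in auto)
  then have "((\<lambda>a. - integral (cbox (pi / 2) \<theta>) (delta_integrand a)) has_real_derivative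
     - integral (cbox (pi / 2) \<theta>) (\<lambda>t. 2 * sin (2 * a) / (1 - cos (2 * a) * cos (2 * t)))) (at a)"
    unfolding at_within_open[OF a] by (rule DERIV_minus)
  then show ?thesis
    by (rule has_field_derivative_transform_within_open[OF _ a(2,1)])
       (use \<theta> in \<open>auto simp: U_def delta_eq_integral\<close>)
qed

lemma delta_isCont:
  assumes "pi / 2 < a" "a < 3 * pi / 2" "pi / 2 < \<theta>" "\<theta> < pi"
  shows "isCont (\<lambda>a. delta a \<theta>) a"
  using delta_has_derivative_integral[OF assms] by (rule DERIV_isCont)

text \<open>The substitution \<open>x = - cot \<tau>\<close> rationalises the integrand.\<close>
lemma delta_has_derivative:
  assumes a: "pi / 2 < a" "a < pi" and \<theta>: "pi / 2 < \<theta>" "\<theta> < pi"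
  shows "((\<lambda>a. delta a \<theta>) has_real_derivative 2 * arctan (tan a / tan \<theta>)) (at a)"
proof -
  have sa: "sin a > 0" using a by (intro sin_gt_zero) auto
  have ca: "cos a < 0" using a cos_gt_zero_pi[of "pi - a"] by simp
  have "((\<lambda>t. 2 * sin (2 * a) / (1 - cos (2 * a) * cos (2 * t))) has_integral
     - 2 * arctan (tan a * cot \<theta>) - - 2 * arctan (tan a * cot (pi / 2))) {pi / 2..\<theta>}"
  proof (rule fundamental_theorem_of_calculus)
    fix t assume t: "t \<in> {pi / 2..\<theta>}"
    have st: "sin t > 0" using t \<theta> by (intro sin_gt_zero) auto
    have less: "cos (2 * a) * cos (2 * t) < 1"
      using t \<theta> a by (intro cos2_less[of a t \<theta>]) auto
    have sc: "sin a ^ 2 = 1 - cos a ^ 2" "sin t ^ 2 = 1 - cos t ^ 2"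
      by (simp_all add: sin_squared_eq)
    have c2: "1 - cos (2 * a) * cos (2 * t) = 2 * (cos a ^ 2 * sin t ^ 2 + sin a ^ 2 * cos t ^ 2)"
      unfolding cos_double_cos sc by algebra
    have pos: "cos a ^ 2 * sin t ^ 2 + sin a ^ 2 * cos t ^ 2 > 0"
      using less c2 by simp
    have "((\<lambda>t. - 2 * arctan (tan a * cot t)) has_real_derivative
            - 2 * (tan a * (- inverse ((sin t)\<^sup>2)) / (1 + (tan a * cot t)\<^sup>2))) (at t)"
      using st by (auto intro!: derivative_eq_intros DERIV_cot simp: field_simps)
    also have "- 2 * (tan a * (- inverse ((sin t)\<^sup>2)) / (1 + (tan a * cot t)\<^sup>2))
       = 2 * tan a / (sin t ^ 2 * (1 + (tan a * cot t)\<^sup>2))"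
      by (simp add: field_simps)
    also have "sin t ^ 2 * (1 + (tan a * cot t)\<^sup>2) = (cos a ^ 2 * sin t ^ 2 + sin a ^ 2 * cos t ^ 2) / cos a ^ 2"
      using st ca by (simp add: tan_def cot_def field_simps)
    also have "2 * tan a / \<dots> = 2 * sin (2 * a) / (1 - cos (2 * a) * cos (2 * t))"
      unfolding c2 sin_double using ca pos by (simp add: tan_def divide_simps power2_eq_square)
    finally show "((\<lambda>t. - 2 * arctan (tan a * cot t)) has_vector_derivative
        2 * sin (2 * a) / (1 - cos (2 * a) * cos (2 * t))) (at t within {pi / 2..\<theta>})"
      by (simp add: has_real_derivative_iff_has_vector_derivative has_vector_derivative_at_within)
  qed (use \<theta> in simp)
  then have "integral {pi / 2..\<theta>} (\<lambda>t. 2 * sin (2 * a) / (1 - cos (2 * a) * cos (2 * t)))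
     = - 2 * arctan (tan a * cot \<theta>)"
    by (simp add: integral_unique cot_def)
  moreover have "tan a * cot \<theta> = tan a / tan \<theta>"
    by (simp add: cot_altdef field_simps)
  ultimately show ?thesis
    using delta_has_derivative_integral[of a \<theta>] assms by simp
qed

text \<open>At \<open>a = pi / 2\<close> the integrand is unbounded near \<open>t = pi / 2\<close>,
  so uniform arguments fail. As \<open>a\<close> decreases to \<open>pi / 2\<close> the integrands
  increase pointwise, and monotone convergence applies once the integrals are known to
  converge.\<close>

lemma delta_tendsto_at_right:
  assumes \<theta>: "pi / 2 < \<theta>" "\<theta> < pi"
  shows "((\<lambda>a. delta a \<theta>) \<longlongrightarrow> delta (pi / 2) \<theta>) (at_right (pi / 2))"
proof (rule tendsto_at_right_sequentially)
  show "pi / 2 < pi" by simp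
next
  fix s :: "nat \<Rightarrow> real"
  assume s: "\<And>n. pi / 2 < s n" "\<And>n. s n < pi" "decseq s" "s \<longlonglongrightarrow> pi / 2"
  \<comment> \<open>The derivative from \<open>delta_has_derivative\<close> lies between 0 and
    \<open>pi\<close>; hence \<open>delta\<close> is increasing and Lipschitz up to the endpoint,
    which bounds the sequence and produces its limit \<open>l\<close>.\<close>
  have inc: "delta a \<theta> \<le> delta b \<theta>" "delta b \<theta> - delta a \<theta> \<le> pi * (b - a)"
    if "pi / 2 < a" "a \<le> b" "b < pi" for a b
  proof -
    have "\<exists>z. delta b \<theta> - delta a \<theta> = (b - a) * (2 * arctan (tan z / tan \<theta>)) \<and> a < z \<and> z < b" if "a < b"
      using MVT2[OF that, of "\<lambda>a. delta a \<theta>" "\<lambda>z. 2 * arctan (tan z / tan \<theta>)"]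
        delta_has_derivative[OF _ _ \<theta>] \<open>pi / 2 < a\<close> \<open>b < pi\<close> by auto
    moreover have "0 \<le> 2 * arctan (tan z / tan \<theta>)" "2 * arctan (tan z / tan \<theta>) \<le> pi"
      if "a < z" "z < b" for z
    proof -
      have "tan z < 0" using that \<open>pi / 2 < a\<close> \<open>b < pi\<close> by (intro tan_neg) auto
      moreover have "tan \<theta> < 0" using \<theta> by (rule tan_neg)
      ultimately show "0 \<le> 2 * arctan (tan z / tan \<theta>)"
        by (simp add: zero_le_divide_iff zero_le_arctan_iff)
      show "2 * arctan (tan z / tan \<theta>) \<le> pi"
        using arctan_ubound[of "tan z / tan \<theta>"] by simp
    qed
    ultimately have *: "0 \<le> delta b \<theta> - delta a \<theta> \<and> delta b \<theta> - delta a \<theta> \<le> (b - a) * pi" if "a < b"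
      using that by (metis diff_ge_0_iff_ge less_eq_real_def mult_left_mono mult_nonneg_nonneg)
    show "delta a \<theta> \<le> delta b \<theta>" "delta b \<theta> - delta a \<theta> \<le> pi * (b - a)"
      using * \<open>a \<le> b\<close> by (cases "a = b"; force simp: mult.commute)+
  qed
  have "decseq (\<lambda>n. delta (s n) \<theta>)"
    using s by (intro decseq_SucI inc) (auto simp: decseq_SucD)
  moreover have "delta (s 0) \<theta> - pi * pi \<le> delta (s n) \<theta>" for n
  proof -
    have "delta (s 0) \<theta> - delta (s n) \<theta> \<le> pi * (s 0 - s n)"
      using s by (intro inc) (auto simp: decseqD)
    also have "\<dots> \<le> pi * pi"
      using s(1)[of n] s(2)[of 0] by (intro mult_left_mono) (use pi_gt_zero in linarith)+
    finally show ?thesis by simp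
  qed
  ultimately obtain l where l: "(\<lambda>n. delta (s n) \<theta>) \<longlonglongrightarrow> l"
    using decseq_convergent[of "\<lambda>n. delta (s n) \<theta>" "delta (s 0) \<theta> - pi * pi"] by blast
  have less: "cos (2 * s n) * cos (2 * t) < 1" if "t \<in> {pi / 2..\<theta>}" for t n
    using that \<theta> s(1,2)[of n] by (intro cos2_less[of "s n" t \<theta>]) auto
  have "integral\<^sup>L lborel (\<lambda>t. indicator {pi / 2..\<theta>} t *\<^sub>R delta_integrand (pi / 2) t) = - l"
  proof (rule integral_monotone_convergence)
    show "integrable lborel (\<lambda>t. indicator {pi / 2..\<theta>} t *\<^sub>R delta_integrand (s n) t)" for n
      using delta_integrand_set_integrable[of "s n" \<theta>] s(1,2)[of n] \<theta>
      by (simp add: set_integrable_def)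
    show "AE t in lborel. mono (\<lambda>n. indicator {pi / 2..\<theta>} t *\<^sub>R delta_integrand (s n) t)"
    proof (intro AE_I2 monoI)
      fix t :: real and m n :: nat
      assume "m \<le> n"
      have "cos (2 * s n) \<le> cos (2 * s m)"
      proof -
        have "cos (2 * s k) = - cos (2 * s k - pi)" for k
          by (simp add: cos_diff)
        moreover have "cos (2 * s n - pi) \<ge> cos (2 * s m - pi)"
          using s(1)[of n] s(2)[of m] decseqD[OF s(3) \<open>m \<le> n\<close>]
          by (intro cos_monotone_0_pi_le) auto
        ultimately show ?thesis by simp
      qed
      then show "indicator {pi / 2..\<theta>} t *\<^sub>R delta_integrand (s m) t
               \<le> indicator {pi / 2..\<theta>} t *\<^sub>R delta_integrand (s n) t"
        using less by (auto simp: indicator_def intro!: delta_integrand_antimono)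
    qed
    \<comment> \<open>The point \<open>t = pi / 2\<close> has to be left out: there the argument of
      the logarithm in the limit function is 0.\<close>
    show "AE t in lborel. (\<lambda>n. indicator {pi / 2..\<theta>} t *\<^sub>R delta_integrand (s n) t)
            \<longlonglongrightarrow> indicator {pi / 2..\<theta>} t *\<^sub>R delta_integrand (pi / 2) t"
      using AE_lborel_singleton[of "pi / 2"]
    proof eventually_elim
      case (elim t)
      show ?case
      proof (cases "t \<in> {pi / 2..\<theta>}")
        case True
        with elim have "cos t < 0" using \<theta> cos_gt_zero_pi[of "pi - t"] by simp
        then have "cos (2 * (pi / 2)) * cos (2 * t) < 1"
          by (simp add: cos_double_cos)
        from isCont_tendsto_compose[OF isCont_delta_integrand(2)[OF this] s(4)]
        show ?thesis by (intro tendsto_intros)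
      qed simp
    qed
    have "(\<lambda>n. - delta (s n) \<theta>) \<longlonglongrightarrow> - l"
      using l by (intro tendsto_intros)
    then show "(\<lambda>n. integral\<^sup>L lborel (\<lambda>t. indicator {pi / 2..\<theta>} t *\<^sub>R delta_integrand (s n) t)) \<longlonglongrightarrow> - l"
      using \<theta> by (simp add: delta_eq_set_integral set_lebesgue_integral_def)
    show "(\<lambda>t. indicator {pi / 2..\<theta>} t *\<^sub>R delta_integrand (pi / 2) t) \<in> borel_measurable lborel"
      unfolding delta_integrand_def by measurable
  qed
  then have "delta (pi / 2) \<theta> = l"
    using \<theta> by (simp add: delta_eq_set_integral set_lebesgue_integral_def)
  with l show "(\<lambda>n. delta (s n) \<theta>) \<longlonglongrightarrow> delta (pi / 2) \<theta>" by simp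
qed

lemma delta_continuous_on:
  assumes \<theta>: "pi / 2 < \<theta>" "\<theta> < pi"
  shows "continuous_on {pi / 2..pi} (\<lambda>a. delta a \<theta>)"
  unfolding continuous_on_eq_continuous_within
proof
  fix a assume a: "a \<in> {pi / 2..pi}"
  show "continuous (at a within {pi / 2..pi}) (\<lambda>a. delta a \<theta>)"
  proof (cases "a = pi / 2")
    case True
    have "pi / 2 < pi" by simp
    then show ?thesis
      using delta_tendsto_at_right[OF \<theta>]
      by (simp add: True continuous_within at_within_Icc_at_right)
  next
    case False
    with a pi_gt_zero have "pi / 2 < a" "a < 3 * pi / 2" by (auto simp del: pi_gt_zero)
    from delta_isCont[OF this \<theta>] show ?thesis
      by (rule continuous_at_imp_continuous_at_within)
  qed
qed

text \<open>The map \<open>a \<mapsto> pi / 2 + l a\<close> is an involution: applying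
  \<open>l\<close> to its value returns \<open>a - pi / 2\<close>. So the derivatives of the two
  variable \<open>delta\<close> terms are \<open>2 * l a\<close> and
  \<open>2 * (a - pi / 2) * l' a\<close>, together the derivative of the product
  \<open>2 * l a * (a - pi / 2)\<close>. At \<open>a = pi\<close> the product vanishes, since
  \<open>l pi = 0\<close>, and the remaining values are the constants of the formula.\<close>

lemma delta_add_delta_complement:
  assumes \<alpha>: "pi / 2 < \<alpha>" "\<alpha> < pi" and \<theta>: "pi / 2 < \<theta>" "\<theta> < pi"
  defines "l \<equiv> \<lambda>a. arctan (tan a / tan \<theta>)"
  shows "delta \<alpha> \<theta> + delta (pi / 2 + l \<alpha>) \<theta> - delta (pi / 2) \<theta> - delta 0 \<theta> = 2 * l \<alpha> * (\<alpha> - pi / 2)"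
proof -
  define F where "F a = delta a \<theta> + delta (pi / 2 + l a) \<theta> - 2 * l a * (a - pi / 2)" for a
  have t\<theta>: "tan \<theta> < 0" using \<theta> by (rule tan_neg)
  have tan_le: "tan a \<le> 0" if "pi / 2 < a" "a \<le> pi" for a
    using tan_neg[of a] that by (cases "a = pi") auto
  have l_range: "0 \<le> l a" "l a < pi / 2" if "pi / 2 < a" "a \<le> pi" for a
    using t\<theta> tan_le[OF that] arctan_ubound by (auto simp: l_def divide_nonpos_neg)
  have l_pos: "0 < l a" if "pi / 2 < a" "a < pi" for a
    using t\<theta> tan_neg[OF that] by (simp add: l_def divide_neg_neg)
  have cos_neq: "cos a \<noteq> 0" if "pi / 2 < a" "a \<le> pi" for a
    using that cos_gt_zero_pi[of "pi - a"] by auto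
  have cont_l: "continuous_on {\<alpha>..pi} l"
    unfolding l_def using cos_neq \<alpha> t\<theta> by (intro continuous_intros) auto
  have "F pi = F \<alpha>"
  proof (rule DERIV_isconst_end[where f = F and a = \<alpha> and b = pi])
    have "continuous_on {\<alpha>..pi} (\<lambda>a. delta a \<theta>)"
      by (rule continuous_on_subset[OF delta_continuous_on[OF \<theta>]]) (use \<alpha> in auto)
    moreover have "continuous_on {\<alpha>..pi} (\<lambda>a. delta (pi / 2 + l a) \<theta>)"
    proof (rule continuous_on_compose2[OF delta_continuous_on[OF \<theta>], where f = "\<lambda>a. pi / 2 + l a"])
      show "continuous_on {\<alpha>..pi} (\<lambda>a. pi / 2 + l a)"
        by (intro continuous_intros cont_l)
      have "pi / 2 + l a \<in> {pi / 2..pi}" if "a \<in> {\<alpha>..pi}" for a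
        using that l_range[of a] \<alpha> by auto
      then show "(\<lambda>a. pi / 2 + l a) ` {\<alpha>..pi} \<subseteq> {pi / 2..pi}" by blast
    qed
    ultimately show "continuous_on {\<alpha>..pi} F"
      unfolding F_def[abs_def] by (intro continuous_on_add continuous_on_diff continuous_on_mult continuous_on_const continuous_on_id cont_l)
  next
    fix a assume a: "\<alpha> < a" "a < pi"
    define l' where "l' = inverse (1 + (tan a / tan \<theta>)\<^sup>2) * (inverse ((cos a)\<^sup>2) / tan \<theta>)"
    have a': "pi / 2 < a" using a \<alpha> by simp
    have dl: "(l has_real_derivative l') (at a)"
      unfolding l_def l'_def
      by (intro DERIV_chain2[OF DERIV_arctan] DERIV_cdivide DERIV_tan cos_neq) (use a a' in auto)
    \<comment> \<open>Both tangents are shifted by a right angle and become negative reciprocals;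
      this is the involution property.\<close>
    have "tan (pi / 2 + l a) / tan \<theta> = tan (a - pi / 2)"
    proof -
      have "tan (pi / 2 + l a) = - inverse (tan (l a))"
        using tan_cot[of "- l a"] by (simp add: add.commute tan_minus)
      moreover have "tan (a - pi / 2) = - inverse (tan a)"
        using tan_cot[of a] tan_minus[of "pi / 2 - a"] by simp
      ultimately show ?thesis
        using t\<theta> by (simp add: l_def tan_arctan inverse_eq_divide)
    qed
    then have arc: "arctan (tan (pi / 2 + l a) / tan \<theta>) = a - pi / 2"
      using a a' by (simp add: arctan_tan)
    have "((\<lambda>a. delta (pi / 2 + l a) \<theta>) has_real_derivative 2 * (a - pi / 2) * l') (at a)"
    proof (rule DERIV_chain2[of "\<lambda>a. delta a \<theta>", where g = "\<lambda>a. pi / 2 + l a"])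
      show "((\<lambda>a. delta a \<theta>) has_real_derivative 2 * (a - pi / 2)) (at (pi / 2 + l a))"
        using delta_has_derivative[of "pi / 2 + l a" \<theta>] l_pos[OF a' a(2)] l_range[of a] a a' \<theta>
        by (simp add: arc)
    qed (use dl in \<open>auto intro!: derivative_eq_intros\<close>)
    moreover have "((\<lambda>a. delta a \<theta>) has_real_derivative 2 * l a) (at a)"
      using delta_has_derivative[OF a' a(2) \<theta>] by (simp only: l_def)
    ultimately show "(F has_real_derivative 0) (at a)"
      unfolding F_def[abs_def] using dl
      by (auto intro!: derivative_eq_intros simp: algebra_simps)
  qed (use \<alpha> in simp)
  moreover have "delta pi \<theta> = delta 0 \<theta>"
  proof -
    have "delta_integrand pi = delta_integrand 0"
      by (simp add: delta_integrand_def fun_eq_iff)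
    then show ?thesis by (simp add: delta_def)
  qed
  ultimately show ?thesis
    by (simp add: F_def l_def)
qed

section \<open>The volume of one half of a Lambert cube\<close>

text \<open>Volume of a piece after the integrations over distance from the axis and over the angle
  about it; \<open>t\<close> is the tangent of the position on the axis, whose length is
  \<open>arctan \<nu>\<close>, and \<open>\<Lambda>\<close> stands for
  \<open>- tan \<alpha>\<close>. The argument of the arctangent comes from the slope of the dividing
  surface, see \<open>frame_cone_region\<close>.\<close>

definition lambert_part :: "real \<Rightarrow> real \<Rightarrow> real \<Rightarrow> real" where
  "lambert_part \<Lambda> \<nu> \<kappa> = integral {0..\<nu>} (\<lambda>t. \<kappa> / ((1 + t\<^sup>2) * sqrt (1 + \<kappa>\<^sup>2 + t\<^sup>2)) *
     arctan ((\<kappa>\<^sup>2 + 1 + \<nu> * t) / (\<kappa> * \<Lambda> * sqrt (1 + \<kappa>\<^sup>2 + t\<^sup>2)))) / 2"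

text \<open>What remains of the \<open>\<kappa>\<close>-derivative of the integrand of \<open>lambert_part\<close> (times \<open>\<kappa>\<close>) after splitting
  off a derivative with respect to \<open>t\<close>.\<close>
definition lambert_residue :: "real \<Rightarrow> real \<Rightarrow> real \<Rightarrow> real \<Rightarrow> real" where
  "lambert_residue \<Lambda> \<nu> \<kappa> t = (t\<^sup>2 - 1 - 2 * \<nu> * t) /
     (\<Lambda> * (1 + t\<^sup>2) * (1 + \<kappa>\<^sup>2 + t\<^sup>2 + ((\<kappa>\<^sup>2 + 1 + \<nu> * t) / (\<kappa> * \<Lambda>))\<^sup>2))"

text \<open>Used twice with the same \<open>u / s\<close>, once for the derivative in
  \<open>\<kappa>\<close> and once for that in \<open>t\<close>, so that the coefficients of the
  arctangent can be compared.\<close>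

lemma arctan_quotient_has_derivative:
  fixes g s u :: "real \<Rightarrow> real"
  assumes "(g has_real_derivative g') (at x)" "(s has_real_derivative s') (at x)"
    and "(u has_real_derivative u') (at x)" and "s x > 0" "A \<noteq> 0"
  shows "((\<lambda>x. g x / (A * s x) * arctan (u x / s x)) has_real_derivative
     (g' * s x - g x * s') / (A * (s x)\<^sup>2) * arctan (u x / s x)
      + g x * (u' * s x - u x * s') / (A * s x * ((s x)\<^sup>2 + (u x)\<^sup>2))) (at x)"
proof -
  have "((\<lambda>x. g x / (A * s x)) has_real_derivative (g' * (A * s x) - g x * (A * s')) / (A * s x * (A * s x))) (at x)"
    using assms by (intro DERIV_divide DERIV_cmult) auto
  moreover have "((\<lambda>x. arctan (u x / s x)) has_real_derivative
      inverse (1 + (u x / s x)\<^sup>2) * ((u' * s x - u x * s') / (s x * s x))) (at x)"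
    using assms by (intro DERIV_chain2[OF DERIV_arctan] DERIV_divide) auto
  ultimately have d: "((\<lambda>x. g x / (A * s x) * arctan (u x / s x)) has_real_derivative
     (g' * (A * s x) - g x * (A * s')) / (A * s x * (A * s x)) * arctan (u x / s x)
      + inverse (1 + (u x / s x)\<^sup>2) * ((u' * s x - u x * s') / (s x * s x)) * (g x / (A * s x))) (at x)"
    by (rule DERIV_mult)
  have e1: "(g' * (A * s x) - g x * (A * s')) / (A * s x * (A * s x)) = (g' * s x - g x * s') / (A * (s x)\<^sup>2)"
    using assms by (simp add: divide_simps power2_eq_square) (simp add: algebra_simps)
  have e2: "inverse (1 + (u x / s x)\<^sup>2) = (s x)\<^sup>2 / ((s x)\<^sup>2 + (u x)\<^sup>2)"
    using assms by (simp add: field_simps)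
  from d[unfolded e1 e2] show ?thesis
    using assms by (simp add: power2_eq_square mult_ac)
qed

text \<open>The \<open>\<kappa>\<close>-derivative of the integrand and the
  \<open>t\<close>-derivative of a suitable \<open>\<Phi>\<close> contain the same multiple of the
  same arctangent, so their difference is rational and equals the residue divided by
  \<open>\<kappa>\<close>. The boundary value of \<open>\<Phi>\<close> at \<open>\<nu>\<close> is an
  edge length times the derivative of the angle at that edge, by
  \<open>sqrt_quotient_has_derivative\<close>.\<close>

lemma lambert_part_has_derivative:
  assumes pos: "\<Lambda> > 0" "\<nu> > 0" "\<kappa> > 0"
  shows "(lambert_part \<Lambda> \<nu> has_real_derivative
     \<nu> / ((1 + \<kappa>\<^sup>2) * sqrt (1 + \<kappa>\<^sup>2 + \<nu>\<^sup>2)) * arctan (sqrt (1 + \<kappa>\<^sup>2 + \<nu>\<^sup>2) / (\<kappa> * \<Lambda>)) / 2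
     + integral {0..\<nu>} (lambert_residue \<Lambda> \<nu> \<kappa>) / (2 * \<kappa>)) (at \<kappa>)"
proof -
  define S :: "real \<Rightarrow> real \<Rightarrow> real" where "S \<kappa> t = sqrt (1 + \<kappa>\<^sup>2 + t\<^sup>2)" for \<kappa> t
  define U where "U \<kappa> t = (\<kappa>\<^sup>2 + 1 + \<nu> * t) / (\<kappa> * \<Lambda>)" for \<kappa> t
  define f where "f \<kappa> t = \<kappa> / ((1 + t\<^sup>2) * S \<kappa> t) * arctan (U \<kappa> t / S \<kappa> t)" for \<kappa> t
  define fx where "fx \<kappa> t = arctan (U \<kappa> t / S \<kappa> t) / S \<kappa> t ^ 3
     + \<kappa> * (2 / \<Lambda> - U \<kappa> t / \<kappa> - U \<kappa> t * \<kappa> / (S \<kappa> t)\<^sup>2) / ((1 + t\<^sup>2) * ((S \<kappa> t)\<^sup>2 + (U \<kappa> t)\<^sup>2))" for \<kappa> t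
  \<comment> \<open>Obtained from \<open>f\<close> by exchanging \<open>\<kappa>\<close> and
    \<open>t\<close> in the factor before the arctangent. Since \<open>S\<close> is symmetric in the
    two, the derivative of that factor in \<open>\<kappa>\<close> for \<open>f\<close> and in
    \<open>t\<close> for \<open>\<Phi>\<close> is \<open>1 / S ^ 3\<close> in both cases.\<close>
  define \<Phi> where "\<Phi> t = t / ((1 + \<kappa>\<^sup>2) * S \<kappa> t) * arctan (U \<kappa> t / S \<kappa> t)" for t
  have S: "S \<kappa> t > 0" "(S \<kappa> t)\<^sup>2 = 1 + \<kappa>\<^sup>2 + t\<^sup>2" "S \<kappa> t \<noteq> 0" for \<kappa> t
    unfolding S_def by (simp_all add: add_pos_nonneg add_nonneg_eq_0_iff)
  have SU: "(S \<kappa> t)\<^sup>2 + (U \<kappa> t)\<^sup>2 \<noteq> 0" for \<kappa> t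
    using S(1)[of \<kappa> t] by (metis sum_power2_eq_zero_iff less_irrefl)
  have at: "1 + t\<^sup>2 \<noteq> 0" for t :: real
    by (simp add: add_nonneg_eq_0_iff)
  have dS: "((\<lambda>\<kappa>. S \<kappa> t) has_real_derivative \<kappa> / S \<kappa> t) (at \<kappa>)"
           "(S \<kappa> has_real_derivative t / S \<kappa> t) (at t)" for \<kappa> t
    using S[of \<kappa> t] unfolding S_def
    by (auto intro!: derivative_eq_intros simp: field_simps)
  have dU: "((\<lambda>\<kappa>. U \<kappa> t) has_real_derivative 2 / \<Lambda> - U \<kappa> t / \<kappa>) (at \<kappa>)"
           "(U \<kappa> has_real_derivative \<nu> / (\<kappa> * \<Lambda>)) (at t)" if "\<kappa> > 0" for \<kappa> t
    using that pos unfolding U_def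
    by (auto intro!: derivative_eq_intros simp: field_simps power2_eq_square)
  have df: "((\<lambda>\<kappa>. f \<kappa> t) has_real_derivative fx \<kappa> t) (at \<kappa>)" if "\<kappa> > 0" for \<kappa> t
  proof -
    define U' s u where "U' = 2 / \<Lambda> - U \<kappa> t / \<kappa>" and "s = S \<kappa> t" and "u = U \<kappa> t"
    have s: "s\<^sup>2 = 1 + \<kappa>\<^sup>2 + t\<^sup>2" "s > 0" using S by (auto simp: s_def)
    have su: "s\<^sup>2 + u\<^sup>2 \<noteq> 0" using SU by (simp add: s_def u_def)
    have d: "((\<lambda>\<kappa>. f \<kappa> t) has_real_derivative
      (1 * s - \<kappa> * (\<kappa> / s)) / ((1 + t\<^sup>2) * s\<^sup>2) * arctan (u / s)
      + \<kappa> * (U' * s - u * (\<kappa> / s)) / ((1 + t\<^sup>2) * s * (s\<^sup>2 + u\<^sup>2))) (at \<kappa>)"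
      unfolding f_def U'_def s_def u_def using S[of \<kappa> t] at[of t] that
      by (intro arctan_quotient_has_derivative dS dU DERIV_ident) auto
    have e1: "(1 * s - \<kappa> * (\<kappa> / s)) / ((1 + t\<^sup>2) * s\<^sup>2) = 1 / s ^ 3"
    proof -
      have "1 * s - \<kappa> * (\<kappa> / s) = (s\<^sup>2 - \<kappa>\<^sup>2) / s"
        using s(2) by (simp add: field_simps power2_eq_square)
      also have "s\<^sup>2 - \<kappa>\<^sup>2 = 1 + t\<^sup>2" using s by simp
      finally show ?thesis
        using s(2) at[of t] by (simp add: power2_eq_square power3_eq_cube)
    qed
    have e2: "U' * s - u * (\<kappa> / s) = s * (U' - u * \<kappa> / s\<^sup>2)"
      using s(2) by (simp add: field_simps power2_eq_square)
    from d[unfolded e1 e2] show ?thesis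
      using s(2) by (simp add: fx_def U'_def s_def[symmetric] u_def[symmetric])
  qed
  have cont: "continuous_on ({0<..} \<times> cbox 0 \<nu>) (\<lambda>(\<kappa>, t). fx \<kappa> t)"
  proof -
    have *: "continuous_on ({0<..} \<times> cbox 0 \<nu>) (\<lambda>p. U (fst p) (snd p))"
            "continuous_on ({0<..} \<times> cbox 0 \<nu>) (\<lambda>p. S (fst p) (snd p))"
      unfolding S_def U_def using pos by (intro continuous_intros ballI; auto)+
    show ?thesis
      unfolding case_prod_beta fx_def
      by (intro continuous_intros * ballI) (use S(1,3) SU at pos in auto)
  qed
  have contf: "continuous_on T (f \<kappa>)" "continuous_on T (lambert_residue \<Lambda> \<nu> \<kappa>)" if "\<kappa> > 0" for \<kappa> T
  proof -
    have *: "continuous_on T (U \<kappa>)" "continuous_on T (S \<kappa>)"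
      unfolding S_def[abs_def] U_def[abs_def] using pos that by (intro continuous_intros ballI; auto)+
    then show "continuous_on T (f \<kappa>)"
      unfolding f_def[abs_def] using S(1,3) at by (intro continuous_intros) auto
    have "lambert_residue \<Lambda> \<nu> \<kappa> = (\<lambda>t. (t\<^sup>2 - 1 - 2 * \<nu> * t) / (\<Lambda> * (1 + t\<^sup>2) * ((S \<kappa> t)\<^sup>2 + (U \<kappa> t)\<^sup>2)))"
      by (simp add: lambert_residue_def[abs_def] S U_def)
    then show "continuous_on T (lambert_residue \<Lambda> \<nu> \<kappa>)"
      using SU at pos * by (auto intro!: continuous_intros)
  qed
  have "((\<lambda>\<kappa>. integral (cbox 0 \<nu>) (f \<kappa>)) has_real_derivative integral (cbox 0 \<nu>) (fx \<kappa>)) (at \<kappa> within {0<..})"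
  proof (rule leibniz_rule_field_derivative)
    show "((\<lambda>\<kappa>. f \<kappa> t) has_real_derivative fx \<kappa> t) (at \<kappa> within {0<..})" if "\<kappa> \<in> {0<..}" for \<kappa> t
      using df[of \<kappa> t] that by (auto intro: has_field_derivative_at_within)
    show "f \<kappa> integrable_on cbox 0 \<nu>" if "\<kappa> \<in> {0<..}" for \<kappa>
      using contf(1)[of \<kappa>] that by (intro integrable_continuous) auto
  qed (use cont pos in auto)
  then have main: "((\<lambda>\<kappa>. integral {0..\<nu>} (f \<kappa>)) has_real_derivative integral {0..\<nu>} (fx \<kappa>)) (at \<kappa>)"
    using pos by (simp add: at_within_open[of _ "{0<..}"])
  have "((\<lambda>t. fx \<kappa> t - lambert_residue \<Lambda> \<nu> \<kappa> t / \<kappa>) has_integral \<Phi> \<nu> - \<Phi> 0) {0..\<nu>}"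
  proof (rule fundamental_theorem_of_calculus)
    fix t
    define U' s u D where "U' = \<nu> / (\<kappa> * \<Lambda>)" and "s = S \<kappa> t" and "u = U \<kappa> t" and "D = 1 + \<kappa>\<^sup>2"
    have s: "s\<^sup>2 = D + t\<^sup>2" "s > 0" using S by (auto simp: s_def D_def)
    have su: "s\<^sup>2 + u\<^sup>2 \<noteq> 0" using SU by (simp add: s_def u_def)
    have D: "D > 0" by (simp add: D_def add_pos_nonneg)
    have d: "(\<Phi> has_real_derivative
      (1 * s - t * (t / s)) / (D * s\<^sup>2) * arctan (u / s)
      + t * (U' * s - u * (t / s)) / (D * s * (s\<^sup>2 + u\<^sup>2))) (at t)"
      unfolding \<Phi>_def[abs_def] U'_def s_def u_def D_def[symmetric] using S[of \<kappa> t] D pos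
      by (intro arctan_quotient_has_derivative dS dU DERIV_ident) auto
    have e1: "(1 * s - t * (t / s)) / (D * s\<^sup>2) = 1 / s ^ 3"
    proof -
      have "1 * s - t * (t / s) = (s\<^sup>2 - t\<^sup>2) / s"
        using s(2) by (simp add: field_simps power2_eq_square)
      also have "s\<^sup>2 - t\<^sup>2 = D" using s by simp
      finally show ?thesis
        using s(2) D by (simp add: power2_eq_square power3_eq_cube)
    qed
    have e2: "U' * s - u * (t / s) = s * (U' - u * t / s\<^sup>2)"
      using s(2) by (simp add: field_simps power2_eq_square)
    from d[unfolded e1 e2] have d\<Phi>: "(\<Phi> has_real_derivative
        arctan (u / s) / s ^ 3 + t * (U' - u * t / s\<^sup>2) / (D * (s\<^sup>2 + u\<^sup>2))) (at t)"
      using s(2) by simp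
    define A where "A = 1 + t\<^sup>2"
    have A: "A > 0" by (simp add: A_def add_pos_nonneg)
    \<comment> \<open>The comparison of the rational terms with the common denominator
      \<open>s^2 + u^2\<close> removed. The terms in \<open>u\<close> and \<open>s\<close> cancel
      completely, which is why the residue has such a simple numerator.\<close>
    have q: "\<kappa> * (2 / \<Lambda> - u / \<kappa> - u * \<kappa> / s\<^sup>2) / A - t * (U' - u * t / s\<^sup>2) / D
        = (t\<^sup>2 - 1 - 2 * \<nu> * t) / (\<kappa> * \<Lambda> * A)"
    proof -
      have "t\<^sup>2 / (s\<^sup>2 * D) - \<kappa>\<^sup>2 / (s\<^sup>2 * A) = (t\<^sup>2 - \<kappa>\<^sup>2) / (D * A)"
      proof -
        have "t\<^sup>2 / (s\<^sup>2 * D) - \<kappa>\<^sup>2 / (s\<^sup>2 * A) = (t\<^sup>2 * A - \<kappa>\<^sup>2 * D) / (s\<^sup>2 * (D * A))"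
          using s(2) D A by (simp add: divide_simps)
        also have "t\<^sup>2 * A - \<kappa>\<^sup>2 * D = s\<^sup>2 * (t\<^sup>2 - \<kappa>\<^sup>2)"
          unfolding s D_def A_def by algebra
        finally show ?thesis using s(2) by simp
      qed
      moreover have "\<kappa> * (2 / \<Lambda> - u / \<kappa> - u * \<kappa> / s\<^sup>2) / A - t * (U' - u * t / s\<^sup>2) / D
         = (2 * \<kappa> / \<Lambda> - u) / A - t * U' / D + u * (t\<^sup>2 / (s\<^sup>2 * D) - \<kappa>\<^sup>2 / (s\<^sup>2 * A))"
        using pos s(2) D A by (simp add: field_simps power2_eq_square)
      moreover have "(2 * \<kappa> / \<Lambda> - u) / A - t * U' / D + u * ((t\<^sup>2 - \<kappa>\<^sup>2) / (D * A))
         = (D * (2 * \<kappa> / \<Lambda> - u) - A * (t * U') + u * (t\<^sup>2 - \<kappa>\<^sup>2)) / (D * A)"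
        using D A by (simp add: field_simps)
      moreover have "t * U' = u - D / (\<kappa> * \<Lambda>)"
        using pos by (simp add: U'_def u_def U_def D_def field_simps)
      moreover have "D * (2 * \<kappa> / \<Lambda> - u) - A * (u - D / (\<kappa> * \<Lambda>)) + u * (t\<^sup>2 - \<kappa>\<^sup>2)
         = D * (2 * \<kappa> / \<Lambda> + A / (\<kappa> * \<Lambda>) - 2 * u)"
        by (simp add: D_def A_def algebra_simps)
      moreover have "2 * \<kappa> / \<Lambda> + A / (\<kappa> * \<Lambda>) - 2 * u = (t\<^sup>2 - 1 - 2 * \<nu> * t) / (\<kappa> * \<Lambda>)"
        using pos by (simp add: u_def U_def A_def field_simps power2_eq_square)
      ultimately show ?thesis
        using D by simp
    qed
    have "fx \<kappa> t - lambert_residue \<Lambda> \<nu> \<kappa> t / \<kappa> = arctan (u / s) / s ^ 3 + t * (U' - u * t / s\<^sup>2) / (D * (s\<^sup>2 + u\<^sup>2))"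
    proof -
      have "lambert_residue \<Lambda> \<nu> \<kappa> t / \<kappa> = (t\<^sup>2 - 1 - 2 * \<nu> * t) / (\<kappa> * \<Lambda> * (1 + t\<^sup>2)) / (s\<^sup>2 + u\<^sup>2)"
        by (simp add: lambert_residue_def s D_def u_def U_def mult_ac)
      also have "\<dots> = \<kappa> * (2 / \<Lambda> - u / \<kappa> - u * \<kappa> / s\<^sup>2) / ((1 + t\<^sup>2) * (s\<^sup>2 + u\<^sup>2)) - t * (U' - u * t / s\<^sup>2) / (D * (s\<^sup>2 + u\<^sup>2))"
        unfolding q[unfolded A_def, symmetric] by (simp add: diff_divide_distrib)
      finally show ?thesis
        by (simp add: fx_def s_def[symmetric] u_def[symmetric])
    qed
    with d\<Phi> show "(\<Phi> has_vector_derivative fx \<kappa> t - lambert_residue \<Lambda> \<nu> \<kappa> t / \<kappa>) (at t within {0..\<nu>})"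
      by (simp add: has_real_derivative_iff_has_vector_derivative has_vector_derivative_at_within)
  qed (use pos in simp)
  moreover have "((\<lambda>t. lambert_residue \<Lambda> \<nu> \<kappa> t / \<kappa>) has_integral integral {0..\<nu>} (lambert_residue \<Lambda> \<nu> \<kappa>) / \<kappa>) {0..\<nu>}"
    using contf(2)[OF pos(3)] integrable_continuous_real by (intro has_integral_divide integrable_integral) auto
  ultimately have "((\<lambda>t. fx \<kappa> t - lambert_residue \<Lambda> \<nu> \<kappa> t / \<kappa> + lambert_residue \<Lambda> \<nu> \<kappa> t / \<kappa>) has_integral
      \<Phi> \<nu> - \<Phi> 0 + integral {0..\<nu>} (lambert_residue \<Lambda> \<nu> \<kappa>) / \<kappa>) {0..\<nu>}"
    by (rule has_integral_add)
  then have "integral {0..\<nu>} (fx \<kappa>) = \<Phi> \<nu> - \<Phi> 0 + integral {0..\<nu>} (lambert_residue \<Lambda> \<nu> \<kappa>) / \<kappa>"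
    by (simp add: integral_unique)
  \<comment> \<open>At the end of the axis the numerator of \<open>U\<close> is itself the square of
    \<open>S\<close>, so the quotient simplifies to the tangent of an edge length.\<close>
  moreover have "U \<kappa> \<nu> / S \<kappa> \<nu> = sqrt (1 + \<kappa>\<^sup>2 + \<nu>\<^sup>2) / (\<kappa> * \<Lambda>)"
  proof -
    have "U \<kappa> \<nu> = (S \<kappa> \<nu>)\<^sup>2 / (\<kappa> * \<Lambda>)" unfolding S(2) U_def by (simp add: power2_eq_square add_ac)
    then show ?thesis
      using S(1)[of \<kappa> \<nu>] unfolding S_def[symmetric] by (simp add: power2_eq_square)
  qed
  then have "\<Phi> \<nu> - \<Phi> 0 = \<nu> / ((1 + \<kappa>\<^sup>2) * sqrt (1 + \<kappa>\<^sup>2 + \<nu>\<^sup>2)) * arctan (sqrt (1 + \<kappa>\<^sup>2 + \<nu>\<^sup>2) / (\<kappa> * \<Lambda>))"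
    by (simp add: \<Phi>_def S_def)
  moreover have "lambert_part \<Lambda> \<nu> = (\<lambda>\<kappa>. integral {0..\<nu>} (f \<kappa>) / 2)"
    by (simp add: lambert_part_def[abs_def] f_def[abs_def] S_def U_def mult_ac)
  ultimately show ?thesis
    using DERIV_cdivide[OF main, of 2] by (simp add: add_divide_distrib mult.commute)
qed

text \<open>The reflection \<open>z \<mapsto> l - z\<close> of the edge is \<open>t \<mapsto> (\<nu> - t) / (1 + \<nu> * t)\<close> for \<open>t = tan z\<close>, \<open>\<nu> = tan l\<close>.\<close>
lemma lambert_residue_integral_symmetric:
  assumes pos: "\<Lambda> > 0" "\<nu> > 0" "\<kappa> > 0" "\<kappa>' > 0"
    and rel: "\<kappa>\<^sup>2 * \<kappa>'\<^sup>2 * (1 + \<Lambda>\<^sup>2) = 1 + \<nu>\<^sup>2"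
  shows "integral {0..\<nu>} (lambert_residue \<Lambda> \<nu> \<kappa>) = integral {0..\<nu>} (lambert_residue \<Lambda> \<nu> \<kappa>')"
proof -
  define g where "g t = (\<nu> - t) / (1 + \<nu> * t)" for t
  define E where "E = 1 + \<nu>\<^sup>2"
  have E: "E > 0" by (simp add: E_def add_pos_nonneg)
  have cont: "continuous_on T (lambert_residue \<Lambda> \<nu> \<kappa>)" for T
  proof -
    have "1 + t\<^sup>2 \<noteq> 0" for t :: real by (simp add: add_nonneg_eq_0_iff)
    moreover have "1 + \<kappa>\<^sup>2 + t\<^sup>2 + u\<^sup>2 \<noteq> 0" for t u :: real
      by (smt (verit) zero_le_power2)
    ultimately show ?thesis
      unfolding lambert_residue_def[abs_def] using pos by (intro continuous_intros) auto
  qed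
  have key: "lambert_residue \<Lambda> \<nu> \<kappa> (g t) * (- E / (1 + \<nu> * t)\<^sup>2) = - lambert_residue \<Lambda> \<nu> \<kappa>' t"
    if "0 \<le> t" for t
  proof -
    define p q where "p = 1 + \<nu> * t" and "q = E / p\<^sup>2"
    have p: "p > 0" using that pos by (simp add: p_def add_pos_nonneg)
    have q: "q > 0" using p E by (simp add: q_def)
    have x: "g t = (\<nu> - t) / p" by (simp add: g_def p_def)
    have 1: "1 + (g t)\<^sup>2 = (1 + t\<^sup>2) * q"
    proof -
      have "p\<^sup>2 + (\<nu> - t)\<^sup>2 = (1 + t\<^sup>2) * E" unfolding p_def E_def by algebra
      moreover have "1 + (g t)\<^sup>2 = (p\<^sup>2 + (\<nu> - t)\<^sup>2) / p\<^sup>2" using p unfolding x by (simp add: field_simps)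
      ultimately show ?thesis by (simp add: q_def)
    qed
    have 2: "(g t)\<^sup>2 - 1 - 2 * \<nu> * g t = (t\<^sup>2 - 1 - 2 * \<nu> * t) * q"
    proof -
      have "(\<nu> - t)\<^sup>2 - p\<^sup>2 - 2 * \<nu> * (\<nu> - t) * p = (t\<^sup>2 - 1 - 2 * \<nu> * t) * E"
        unfolding p_def E_def by algebra
      moreover have "(g t)\<^sup>2 - 1 - 2 * \<nu> * g t = ((\<nu> - t)\<^sup>2 - p\<^sup>2 - 2 * \<nu> * (\<nu> - t) * p) / p\<^sup>2"
        using p unfolding x by (simp add: field_simps power2_eq_square)
      ultimately show ?thesis by (simp add: q_def)
    qed
    \<comment> \<open>The only place where \<open>rel\<close> enters: with
      \<open>E = a * b * (1 + l)\<close> the denominator for \<open>\<kappa>\<close> at the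
      reflected point becomes that for \<open>\<kappa>'\<close> at \<open>t\<close>, up to the
      factor \<open>q\<close>.\<close>
    have 3: "1 + \<kappa>\<^sup>2 + (g t)\<^sup>2 + ((\<kappa>\<^sup>2 + 1 + \<nu> * g t) / (\<kappa> * \<Lambda>))\<^sup>2
       = (1 + \<kappa>'\<^sup>2 + t\<^sup>2 + ((\<kappa>'\<^sup>2 + 1 + \<nu> * t) / (\<kappa>' * \<Lambda>))\<^sup>2) * q"
    proof -
      define a b l where "a = \<kappa>\<^sup>2" and "b = \<kappa>'\<^sup>2" and "l = \<Lambda>\<^sup>2"
      have ab: "a > 0" "b > 0" "l > 0" using pos by (auto simp: a_def b_def l_def)
      have e: "E = a * b * (1 + l)" using rel by (simp add: E_def a_def b_def l_def)
      have "1 + \<nu> * g t = E / p"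
        using p unfolding x E_def by (simp add: field_simps power2_eq_square) (simp add: p_def algebra_simps)
      then have "\<kappa>\<^sup>2 + ((\<kappa>\<^sup>2 + 1 + \<nu> * g t) / (\<kappa> * \<Lambda>))\<^sup>2 = a + (a + E / p)\<^sup>2 / (a * l)"
        by (simp add: a_def l_def power_divide power_mult_distrib add.assoc)
      also have "a + (a + E / p)\<^sup>2 / (a * l) = (b + (b + p)\<^sup>2 / (b * l)) * (E / p\<^sup>2)"
        unfolding e using ab p by (simp add: divide_simps power2_eq_square) (simp add: algebra_simps)
      also have "b + (b + p)\<^sup>2 / (b * l) = \<kappa>'\<^sup>2 + ((\<kappa>'\<^sup>2 + 1 + \<nu> * t) / (\<kappa>' * \<Lambda>))\<^sup>2"
        by (simp add: b_def l_def p_def power_divide power_mult_distrib add.assoc)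
      finally have "\<kappa>\<^sup>2 + ((\<kappa>\<^sup>2 + 1 + \<nu> * g t) / (\<kappa> * \<Lambda>))\<^sup>2
        = (\<kappa>'\<^sup>2 + ((\<kappa>'\<^sup>2 + 1 + \<nu> * t) / (\<kappa>' * \<Lambda>))\<^sup>2) * q" by (simp add: q_def)
      with 1 show ?thesis by (simp add: algebra_simps)
    qed
    show ?thesis
      unfolding lambert_residue_def 1 2 3 p_def[symmetric] using q pos
      by (simp add: q_def[symmetric])
  qed
  define G where "G x = integral {0..x} (lambert_residue \<Lambda> \<nu> \<kappa>)" for x
  have g_in: "g t \<in> {0..\<nu>}" if "t \<in> {0..\<nu>}" for t
  proof -
    have "1 + \<nu> * t > 0" using that pos by (simp add: add_pos_nonneg)
    moreover have "\<nu> - t \<le> \<nu> * (1 + \<nu> * t)"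
      using that pos by (simp add: algebra_simps)
    ultimately show ?thesis using that by (simp add: g_def divide_le_eq)
  qed
  have "((\<lambda>t. - lambert_residue \<Lambda> \<nu> \<kappa>' t) has_integral G (g \<nu>) - G (g 0)) {0..\<nu>}"
  proof (rule fundamental_theorem_of_calculus)
    fix t assume t: "t \<in> {0..\<nu>}"
    have p: "1 + \<nu> * t > 0" using t pos by (simp add: add_pos_nonneg)
    have "(g has_real_derivative - E / (1 + \<nu> * t)\<^sup>2) (at t within {0..\<nu>})"
      unfolding g_def[abs_def] E_def using p
      by (auto intro!: derivative_eq_intros simp: power2_eq_square algebra_simps divide_simps)
    moreover have "(G has_real_derivative lambert_residue \<Lambda> \<nu> \<kappa> (g t)) (at (g t) within {0..\<nu>})"
      unfolding G_def[abs_def] using integral_has_real_derivative[OF cont g_in[OF t]] .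
    then have "(G has_real_derivative lambert_residue \<Lambda> \<nu> \<kappa> (g t)) (at (g t) within g ` {0..\<nu>})"
      by (rule has_field_derivative_subset) (use g_in in auto)
    ultimately have d: "((G \<circ> g) has_real_derivative lambert_residue \<Lambda> \<nu> \<kappa> (g t) * (- E / (1 + \<nu> * t)\<^sup>2)) (at t within {0..\<nu>})"
      by (intro DERIV_image_chain) auto
    have "0 \<le> t" using t by simp
    from d[unfolded key[OF this]] show "((\<lambda>t. G (g t)) has_vector_derivative - lambert_residue \<Lambda> \<nu> \<kappa>' t) (at t within {0..\<nu>})"
      by (simp add: o_def has_real_derivative_iff_has_vector_derivative)
  qed (use pos in simp)
  moreover have "g \<nu> = 0" "g 0 = \<nu>" by (simp_all add: g_def)
  ultimately have "((\<lambda>t. - lambert_residue \<Lambda> \<nu> \<kappa>' t) has_integral - G \<nu>) {0..\<nu>}"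
    by (simp add: G_def)
  from has_integral_neg[OF this] have "(lambert_residue \<Lambda> \<nu> \<kappa>' has_integral G \<nu>) {0..\<nu>}"
    by simp
  from integral_unique[OF this] show ?thesis
    by (simp add: G_def)
qed

section \<open>Limits of a piece as its parameter tends to 0 and to infinity, and the sum of two
  pieces\<close>

lemma integral_inverse_one_plus_square:
  assumes "0 \<le> (b::real)"
  shows "((\<lambda>t. 1 / (1 + t\<^sup>2)) has_integral arctan b) {0..b}"
proof -
  have "((\<lambda>t. 1 / (1 + t\<^sup>2)) has_integral arctan b - arctan 0) {0..b}"
    by (rule fundamental_theorem_of_calculus[OF assms])
       (auto simp: has_real_derivative_iff_has_vector_derivative[symmetric] inverse_eq_divide
         intro!: derivative_eq_intros)
  then show ?thesis by simp
qed

text \<open>The constant bound dominates the integrands as \<open>\<kappa>\<close> tends to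
  infinity; the bound linear in \<open>\<kappa>\<close> makes the integral vanish as
  \<open>\<kappa>\<close> tends to 0.\<close>

lemma lambert_part_integrand_bound:
  assumes "\<kappa> > 0"
  shows "\<bar>\<kappa> / ((1 + t\<^sup>2) * sqrt (1 + \<kappa>\<^sup>2 + t\<^sup>2)) * arctan x\<bar> \<le> pi / 2"
    "\<bar>\<kappa> / ((1 + t\<^sup>2) * sqrt (1 + \<kappa>\<^sup>2 + t\<^sup>2)) * arctan x\<bar> \<le> \<kappa> * (pi / 2)"
proof -
  have "\<bar>arctan x\<bar> \<le> pi / 2" using arctan_bounded[of x] by linarith
  have s: "sqrt (1 + \<kappa>\<^sup>2 + t\<^sup>2) \<ge> \<kappa>" "sqrt (1 + \<kappa>\<^sup>2 + t\<^sup>2) \<ge> 1"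
    by (simp_all add: real_le_rsqrt)
  have "1 * x \<le> (1 + t\<^sup>2) * x" if "x \<ge> 0" for x :: real
    using that by (intro mult_right_mono) auto
  then have d: "(1 + t\<^sup>2) * sqrt (1 + \<kappa>\<^sup>2 + t\<^sup>2) \<ge> \<kappa>" "(1 + t\<^sup>2) * sqrt (1 + \<kappa>\<^sup>2 + t\<^sup>2) \<ge> 1"
    using s assms by (metis dual_order.trans less_imp_le mult_1 zero_le_one)+
  have c: "\<bar>\<kappa> / ((1 + t\<^sup>2) * sqrt (1 + \<kappa>\<^sup>2 + t\<^sup>2))\<bar> \<le> 1" "\<bar>\<kappa> / ((1 + t\<^sup>2) * sqrt (1 + \<kappa>\<^sup>2 + t\<^sup>2))\<bar> \<le> \<kappa>"
    using d assms by (auto simp: divide_le_eq)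
  show "\<bar>\<kappa> / ((1 + t\<^sup>2) * sqrt (1 + \<kappa>\<^sup>2 + t\<^sup>2)) * arctan x\<bar> \<le> pi / 2"
    unfolding abs_mult using mult_mono[OF c(1) \<open>\<bar>arctan x\<bar> \<le> pi / 2\<close>] by simp
  show "\<bar>\<kappa> / ((1 + t\<^sup>2) * sqrt (1 + \<kappa>\<^sup>2 + t\<^sup>2)) * arctan x\<bar> \<le> \<kappa> * (pi / 2)"
    unfolding abs_mult using mult_mono[OF c(2) \<open>\<bar>arctan x\<bar> \<le> pi / 2\<close>] assms by simp
qed

lemma lambert_part_integrand_continuous_on:
  assumes "\<Lambda> > 0" "\<nu> > 0" "\<kappa> > 0"
  shows "continuous_on T (\<lambda>t. \<kappa> / ((1 + t\<^sup>2) * sqrt (1 + \<kappa>\<^sup>2 + t\<^sup>2)) *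
     arctan ((\<kappa>\<^sup>2 + 1 + \<nu> * t) / (\<kappa> * \<Lambda> * sqrt (1 + \<kappa>\<^sup>2 + t\<^sup>2))))"
proof -
  have "1 + t\<^sup>2 \<noteq> 0" "1 + \<kappa>\<^sup>2 + t\<^sup>2 \<noteq> 0" for t :: real by (simp_all add: add_nonneg_eq_0_iff)
  then show ?thesis using assms by (intro continuous_intros) auto
qed

lemma lambert_part_tendsto_0:
  assumes pos: "\<Lambda> > 0" "\<nu> > 0" and k: "k \<longlonglongrightarrow> 0" "\<And>n::nat. k n > 0"
  shows "(\<lambda>n. lambert_part \<Lambda> \<nu> (k n)) \<longlonglongrightarrow> 0"
proof (rule Lim_null_comparison)
  show "\<forall>\<^sub>F n in sequentially. norm (lambert_part \<Lambda> \<nu> (k n)) \<le> k n * (pi / 2) * \<nu> / 2"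
  proof (intro always_eventually allI)
    fix n
    have "norm (integral {0..\<nu>} (\<lambda>t. k n / ((1 + t\<^sup>2) * sqrt (1 + (k n)\<^sup>2 + t\<^sup>2)) *
       arctan (((k n)\<^sup>2 + 1 + \<nu> * t) / (k n * \<Lambda> * sqrt (1 + (k n)\<^sup>2 + t\<^sup>2))))) \<le> k n * (pi / 2) * (\<nu> - 0)"
      using lambert_part_integrand_bound(2)[OF k(2)] pos k(2)
      by (intro integral_bound lambert_part_integrand_continuous_on) (auto simp del: abs_mult)
    then show "norm (lambert_part \<Lambda> \<nu> (k n)) \<le> k n * (pi / 2) * \<nu> / 2"
      by (simp add: lambert_part_def)
  qed
  have "(\<lambda>n. k n * (pi / 2) * \<nu> / 2) \<longlonglongrightarrow> 0 * (pi / 2) * \<nu> / 2"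
    by (intro tendsto_intros k) auto
  then show "(\<lambda>n. k n * (pi / 2) * \<nu> / 2) \<longlonglongrightarrow> 0" by simp
qed

lemma lambert_part_tendsto_at_top:
  assumes pos: "\<Lambda> > 0" "\<nu> > 0"
  shows "(\<lambda>n. lambert_part \<Lambda> \<nu> (real (Suc n))) \<longlonglongrightarrow> arctan \<nu> * arctan (1 / \<Lambda>) / 2"
proof -
  define f where "f n t = (let \<kappa> = real (Suc n) in \<kappa> / ((1 + t\<^sup>2) * sqrt (1 + \<kappa>\<^sup>2 + t\<^sup>2)) *
     arctan ((\<kappa>\<^sup>2 + 1 + \<nu> * t) / (\<kappa> * \<Lambda> * sqrt (1 + \<kappa>\<^sup>2 + t\<^sup>2))))" for n t
  have "(\<lambda>n. integral {0..\<nu>} (f n)) \<longlonglongrightarrow> integral {0..\<nu>} (\<lambda>t. 1 / (1 + t\<^sup>2) * arctan (1 / \<Lambda>))"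
  proof (rule dominated_convergence)
    show "f n integrable_on {0..\<nu>}" for n
      unfolding f_def Let_def using pos
      by (intro integrable_continuous_real lambert_part_integrand_continuous_on) auto
    show "(\<lambda>t. pi / 2) integrable_on {0..\<nu>}" by (rule integrable_const_ivl)
    show "norm (f n t) \<le> pi / 2" for n t
      unfolding f_def Let_def real_norm_def by (rule lambert_part_integrand_bound) simp
    fix t assume "t \<in> {0..\<nu>}"
    define c where "c = 1 + t\<^sup>2"
    have c: "c > 0" by (simp add: c_def add_pos_nonneg)
    have "((\<lambda>x::real. x / (c * sqrt (x\<^sup>2 + c))) \<longlongrightarrow> 1 / c) at_top"
      using c by real_asymp (simp add: inverse_eq_divide)
    then have "((\<lambda>x::real. x / ((1 + t\<^sup>2) * sqrt (1 + x\<^sup>2 + t\<^sup>2))) \<longlongrightarrow> 1 / (1 + t\<^sup>2)) at_top"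
      by (simp add: c_def add_ac)
    moreover have "((\<lambda>x::real. (x\<^sup>2 + 1 + \<nu> * t) / (x * \<Lambda> * sqrt (x\<^sup>2 + c))) \<longlongrightarrow> 1 / \<Lambda>) at_top"
      using c pos by real_asymp (simp add: inverse_eq_divide)
    then have "((\<lambda>x::real. (x\<^sup>2 + 1 + \<nu> * t) / (x * \<Lambda> * sqrt (1 + x\<^sup>2 + t\<^sup>2))) \<longlongrightarrow> 1 / \<Lambda>) at_top"
      by (simp add: c_def add_ac)
    ultimately have "((\<lambda>x. x / ((1 + t\<^sup>2) * sqrt (1 + x\<^sup>2 + t\<^sup>2)) *
       arctan ((x\<^sup>2 + 1 + \<nu> * t) / (x * \<Lambda> * sqrt (1 + x\<^sup>2 + t\<^sup>2)))) \<longlongrightarrow> 1 / (1 + t\<^sup>2) * arctan (1 / \<Lambda>)) at_top"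
      by (intro tendsto_mult tendsto_arctan)
    moreover have "filterlim (\<lambda>n. real (Suc n)) at_top sequentially"
      by (rule filterlim_compose[OF filterlim_real_sequentially filterlim_Suc])
    ultimately show "(\<lambda>n. f n t) \<longlonglongrightarrow> 1 / (1 + t\<^sup>2) * arctan (1 / \<Lambda>)"
      unfolding f_def Let_def by (rule filterlim_compose)
  qed
  also have "integral {0..\<nu>} (\<lambda>t. 1 / (1 + t\<^sup>2) * arctan (1 / \<Lambda>)) = arctan \<nu> * arctan (1 / \<Lambda>)"
    by (rule integral_unique[OF has_integral_mult_left[OF integral_inverse_one_plus_square]])
       (use pos in simp)
  finally have "(\<lambda>n. integral {0..\<nu>} (f n) / 2) \<longlonglongrightarrow> arctan \<nu> * arctan (1 / \<Lambda>) / 2"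
    by (rule tendsto_divide[OF _ tendsto_const]) simp
  then show ?thesis
    unfolding lambert_part_def f_def[abs_def] Let_def .
qed

text \<open>The function is the essential angle away from the axis that belongs to
  \<open>\<kappa>\<close>, see \<open>angle_from_cosine\<close>. Its derivative is exactly the
  factor that accompanies the arctangent in the boundary term of
  \<open>lambert_part_has_derivative\<close>.\<close>

lemma sqrt_quotient_has_derivative:
  assumes "\<nu> > 0" "\<kappa> > 0"
  shows "((\<lambda>\<kappa>. pi - arctan (sqrt (1 + \<kappa>\<^sup>2 + \<nu>\<^sup>2) / (\<nu> * \<kappa>))) has_real_derivative
     \<nu> / ((1 + \<kappa>\<^sup>2) * sqrt (1 + \<kappa>\<^sup>2 + \<nu>\<^sup>2))) (at \<kappa>)"
proof -
  define s where "s = sqrt (1 + \<kappa>\<^sup>2 + \<nu>\<^sup>2)"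
  have s: "s > 0" "s\<^sup>2 = 1 + \<kappa>\<^sup>2 + \<nu>\<^sup>2" by (simp_all add: s_def add_pos_nonneg)
  have D: "1 + \<kappa>\<^sup>2 > 0" "1 + \<nu>\<^sup>2 > 0" by (simp_all add: add_pos_nonneg)
  have "((\<lambda>\<kappa>. sqrt (1 + \<kappa>\<^sup>2 + \<nu>\<^sup>2)) has_real_derivative \<kappa> / s) (at \<kappa>)"
    using s(1) unfolding s_def by (auto intro!: derivative_eq_intros simp: field_simps)
  then have "((\<lambda>\<kappa>. sqrt (1 + \<kappa>\<^sup>2 + \<nu>\<^sup>2) / (\<nu> * \<kappa>)) has_real_derivative
       (\<kappa> / s * (\<nu> * \<kappa>) - s * (\<nu> * 1)) / (\<nu> * \<kappa> * (\<nu> * \<kappa>))) (at \<kappa>)"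
    unfolding s_def using assms by (intro DERIV_divide DERIV_cmult DERIV_ident) auto
  then have "((\<lambda>\<kappa>. arctan (sqrt (1 + \<kappa>\<^sup>2 + \<nu>\<^sup>2) / (\<nu> * \<kappa>))) has_real_derivative
       inverse (1 + (s / (\<nu> * \<kappa>))\<^sup>2) * ((\<kappa> / s * (\<nu> * \<kappa>) - s * (\<nu> * 1)) / (\<nu> * \<kappa> * (\<nu> * \<kappa>)))) (at \<kappa>)"
    unfolding s_def by (rule DERIV_chain2[OF DERIV_arctan])
  then have d: "((\<lambda>\<kappa>. pi - arctan (sqrt (1 + \<kappa>\<^sup>2 + \<nu>\<^sup>2) / (\<nu> * \<kappa>))) has_real_derivative
       0 - inverse (1 + (s / (\<nu> * \<kappa>))\<^sup>2) * ((\<kappa> / s * (\<nu> * \<kappa>) - s * (\<nu> * 1)) / (\<nu> * \<kappa> * (\<nu> * \<kappa>)))) (at \<kappa>)"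
    by (intro DERIV_diff DERIV_const)
  have e1: "1 + (s / (\<nu> * \<kappa>))\<^sup>2 = (1 + \<kappa>\<^sup>2) * (1 + \<nu>\<^sup>2) / (\<nu> * \<kappa>)\<^sup>2"
    using assms s(2) by (simp add: power_divide divide_simps) (simp add: algebra_simps power2_eq_square)
  have e2: "(\<kappa> / s * (\<nu> * \<kappa>) - s * (\<nu> * 1)) / (\<nu> * \<kappa> * (\<nu> * \<kappa>)) = - (\<nu> * (1 + \<nu>\<^sup>2)) / (s * (\<nu> * \<kappa>)\<^sup>2)"
  proof -
    have "\<kappa> / s * (\<nu> * \<kappa>) - s * (\<nu> * 1) = \<nu> * (\<kappa>\<^sup>2 - s\<^sup>2) / s"
      using s(1) by (simp add: field_simps power2_eq_square)
    also have "\<kappa>\<^sup>2 - s\<^sup>2 = - (1 + \<nu>\<^sup>2)" using s(2) by simp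
    finally have e: "\<kappa> / s * (\<nu> * \<kappa>) - s * (\<nu> * 1) = \<nu> * - (1 + \<nu>\<^sup>2) / s" .
    show ?thesis
      unfolding e using assms s(1) by (simp add: divide_simps power2_eq_square)
  qed
  have e: "0 - inverse (1 + (s / (\<nu> * \<kappa>))\<^sup>2) * ((\<kappa> / s * (\<nu> * \<kappa>) - s * (\<nu> * 1)) / (\<nu> * \<kappa> * (\<nu> * \<kappa>)))
      = \<nu> / ((1 + \<kappa>\<^sup>2) * s)"
    unfolding e1 e2 using assms D s(1) by (simp add: divide_simps power2_eq_square)
  from d[unfolded e, unfolded s_def] show ?thesis .
qed

text \<open>Volume minus a quarter of the two angle terms is constant along
  \<open>\<kappa> * \<kappa>' = c\<close>. In the limit one angle tends to \<open>pi / 2 + l\<close>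
  and the other to \<open>pi / 2\<close>, which yields one copy of
  \<open>delta (pi / 2) \<theta>\<close>. The second copy and \<open>delta 0 \<theta>\<close> come
  from \<open>delta_add_delta_complement\<close>, which also removes
  \<open>delta (pi / 2 + l) \<theta>\<close>.\<close>

lemma lambert_part_add:
  fixes \<alpha> \<theta> \<kappa> \<kappa>' :: real
  defines "\<Lambda> \<equiv> - tan \<alpha>" and "\<nu> \<equiv> tan \<alpha> / tan \<theta>"
  defines "b \<equiv> \<lambda>\<kappa>. pi - arctan (sqrt (1 + \<kappa>\<^sup>2 + \<nu>\<^sup>2) / (\<nu> * \<kappa>))"
  assumes \<alpha>: "pi / 2 < \<alpha>" "\<alpha> < pi" and \<theta>: "pi / 2 < \<theta>" "\<theta> < pi"
    and \<kappa>: "\<kappa> > 0" "\<kappa>' > 0" and rel: "\<kappa>\<^sup>2 * \<kappa>'\<^sup>2 * (1 + \<Lambda>\<^sup>2) = 1 + \<nu>\<^sup>2"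
  shows "lambert_part \<Lambda> \<nu> \<kappa> + lambert_part \<Lambda> \<nu> \<kappa>' =
    (delta \<alpha> \<theta> + delta (b \<kappa>) \<theta> + delta (b \<kappa>') \<theta> - 2 * delta (pi / 2) \<theta> - delta 0 \<theta>) / 4"
proof -
  have tn: "tan \<alpha> < 0" "tan \<theta> < 0" using \<alpha> \<theta> tan_neg by auto
  then have pos: "\<Lambda> > 0" "\<nu> > 0" by (simp_all add: \<Lambda>_def \<nu>_def divide_neg_neg)
  define c where "c = \<kappa> * \<kappa>'"
  have c: "c > 0" using \<kappa> by (simp add: c_def)
  have b: "pi / 2 < b k" "b k < pi" if "k > 0" for k
    using that pos arctan_ubound[of "sqrt (1 + k\<^sup>2 + \<nu>\<^sup>2) / (\<nu> * k)"]
    by (simp_all add: b_def zero_less_arctan_iff add_pos_nonneg)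
  define R where "R k = integral {0..\<nu>} (lambert_residue \<Lambda> \<nu> k)" for k
  define H where "H k = lambert_part \<Lambda> \<nu> k - delta (b k) \<theta> / 4" for k
  have dH: "(H has_real_derivative R k / (2 * k)) (at k)" if k: "k > 0" for k
  proof -
    \<comment> \<open>This identifies the arctangent in the derivative of \<open>delta\<close> with
      the one in the boundary term of the volume derivative, so the two cancel in \<open>H\<close>
      and only the residue survives.\<close>
    have "tan (b k) / tan \<theta> = sqrt (1 + k\<^sup>2 + \<nu>\<^sup>2) / (k * \<Lambda>)"
    proof -
      have "tan (b k) = - (sqrt (1 + k\<^sup>2 + \<nu>\<^sup>2) / (\<nu> * k))"
        unfolding b_def by (metis tan_arctan tan_minus tan_periodic_pi uminus_add_conv_diff)
      then show ?thesis using tn k by (simp add: \<nu>_def \<Lambda>_def field_simps)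
    qed
    then have "((\<lambda>a. delta a \<theta>) has_real_derivative 2 * arctan (sqrt (1 + k\<^sup>2 + \<nu>\<^sup>2) / (k * \<Lambda>))) (at (b k))"
      using delta_has_derivative[OF b[OF k] \<theta>] by simp
    from DERIV_chain2[OF this sqrt_quotient_has_derivative[OF pos(2) k, folded b_def]]
    have "((\<lambda>k. delta (b k) \<theta>) has_real_derivative 2 * arctan (sqrt (1 + k\<^sup>2 + \<nu>\<^sup>2) / (k * \<Lambda>))
            * (\<nu> / ((1 + k\<^sup>2) * sqrt (1 + k\<^sup>2 + \<nu>\<^sup>2)))) (at k)" .
    from DERIV_diff[OF lambert_part_has_derivative[OF pos k] DERIV_cdivide[OF this, of 4]]
    have "(H has_real_derivative
       \<nu> / ((1 + k\<^sup>2) * sqrt (1 + k\<^sup>2 + \<nu>\<^sup>2)) * arctan (sqrt (1 + k\<^sup>2 + \<nu>\<^sup>2) / (k * \<Lambda>)) / 2 + R k / (2 * k)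
       - 2 * arctan (sqrt (1 + k\<^sup>2 + \<nu>\<^sup>2) / (k * \<Lambda>)) * (\<nu> / ((1 + k\<^sup>2) * sqrt (1 + k\<^sup>2 + \<nu>\<^sup>2))) / 4) (at k)"
      unfolding H_def[abs_def] R_def .
    then show ?thesis by (rule DERIV_cong) simp
  qed
  have Rsym: "R k = R (c / k)" if "k > 0" for k
    unfolding R_def using that c pos rel
    by (intro lambert_residue_integral_symmetric) (simp_all add: c_def power_divide power_mult_distrib)
  \<comment> \<open>The weight \<open>1 / (2 * k)\<close> belongs to the measure
    \<open>dk / k\<close>, which changes sign under \<open>k \<mapsto> c / k\<close>; together with
    \<open>Rsym\<close> this makes the derivative of \<open>F\<close> vanish.\<close>
  define F where "F k = H k + H (c / k)" for k
  have dF: "(F has_real_derivative 0) (at k)" if k: "k > 0" for k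
  proof -
    have "((\<lambda>k. c / k) has_real_derivative - (c / k\<^sup>2)) (at k)"
      using k by (auto intro!: derivative_eq_intros simp: power2_eq_square)
    from DERIV_chain2[OF dH[of "c / k"] this]
    have "((\<lambda>k. H (c / k)) has_real_derivative R (c / k) / (2 * (c / k)) * - (c / k\<^sup>2)) (at k)"
      using k c by simp
    from DERIV_add[OF dH[OF k] this]
    have "(F has_real_derivative R k / (2 * k) + R (c / k) / (2 * (c / k)) * - (c / k\<^sup>2)) (at k)"
      unfolding F_def[abs_def] .
    then show ?thesis
      by (rule DERIV_cong) (use k c Rsym[OF k] in \<open>simp add: power2_eq_square\<close>)
  qed
  have F_const: "F x = F y" if "x > 0" "y > 0" for x y
    by (rule DERIV_isconst3[of 0 "max x y + 1"]) (use that dF in auto)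
  define k where "k n = real (Suc n)" for n
  have k: "k n > 0" for n by (simp add: k_def)
  have ck: "(\<lambda>n. c / k n) \<longlonglongrightarrow> 0"
    unfolding k_def by (intro real_tendsto_divide_at_top[OF tendsto_const]
        filterlim_compose[OF filterlim_real_sequentially filterlim_Suc])
  define l where "l = arctan (tan \<alpha> / tan \<theta>)"
  have l: "0 < l" "l < pi / 2"
    using pos arctan_ubound by (simp_all add: l_def \<nu>_def zero_less_arctan_iff)
  have "(\<lambda>n. b (k n)) \<longlonglongrightarrow> pi / 2 + l"
  proof -
    have "((\<lambda>x. sqrt (1 + x\<^sup>2 + \<nu>\<^sup>2) / (\<nu> * x)) \<longlongrightarrow> 1 / \<nu>) at_top"
      using pos(2) by real_asymp (simp add: inverse_eq_divide)
    then have "((\<lambda>x. b x) \<longlongrightarrow> pi - arctan (1 / \<nu>)) at_top"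
      unfolding b_def by (intro tendsto_diff tendsto_const tendsto_arctan)
    moreover have "pi - arctan (1 / \<nu>) = pi / 2 + l"
      using arctan_inverse[of \<nu>] pos by (simp add: l_def \<nu>_def[symmetric] inverse_eq_divide)
    ultimately have "(b \<longlongrightarrow> pi / 2 + l) at_top" by simp
    then show ?thesis
      unfolding k_def
      by (rule filterlim_compose[OF _ filterlim_compose[OF filterlim_real_sequentially filterlim_Suc]])
  qed
  moreover have "isCont (\<lambda>a. delta a \<theta>) (pi / 2 + l)"
    using l \<theta> by (intro delta_isCont) auto
  ultimately have 1: "(\<lambda>n. delta (b (k n)) \<theta>) \<longlonglongrightarrow> delta (pi / 2 + l) \<theta>"
    by (rule isCont_tendsto_compose[rotated])
  have "((\<lambda>x. b x) \<longlongrightarrow> pi / 2) (at_right 0)"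
  proof -
    define d where "d = 1 + \<nu>\<^sup>2"
    have "d > 0" by (simp add: d_def add_pos_nonneg)
    then have "filterlim (\<lambda>x. sqrt (x\<^sup>2 + d) / (\<nu> * x)) at_top (at_right 0)"
      using pos(2) by real_asymp
    then have "filterlim (\<lambda>x. sqrt (1 + x\<^sup>2 + \<nu>\<^sup>2) / (\<nu> * x)) at_top (at_right 0)"
      by (simp add: d_def add_ac)
    from filterlim_compose[OF tendsto_arctan_at_top this]
    have "(b \<longlongrightarrow> pi - pi / 2) (at_right 0)"
      unfolding b_def[abs_def] by (intro tendsto_diff tendsto_const)
    then show ?thesis by simp
  qed
  \<comment> \<open>Approach from above is recorded because \<open>delta_tendsto_at_right\<close> is
    one-sided.\<close>
  then have "filterlim b (at_right (pi / 2)) (at_right 0)"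
    by (rule tendsto_imp_filterlim_at_right)
       (use b in \<open>auto simp: eventually_at_right_less intro!: eventually_mono[OF eventually_at_right_less]\<close>)
  moreover have "filterlim (\<lambda>n. c / k n) (at_right 0) sequentially"
    by (rule tendsto_imp_filterlim_at_right[OF ck]) (use k c in simp)
  ultimately have "filterlim (\<lambda>n. b (c / k n)) (at_right (pi / 2)) sequentially"
    by (rule filterlim_compose)
  from filterlim_compose[OF delta_tendsto_at_right[OF \<theta>] this]
  have 2: "(\<lambda>n. delta (b (c / k n)) \<theta>) \<longlonglongrightarrow> delta (pi / 2) \<theta>" .
  have "(\<lambda>n. F (k n)) \<longlonglongrightarrow> arctan \<nu> * arctan (1 / \<Lambda>) / 2 - delta (pi / 2 + l) \<theta> / 4 + (0 - delta (pi / 2) \<theta> / 4)"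
    unfolding F_def H_def using k c
    by (intro tendsto_add tendsto_diff tendsto_divide[OF _ tendsto_const] 1 2 lambert_part_tendsto_0
          lambert_part_tendsto_at_top[folded k_def] pos ck) auto
  moreover have "F (k n) = F \<kappa>" for n
    by (rule F_const[OF k \<kappa>(1)])
  ultimately have "F \<kappa> = arctan \<nu> * arctan (1 / \<Lambda>) / 2 - delta (pi / 2 + l) \<theta> / 4 + (0 - delta (pi / 2) \<theta> / 4)"
    by (simp add: LIMSEQ_const_iff)
  moreover have "arctan (1 / \<Lambda>) = \<alpha> - pi / 2"
  proof -
    have "tan (\<alpha> - pi / 2) = - inverse (tan \<alpha>)"
      using tan_cot[of \<alpha>] tan_minus[of "pi / 2 - \<alpha>"] by simp
    then have "1 / \<Lambda> = tan (\<alpha> - pi / 2)" by (simp add: \<Lambda>_def inverse_eq_divide)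
    then show ?thesis using \<alpha> by (simp add: arctan_tan)
  qed
  moreover have "c / \<kappa> = \<kappa>'" using \<kappa> by (simp add: c_def)
  ultimately show ?thesis
    using delta_add_delta_complement[OF \<alpha> \<theta>]
    by (simp add: F_def H_def l_def \<nu>_def[symmetric] algebra_simps)
qed

section \<open>Lebesgue measure in gnomonic coordinates\<close>

lemma vector_4 [simp]:
  "(vector [a, b, c, d] :: ('a :: zero)^4) $ 1 = a"
  "(vector [a, b, c, d] :: 'a^4) $ 2 = b"
  "(vector [a, b, c, d] :: 'a^4) $ 3 = c"
  "(vector [a, b, c, d] :: 'a^4) $ 4 = d"
  by (simp_all add: vector_def)

lemma emeasure_lborel_Times:
  fixes A :: "'a :: euclidean_space set" and B :: "'b :: euclidean_space set"
  assumes "A \<in> sets borel" "B \<in> sets borel"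
  shows "emeasure lborel (A \<times> B) = emeasure lborel A * emeasure lborel B"
  unfolding lborel_prod[symmetric] using assms by (intro lborel.emeasure_pair_measure_Times) auto

lemma measurable_vector_4:
  "(\<lambda>(a, b, c, d). vector [a, b, c, d] :: real^4) \<in>
     measurable (lborel \<Otimes>\<^sub>M (lborel \<Otimes>\<^sub>M (lborel \<Otimes>\<^sub>M lborel))) borel"
proof -
  have "(\<lambda>(a, b, c, d). vector [a, b, c, d] :: real^4) =
     (\<lambda>p. fst p *\<^sub>R axis 1 1 + fst (snd p) *\<^sub>R axis 2 1 + fst (snd (snd p)) *\<^sub>R axis 3 1
            + snd (snd (snd p)) *\<^sub>R axis 4 1)"
    by (auto simp: fun_eq_iff vec_eq_iff forall_4 axis_def)
  then show ?thesis by simp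
qed

text \<open>Presents Lebesgue measure on \<open>real^4\<close> as a fourfold product, so that a cone
  can be measured by iterated integrals.\<close>

lemma lborel_vec4_eq:
  "(lborel :: (real^4) measure) =
     distr (lborel \<Otimes>\<^sub>M (lborel \<Otimes>\<^sub>M (lborel \<Otimes>\<^sub>M lborel))) borel (\<lambda>(a, b, c, d). vector [a, b, c, d])"
proof (rule lborel_eqI)
  let ?h = "\<lambda>(a, b, c, d). vector [a, b, c, d] :: real^4"
  let ?P = "(lborel :: real measure) \<Otimes>\<^sub>M ((lborel :: real measure) \<Otimes>\<^sub>M ((lborel :: real measure) \<Otimes>\<^sub>M (lborel :: real measure)))"
  note h = measurable_vector_4
  show "sets (distr ?P borel ?h) = sets borel" by simp
  fix l u :: "real^4"
  assume le: "\<And>b. b \<in> Basis \<Longrightarrow> l \<bullet> b \<le> u \<bullet> b"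
  have le': "l $ i \<le> u $ i" for i
    using le[of "axis i 1"] by (simp add: inner_axis axis_in_Basis_iff)
  have "emeasure (distr ?P borel ?h) (box l u) = emeasure ?P (?h -` box l u \<inter> space ?P)"
    using h by (rule emeasure_distr) simp
  also have "?h -` box l u \<inter> space ?P =
     {l $ 1<..<u $ 1} \<times> {l $ 2<..<u $ 2} \<times> {l $ 3<..<u $ 3} \<times> {l $ 4<..<u $ 4}"
    by (auto simp: space_pair_measure mem_box_cart forall_4)
  also have "emeasure ?P \<dots> = ennreal (u $ 1 - l $ 1) * (ennreal (u $ 2 - l $ 2) * (ennreal (u $ 3 - l $ 3) * ennreal (u $ 4 - l $ 4)))"
    using le' by (simp add: lborel_prod emeasure_lborel_Times open_Times)
  also have "\<dots> = ennreal (\<Prod>i\<in>UNIV. u $ i - l $ i)"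
  proof -
    have e: "(\<Prod>i\<in>UNIV. u $ i - l $ i) = (u $ 1 - l $ 1) * ((u $ 2 - l $ 2) * ((u $ 3 - l $ 3) * (u $ 4 - l $ 4)))"
      unfolding UNIV_4 by simp
    show ?thesis
      unfolding e by (simp only: ennreal_mult mult_nonneg_nonneg diff_ge_0_iff_ge le')
  qed
  also have "(\<Prod>i\<in>UNIV. u $ i - l $ i) = (\<Prod>b\<in>Basis. (u - l) \<bullet> b)"
  proof -
    have "cbox l u \<noteq> {}" using le by (simp add: box_ne_empty)
    then show ?thesis
      using content_cbox_cart[of l u] content_cbox'[of l u] by (simp add: inner_diff_left)
  qed
  finally show "emeasure (distr ?P borel ?h) (box l u) = ennreal (\<Prod>b\<in>Basis. (u - l) \<bullet> b)" .
qed

text \<open>First of the three elementary integrations for \<open>emeasure_cone_region\<close>. The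
  power \<open>y ^ 3\<close> is the radial part of the Jacobian, and \<open>y^2 * a \<le> 1\<close>
  is the unit ball in homogeneous coordinates. The next two lemmas integrate the result over the
  distance from the axis and over the slope about it.\<close>

lemma integral_cone_radius:
  fixes a :: real
  assumes "a > 0"
  shows "(\<integral>\<^sup>+y. ennreal (y ^ 3) * indicator {y. 0 \<le> y \<and> y\<^sup>2 * a \<le> 1} y \<partial>lborel) = ennreal (1 / (4 * a\<^sup>2))"
proof -
  have "{y. 0 \<le> y \<and> y\<^sup>2 * a \<le> 1} = {0..1 / sqrt a}"
  proof -
    have "y\<^sup>2 * a \<le> 1 \<longleftrightarrow> y \<le> 1 / sqrt a" if "y \<ge> 0" for y
    proof -
      have "y\<^sup>2 * a = (y * sqrt a)\<^sup>2" using assms by (simp add: power_mult_distrib)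
      also have "\<dots> \<le> 1 \<longleftrightarrow> y * sqrt a \<le> 1"
        using that assms by (simp add: power_le_one_iff abs_square_le_1)
      finally show ?thesis using assms by (simp add: field_simps)
    qed
    then show ?thesis by auto
  qed
  then have "(\<integral>\<^sup>+y. ennreal (y ^ 3) * indicator {y. 0 \<le> y \<and> y\<^sup>2 * a \<le> 1} y \<partial>lborel)
      = (\<integral>\<^sup>+y. ennreal (y ^ 3) * indicator {0..1 / sqrt a} y \<partial>lborel)" by simp
  also have "\<dots> = ennreal ((1 / sqrt a) ^ 4 / 4 - 0 ^ 4 / 4)"
    using assms by (intro nn_integral_FTC_Icc) (auto intro!: derivative_eq_intros)
  also have "(1 / sqrt a) ^ 4 / 4 - 0 ^ 4 / 4 = 1 / (4 * a\<^sup>2)"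
  proof -
    have "sqrt a ^ 4 = (sqrt a ^ 2) ^ 2" by (simp flip: power_mult)
    then show ?thesis using assms by (simp add: power_divide)
  qed
  finally show ?thesis .
qed

lemma integral_cone_height:
  fixes a b \<kappa> :: real
  assumes "a > 0" "b > 0" "\<kappa> > 0"
  shows "(\<integral>\<^sup>+x. ennreal (x / (4 * (a + b * x\<^sup>2)\<^sup>2)) * indicator {0..\<kappa>} x \<partial>lborel)
     = ennreal (\<kappa>\<^sup>2 / (8 * a * (a + b * \<kappa>\<^sup>2)))"
proof -
  have pos: "a + b * x\<^sup>2 > 0" for x using assms by (simp add: add_pos_nonneg)
  then have nz: "a + b * x\<^sup>2 \<noteq> 0" for x by (metis less_irrefl)
  have "(\<integral>\<^sup>+x. ennreal (x / (4 * (a + b * x\<^sup>2)\<^sup>2)) * indicator {0..\<kappa>} x \<partial>lborel)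
     = ennreal (- 1 / (8 * b * (a + b * \<kappa>\<^sup>2)) - - 1 / (8 * b * (a + b * 0\<^sup>2)))"
    using assms nz
    by (intro nn_integral_FTC_Icc)
       (auto intro!: derivative_eq_intros simp: power2_eq_square divide_simps)
  also have "- 1 / (8 * b * (a + b * \<kappa>\<^sup>2)) - - 1 / (8 * b * (a + b * 0\<^sup>2)) = \<kappa>\<^sup>2 / (8 * a * (a + b * \<kappa>\<^sup>2))"
    using assms pos[of \<kappa>] by (simp add: divide_simps)
  finally show ?thesis .
qed

lemma integral_cone_slope:
  fixes c \<kappa> s :: real
  assumes "c > 0" "\<kappa> > 0" "s \<ge> 0"
  shows "(\<integral>\<^sup>+x. ennreal (\<kappa>\<^sup>2 / (8 * c * (c + (1 + x\<^sup>2) * \<kappa>\<^sup>2))) * indicator {0..s} x \<partial>lborel)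
     = ennreal (\<kappa> / (c * sqrt (c + \<kappa>\<^sup>2)) * arctan (\<kappa> * s / sqrt (c + \<kappa>\<^sup>2)) / 8)"
proof -
  define S where "S = sqrt (c + \<kappa>\<^sup>2)"
  have S: "S > 0" "S\<^sup>2 = c + \<kappa>\<^sup>2" using assms by (simp_all add: S_def add_pos_nonneg)
  have "(\<integral>\<^sup>+x. ennreal (\<kappa>\<^sup>2 / (8 * c * (c + (1 + x\<^sup>2) * \<kappa>\<^sup>2))) * indicator {0..s} x \<partial>lborel)
     = ennreal (\<kappa> / (8 * c * S) * arctan (\<kappa> * s / S) - \<kappa> / (8 * c * S) * arctan (\<kappa> * 0 / S))"
  proof (rule nn_integral_FTC_Icc)
    fix x
    have "((\<lambda>x. \<kappa> / (8 * c * S) * arctan (\<kappa> * x / S)) has_real_derivative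
       \<kappa> / (8 * c * S) * (inverse (1 + (\<kappa> * x / S)\<^sup>2) * (\<kappa> * 1 / S))) (at x)"
      by (intro DERIV_cmult DERIV_chain2[OF DERIV_arctan] DERIV_cdivide DERIV_ident)
    also have "1 + (\<kappa> * x / S)\<^sup>2 = (c + (1 + x\<^sup>2) * \<kappa>\<^sup>2) / S\<^sup>2"
    proof -
      have "1 + (\<kappa> * x / S)\<^sup>2 = (S\<^sup>2 + \<kappa>\<^sup>2 * x\<^sup>2) / S\<^sup>2"
        using S(1) by (simp add: field_simps)
      then show ?thesis by (simp add: S(2) algebra_simps)
    qed
    also have "\<kappa> / (8 * c * S) * (inverse ((c + (1 + x\<^sup>2) * \<kappa>\<^sup>2) / S\<^sup>2) * (\<kappa> * 1 / S))
        = \<kappa>\<^sup>2 / (8 * c * (c + (1 + x\<^sup>2) * \<kappa>\<^sup>2))"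
      using S(1) by (simp add: power2_eq_square)
    finally show "((\<lambda>x. \<kappa> / (8 * c * S) * arctan (\<kappa> * x / S)) has_real_derivative
        \<kappa>\<^sup>2 / (8 * c * (c + (1 + x\<^sup>2) * \<kappa>\<^sup>2))) (at x)" .
    show "0 \<le> \<kappa>\<^sup>2 / (8 * c * (c + (1 + x\<^sup>2) * \<kappa>\<^sup>2))"
      using assms by (intro divide_nonneg_nonneg mult_nonneg_nonneg add_nonneg_nonneg) auto
  qed (use assms in auto)
  then show ?thesis by (simp add: S_def[symmetric] mult_ac)
qed

lemma nn_integral_lborel_scale:
  fixes f :: "real \<Rightarrow> ennreal"
  assumes "f \<in> borel_measurable borel" "c > 0"
  shows "(\<integral>\<^sup>+x. f x \<partial>lborel) = (\<integral>\<^sup>+x. ennreal c * f (c * x) \<partial>lborel)"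
proof -
  have "(\<integral>\<^sup>+x. f x \<partial>lborel) = ennreal \<bar>c\<bar> * (\<integral>\<^sup>+x. f (0 + c * x) \<partial>lborel)"
    using assms by (intro nn_integral_real_affine) auto
  also have "\<dots> = (\<integral>\<^sup>+x. ennreal c * f (c * x) \<partial>lborel)"
    using assms by (simp add: nn_integral_cmult)
  finally show ?thesis .
qed

text \<open>The two variants differ by the null set \<open>d = c * \<sigma> (b / a)\<close>; \<open>strict\<close> serves to make two
  such regions disjoint.\<close>
definition cone_region :: "bool \<Rightarrow> (real \<Rightarrow> real) \<Rightarrow> real \<Rightarrow> real \<Rightarrow> (real \<times> real \<times> real \<times> real) set" where
  "cone_region strict \<sigma> \<nu> \<kappa> = {(a, b, c, d). 0 < a \<and> 0 \<le> b \<and> b \<le> \<nu> * a \<and> 0 < c \<and> c \<le> \<kappa> * a \<and> 0 \<le> d \<and>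
     (if strict then d < c * \<sigma> (b / a) else d \<le> c * \<sigma> (b / a))}"

lemma cone_region_measurable:
  assumes [measurable]: "\<sigma> \<in> borel_measurable borel"
  shows "cone_region strict \<sigma> \<nu> \<kappa> \<in> sets borel"
proof -
  have "cone_region strict \<sigma> \<nu> \<kappa> = {p \<in> space borel. 0 < fst p \<and> 0 \<le> fst (snd p) \<and> fst (snd p) \<le> \<nu> * fst p \<and>
       0 < fst (snd (snd p)) \<and> fst (snd (snd p)) \<le> \<kappa> * fst p \<and> 0 \<le> snd (snd (snd p)) \<and>
     (if strict then snd (snd (snd p)) < fst (snd (snd p)) * \<sigma> (fst (snd p) / fst p)
      else snd (snd (snd p)) \<le> fst (snd (snd p)) * \<sigma> (fst (snd p) / fst p))}"
    by (auto simp: cone_region_def)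
  also have "\<dots> \<in> sets borel"
    unfolding borel_prod[symmetric] by measurable
  finally show ?thesis .
qed

text \<open>In the coordinates \<open>(a, a * t, a * x, a * x * s)\<close> with Jacobian
  \<open>a^3 * x\<close> the cone conditions involve only \<open>t\<close>, \<open>x\<close>,
  \<open>s\<close>, and the ball condition becomes a bound on \<open>a\<close>. The substitution is
  carried out one variable at a time, as a scaling of the line.\<close>

lemma emeasure_cone_region:
  fixes \<sigma> :: "real \<Rightarrow> real"
  assumes [measurable]: "\<sigma> \<in> borel_measurable borel" and \<sigma>: "\<And>t. 0 \<le> t \<Longrightarrow> 0 \<le> \<sigma> t" and \<kappa>: "\<kappa> > 0"
  shows "emeasure (lborel \<Otimes>\<^sub>M (lborel \<Otimes>\<^sub>M (lborel \<Otimes>\<^sub>M lborel)))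
       (cone_region strict \<sigma> \<nu> \<kappa> \<inter> {(a, b, c, d). a\<^sup>2 + b\<^sup>2 + c\<^sup>2 + d\<^sup>2 \<le> 1}) =
    (\<integral>\<^sup>+t. ennreal (\<kappa> / ((1 + t\<^sup>2) * sqrt (1 + \<kappa>\<^sup>2 + t\<^sup>2)) * arctan (\<kappa> * \<sigma> t / sqrt (1 + \<kappa>\<^sup>2 + t\<^sup>2)) / 8)
       * indicator {0..\<nu>} t \<partial>lborel)"
    (is "emeasure ?P ?E = _")
proof -
  define lt where "lt x y \<longleftrightarrow> (if strict then x < y else x \<le> y)" for x y :: real
  have [measurable]: "Measurable.pred N (\<lambda>x. lt (f x) (g x))"
    if "f \<in> borel_measurable N" "g \<in> borel_measurable N" for f g :: "'n \<Rightarrow> real" and N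
    using that unfolding lt_def by measurable
  have lt_scale: "lt (k * x) (k * y) = lt x y" if "k > 0" for k x y
    using that by (simp add: lt_def)
  define Q where "Q a b c d \<longleftrightarrow> 0 < a \<and> 0 \<le> b \<and> b \<le> \<nu> * a \<and> 0 < c \<and> c \<le> \<kappa> * a \<and> 0 \<le> d \<and> lt d (c * \<sigma> (b / a))
     \<and> a\<^sup>2 + b\<^sup>2 + c\<^sup>2 + d\<^sup>2 \<le> 1" for a b c d
  have E: "?E = {(a, b, c, d). Q a b c d}"
    by (auto simp: cone_region_def Q_def lt_def)
  have [measurable]: "Measurable.pred N (\<lambda>x. Q (a x) (b x) (c x) (d x))"
    if [measurable]: "a \<in> borel_measurable N" "b \<in> borel_measurable N" "c \<in> borel_measurable N" "d \<in> borel_measurable N"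
    for a b c d :: "'n \<Rightarrow> real" and N
    unfolding Q_def by measurable
  define ind where "ind b = (if b then 1 else 0 :: ennreal)" for b
  have [measurable]: "(\<lambda>x. ind (P x)) \<in> borel_measurable N" if [measurable]: "Measurable.pred N P" for P and N :: "'n measure"
    unfolding ind_def by measurable
  \<comment> \<open>Unlike \<open>Q\<close>, this admits \<open>a = 0\<close> and
    \<open>x = 0\<close>; the Jacobian in \<open>H\<close> vanishes there, and closed ranges suit
    the later integrations.\<close>
  define R where "R t s x a \<longleftrightarrow> 0 \<le> a \<and> 0 \<le> t \<and> t \<le> \<nu> \<and> 0 \<le> x \<and> x \<le> \<kappa> \<and> 0 \<le> s \<and> lt s (\<sigma> t)
     \<and> a\<^sup>2 * (1 + t\<^sup>2 + (1 + s\<^sup>2) * x\<^sup>2) \<le> 1" for t s x a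
  have [measurable]: "Measurable.pred N (\<lambda>y. R (t y) (s y) (x y) (a y))"
    if [measurable]: "t \<in> borel_measurable N" "s \<in> borel_measurable N" "x \<in> borel_measurable N" "a \<in> borel_measurable N"
    for t s x a :: "'n \<Rightarrow> real" and N
    unfolding R_def by measurable
  define H where "H t s x a = ennreal (a ^ 3) * (ennreal x * ind (R t s x a))" for t s x a
  have [measurable]: "(\<lambda>y. H (t y) (s y) (x y) (a y)) \<in> borel_measurable N"
    if [measurable]: "t \<in> borel_measurable N" "s \<in> borel_measurable N" "x \<in> borel_measurable N" "a \<in> borel_measurable N"
    for t s x a :: "'n \<Rightarrow> real" and N
    unfolding H_def by measurable
  have P2: "sigma_finite_measure (lborel \<Otimes>\<^sub>M lborel :: (real \<times> real) measure)"
    unfolding lborel_prod by (rule lborel.sigma_finite_measure_axioms)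
  have P3: "sigma_finite_measure (lborel \<Otimes>\<^sub>M (lborel \<Otimes>\<^sub>M lborel) :: (real \<times> real \<times> real) measure)"
    unfolding lborel_prod by (rule lborel.sigma_finite_measure_axioms)
  have QR: "Q a (a * t) (a * x) (a * x * s) = R t s x a" if "a > 0" "x > 0" for a t x s
  proof -
    have "y * s \<ge> 0 \<longleftrightarrow> s \<ge> 0" if "y > 0" for y using that by (auto simp: zero_le_mult_iff)
    from this[of "a * x"] have "a * x * s \<ge> 0 \<longleftrightarrow> s \<ge> 0" using that by simp
    moreover have "a\<^sup>2 + (a * t)\<^sup>2 + (a * x)\<^sup>2 + (a * x * s)\<^sup>2 = a\<^sup>2 * (1 + t\<^sup>2 + (1 + s\<^sup>2) * x\<^sup>2)"
      by (simp add: algebra_simps power2_eq_square)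
    ultimately show ?thesis
      using that lt_scale[of "a * x" s "\<sigma> t"] by (simp add: Q_def R_def mult.commute[of \<nu>] mult.commute[of \<kappa>] zero_le_mult_iff)
  qed
  have "{(a, b, c, d). Q a b c d} \<in> sets ?P"
  proof -
    have "{(a, b, c, d). Q a b c d} = {p \<in> space ?P. Q (fst p) (fst (snd p)) (fst (snd (snd p))) (snd (snd (snd p)))}"
      by (auto simp: space_pair_measure)
    also have "\<dots> \<in> sets ?P" by measurable
    finally show ?thesis .
  qed
  then have "emeasure ?P ?E = (\<integral>\<^sup>+p. indicator {(a, b, c, d). Q a b c d} p \<partial>?P)"
    unfolding E by (rule nn_integral_indicator[symmetric])
  also have "\<dots> = (\<integral>\<^sup>+p. ind (Q (fst p) (fst (snd p)) (fst (snd (snd p))) (snd (snd (snd p)))) \<partial>?P)"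
    by (intro nn_integral_cong) (auto simp: ind_def indicator_def)
  also have "\<dots> = (\<integral>\<^sup>+a. \<integral>\<^sup>+p. ind (Q a (fst p) (fst (snd p)) (snd (snd p))) \<partial>(lborel \<Otimes>\<^sub>M (lborel \<Otimes>\<^sub>M lborel)) \<partial>lborel)"
    by (subst sigma_finite_measure.nn_integral_fst[OF P3, symmetric]) simp_all
  also have "\<dots> = (\<integral>\<^sup>+a. \<integral>\<^sup>+b. \<integral>\<^sup>+p. ind (Q a b (fst p) (snd p)) \<partial>(lborel \<Otimes>\<^sub>M lborel) \<partial>lborel \<partial>lborel)"
    by (intro nn_integral_cong, subst sigma_finite_measure.nn_integral_fst[OF P2, symmetric]) simp_all
  also have "\<dots> = (\<integral>\<^sup>+a. \<integral>\<^sup>+b. \<integral>\<^sup>+c. \<integral>\<^sup>+d. ind (Q a b c d) \<partial>lborel \<partial>lborel \<partial>lborel \<partial>lborel)"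
    by (intro nn_integral_cong, subst lborel.nn_integral_fst[symmetric]) simp_all
  also have "\<dots> = (\<integral>\<^sup>+a. \<integral>\<^sup>+t. \<integral>\<^sup>+x. \<integral>\<^sup>+s. H t s x a \<partial>lborel \<partial>lborel \<partial>lborel \<partial>lborel)"
  proof (rule nn_integral_cong)
    fix a :: real
    show "(\<integral>\<^sup>+b. \<integral>\<^sup>+c. \<integral>\<^sup>+d. ind (Q a b c d) \<partial>lborel \<partial>lborel \<partial>lborel)
        = (\<integral>\<^sup>+t. \<integral>\<^sup>+x. \<integral>\<^sup>+s. H t s x a \<partial>lborel \<partial>lborel \<partial>lborel)"
    proof (cases "a > 0")
      case False
      then have "\<not> Q a b c d" "a = 0 \<or> \<not> R t s x a" for b c d t s x by (auto simp: Q_def R_def)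
      then have "ind (Q a b c d) = 0" "H t s x a = 0" for b c d t s x
        by (cases "a = 0"; simp add: H_def ind_def)+
      then show ?thesis by simp
    next
      case True
      have inner: "ennreal a * (ennreal a * (\<integral>\<^sup>+d. ind (Q a (a * t) (a * x) d) \<partial>lborel)) = (\<integral>\<^sup>+s. H t s x a \<partial>lborel)" for t x
      proof (cases "x > 0")
        case False
        then have "\<not> Q a (a * t) (a * x) d" "x = 0 \<or> \<not> R t s x a" for d s
          using True by (auto simp: Q_def R_def zero_less_mult_iff)
        then have "ind (Q a (a * t) (a * x) d) = 0" "H t s x a = 0" for d s
          by (cases "x = 0"; simp add: H_def ind_def)+
        then show ?thesis by simp
      next
        case x: True
        have "(\<integral>\<^sup>+d. ind (Q a (a * t) (a * x) d) \<partial>lborel)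
            = (\<integral>\<^sup>+s. ennreal (a * x) * ind (Q a (a * t) (a * x) (a * x * s)) \<partial>lborel)"
          using True x by (intro nn_integral_lborel_scale) auto
        also have "\<dots> = (\<integral>\<^sup>+s. ennreal (a * x) * ind (R t s x a) \<partial>lborel)"
          using True x by (simp add: QR)
        also have "ennreal a * (ennreal a * \<dots>) = (\<integral>\<^sup>+s. ennreal a * (ennreal a * (ennreal (a * x) * ind (R t s x a))) \<partial>lborel)"
          by (simp add: nn_integral_cmult)
        also have "\<dots> = (\<integral>\<^sup>+s. H t s x a \<partial>lborel)"
          using True x by (simp add: H_def ennreal_mult power3_eq_cube mult_ac)
        finally show ?thesis .
      qed
      have "(\<integral>\<^sup>+b. \<integral>\<^sup>+c. \<integral>\<^sup>+d. ind (Q a b c d) \<partial>lborel \<partial>lborel \<partial>lborel)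
          = (\<integral>\<^sup>+t. ennreal a * (\<integral>\<^sup>+c. \<integral>\<^sup>+d. ind (Q a (a * t) c d) \<partial>lborel \<partial>lborel) \<partial>lborel)"
        using True by (intro nn_integral_lborel_scale) auto
      also have "\<dots> = (\<integral>\<^sup>+t. ennreal a * (\<integral>\<^sup>+x. ennreal a * (\<integral>\<^sup>+d. ind (Q a (a * t) (a * x) d) \<partial>lborel) \<partial>lborel) \<partial>lborel)"
        using True by (intro nn_integral_cong arg_cong2[where f = times] refl nn_integral_lborel_scale) auto
      also have "\<dots> = (\<integral>\<^sup>+t. \<integral>\<^sup>+x. ennreal a * (ennreal a * (\<integral>\<^sup>+d. ind (Q a (a * t) (a * x) d) \<partial>lborel)) \<partial>lborel \<partial>lborel)"
        by (intro nn_integral_cong nn_integral_cmult[symmetric]) auto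
      finally show ?thesis by (simp only: inner)
    qed
  qed
  \<comment> \<open>Tonelli moves \<open>a\<close> to the innermost place, then \<open>x\<close>,
    then \<open>s\<close>: in this order each integral has an elementary primitive.\<close>
  also have "\<dots> = (\<integral>\<^sup>+t. \<integral>\<^sup>+a. \<integral>\<^sup>+x. \<integral>\<^sup>+s. H t s x a \<partial>lborel \<partial>lborel \<partial>lborel \<partial>lborel)"
    by (rule lborel_pair.Fubini') simp
  also have "\<dots> = (\<integral>\<^sup>+t. \<integral>\<^sup>+x. \<integral>\<^sup>+a. \<integral>\<^sup>+s. H t s x a \<partial>lborel \<partial>lborel \<partial>lborel \<partial>lborel)"
    by (intro nn_integral_cong lborel_pair.Fubini') simp
  also have "\<dots> = (\<integral>\<^sup>+t. \<integral>\<^sup>+x. \<integral>\<^sup>+s. \<integral>\<^sup>+a. H t s x a \<partial>lborel \<partial>lborel \<partial>lborel \<partial>lborel)"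
    by (intro nn_integral_cong lborel_pair.Fubini') simp
  also have "\<dots> = (\<integral>\<^sup>+t. \<integral>\<^sup>+s. \<integral>\<^sup>+x. \<integral>\<^sup>+a. H t s x a \<partial>lborel \<partial>lborel \<partial>lborel \<partial>lborel)"
    by (intro nn_integral_cong lborel_pair.Fubini') simp
  also have "\<dots> = (\<integral>\<^sup>+t. ennreal (\<kappa> / ((1 + t\<^sup>2) * sqrt (1 + \<kappa>\<^sup>2 + t\<^sup>2)) * arctan (\<kappa> * \<sigma> t / sqrt (1 + \<kappa>\<^sup>2 + t\<^sup>2)) / 8)
       * indicator {0..\<nu>} t \<partial>lborel)"
  proof (rule nn_integral_cong)
    fix t :: real
    define A where "A = 1 + t\<^sup>2"
    have A: "A > 0" by (simp add: A_def add_pos_nonneg)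
    have B: "1 + s\<^sup>2 > 0" for s :: real by (simp add: add_pos_nonneg)
    have "(\<integral>\<^sup>+s. \<integral>\<^sup>+x. \<integral>\<^sup>+a. H t s x a \<partial>lborel \<partial>lborel \<partial>lborel)
      = (\<integral>\<^sup>+s. (\<integral>\<^sup>+x. ind (0 \<le> t \<and> t \<le> \<nu> \<and> 0 \<le> s \<and> lt s (\<sigma> t)) * (ennreal (x / (4 * (A + (1 + s\<^sup>2) * x\<^sup>2)\<^sup>2)) * indicator {0..\<kappa>} x) \<partial>lborel) \<partial>lborel)"
    proof (intro nn_integral_cong)
      fix s x :: real
      have "A + (1 + s\<^sup>2) * x\<^sup>2 > 0" using A B[of s] by (simp add: add_pos_nonneg)
      have "(\<integral>\<^sup>+a. H t s x a \<partial>lborel) = (\<integral>\<^sup>+a. ind (0 \<le> t \<and> t \<le> \<nu> \<and> 0 \<le> s \<and> lt s (\<sigma> t)) * (ennreal x * indicator {0..\<kappa>} x)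
           * (ennreal (a ^ 3) * indicator {a. 0 \<le> a \<and> a\<^sup>2 * (A + (1 + s\<^sup>2) * x\<^sup>2) \<le> 1} a) \<partial>lborel)"
        by (intro nn_integral_cong) (auto simp: H_def R_def ind_def A_def indicator_def mult_ac)
      also have "\<dots> = ind (0 \<le> t \<and> t \<le> \<nu> \<and> 0 \<le> s \<and> lt s (\<sigma> t)) * (ennreal x * indicator {0..\<kappa>} x)
           * ennreal (1 / (4 * (A + (1 + s\<^sup>2) * x\<^sup>2)\<^sup>2))"
        using \<open>A + (1 + s\<^sup>2) * x\<^sup>2 > 0\<close>
        by (subst nn_integral_cmult) (auto simp: integral_cone_radius)
      also have "\<dots> = ind (0 \<le> t \<and> t \<le> \<nu> \<and> 0 \<le> s \<and> lt s (\<sigma> t)) * (ennreal (x / (4 * (A + (1 + s\<^sup>2) * x\<^sup>2)\<^sup>2)) * indicator {0..\<kappa>} x)"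
        by (auto simp: indicator_def ind_def ennreal_mult[symmetric])
      finally show "(\<integral>\<^sup>+a. H t s x a \<partial>lborel) = \<dots>" .
    qed
    also have "\<dots> = (\<integral>\<^sup>+s. ind (0 \<le> t \<and> t \<le> \<nu> \<and> 0 \<le> s \<and> lt s (\<sigma> t)) * ennreal (\<kappa>\<^sup>2 / (8 * A * (A + (1 + s\<^sup>2) * \<kappa>\<^sup>2))) \<partial>lborel)"
      using A B \<kappa> by (intro nn_integral_cong) (simp add: nn_integral_cmult integral_cone_height)
    \<comment> \<open>Here the strict and the non-strict region become equal, as they differ only at
      the single slope \<open>s = \<sigma> t\<close>.\<close>
    also have "\<dots> = (\<integral>\<^sup>+s. indicator {0..\<nu>} t * (ennreal (\<kappa>\<^sup>2 / (8 * A * (A + (1 + s\<^sup>2) * \<kappa>\<^sup>2))) * indicator {0..\<sigma> t} s) \<partial>lborel)"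
    proof (rule nn_integral_cong_AE)
      show "AE s in lborel. ind (0 \<le> t \<and> t \<le> \<nu> \<and> 0 \<le> s \<and> lt s (\<sigma> t)) * ennreal (\<kappa>\<^sup>2 / (8 * A * (A + (1 + s\<^sup>2) * \<kappa>\<^sup>2)))
        = indicator {0..\<nu>} t * (ennreal (\<kappa>\<^sup>2 / (8 * A * (A + (1 + s\<^sup>2) * \<kappa>\<^sup>2))) * indicator {0..\<sigma> t} s)"
        using AE_lborel_singleton[of "\<sigma> t"]
        by eventually_elim (auto simp: ind_def lt_def indicator_def)
    qed
    also have "\<dots> = indicator {0..\<nu>} t * ennreal (\<kappa> / (A * sqrt (A + \<kappa>\<^sup>2)) * arctan (\<kappa> * \<sigma> t / sqrt (A + \<kappa>\<^sup>2)) / 8)"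
    proof (cases "t \<ge> 0")
      case True
      then show ?thesis using A \<kappa> \<sigma>
        by (subst nn_integral_cmult) (auto simp: integral_cone_slope)
    qed (simp add: indicator_def)
    finally show "(\<integral>\<^sup>+s. \<integral>\<^sup>+x. \<integral>\<^sup>+a. H t s x a \<partial>lborel \<partial>lborel \<partial>lborel)
      = ennreal (\<kappa> / ((1 + t\<^sup>2) * sqrt (1 + \<kappa>\<^sup>2 + t\<^sup>2)) * arctan (\<kappa> * \<sigma> t / sqrt (1 + \<kappa>\<^sup>2 + t\<^sup>2)) / 8) * indicator {0..\<nu>} t"
      by (simp add: A_def add_ac mult_ac)
  qed
  finally show ?thesis .
qed

section \<open>Orthonormal frames of \<open>real^4\<close> and the volume of a piece in such a
  frame\<close>

definition frame_map :: "real^4 \<Rightarrow> real^4 \<Rightarrow> real^4 \<Rightarrow> real^4 \<Rightarrow> real^4 \<Rightarrow> real^4" where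
  "frame_map u1 u2 u3 u4 x = x $ 1 *\<^sub>R u1 + x $ 2 *\<^sub>R u2 + x $ 3 *\<^sub>R u3 + x $ 4 *\<^sub>R u4"

definition orthonormal_frame :: "real^4 \<Rightarrow> real^4 \<Rightarrow> real^4 \<Rightarrow> real^4 \<Rightarrow> bool" where
  "orthonormal_frame u1 u2 u3 u4 \<longleftrightarrow>
     u1 \<bullet> u1 = 1 \<and> u2 \<bullet> u2 = 1 \<and> u3 \<bullet> u3 = 1 \<and> u4 \<bullet> u4 = 1 \<and>
     u1 \<bullet> u2 = 0 \<and> u1 \<bullet> u3 = 0 \<and> u1 \<bullet> u4 = 0 \<and> u2 \<bullet> u3 = 0 \<and> u2 \<bullet> u4 = 0 \<and> u3 \<bullet> u4 = 0"

lemma inner_vec4: "(x :: real^4) \<bullet> y = x $ 1 * y $ 1 + x $ 2 * y $ 2 + x $ 3 * y $ 3 + x $ 4 * y $ 4"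
  by (simp add: inner_vec_def sum_4)

context
  fixes u1 u2 u3 u4
  assumes fr: "orthonormal_frame u1 u2 u3 u4"
begin

lemma frame_map_inner:
  "u1 \<bullet> frame_map u1 u2 u3 u4 x = x $ 1" "u2 \<bullet> frame_map u1 u2 u3 u4 x = x $ 2"
  "u3 \<bullet> frame_map u1 u2 u3 u4 x = x $ 3" "u4 \<bullet> frame_map u1 u2 u3 u4 x = x $ 4"
  using fr by (simp_all add: frame_map_def inner_add_right orthonormal_frame_def inner_commute)

lemma frame_map_orthogonal: "orthogonal_transformation (frame_map u1 u2 u3 u4)"
  unfolding orthogonal_transformation_def
proof (intro conjI allI)
  show "linear (frame_map u1 u2 u3 u4)"
    by (rule linearI) (simp_all add: frame_map_def algebra_simps)
  fix x y
  show "frame_map u1 u2 u3 u4 x \<bullet> frame_map u1 u2 u3 u4 y = x \<bullet> y"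
    by (subst (1) frame_map_def) (simp add: inner_add_left frame_map_inner inner_vec4[of x y])
qed

lemma frame_map_surj: obtains z where "x = frame_map u1 u2 u3 u4 z"
  using orthogonal_transformation_surj[OF frame_map_orthogonal] by (metis surjD)

lemma frame_inner:
  "x \<bullet> y = (u1 \<bullet> x) * (u1 \<bullet> y) + (u2 \<bullet> x) * (u2 \<bullet> y) + (u3 \<bullet> x) * (u3 \<bullet> y) + (u4 \<bullet> x) * (u4 \<bullet> y)"
proof -
  obtain z w where x: "x = frame_map u1 u2 u3 u4 z" and y: "y = frame_map u1 u2 u3 u4 w"
    using frame_map_surj by metis
  have "x \<bullet> y = z \<bullet> w"
    using frame_map_orthogonal by (simp add: x y orthogonal_transformation_def)
  also have "z \<bullet> w = z $ 1 * w $ 1 + z $ 2 * w $ 2 + z $ 3 * w $ 3 + z $ 4 * w $ 4"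
    by (rule inner_vec4)
  finally show ?thesis by (simp add: x y frame_map_inner)
qed

text \<open>Every orthonormal frame is allowed because the two pieces of a cube are measured in
  different frames, one for each end of the axis; invariance of Lebesgue measure under orthogonal
  maps reduces both to the standard frame.\<close>

lemma frame_cone_region:
  fixes \<Lambda> \<nu> \<kappa> :: real and strict :: bool
  assumes pos: "\<Lambda> > 0" "\<nu> > 0" "\<kappa> > 0"
  defines "\<sigma> \<equiv> \<lambda>t. (\<kappa>\<^sup>2 + 1 + \<nu> * t) / (\<kappa>\<^sup>2 * \<Lambda>)"
  defines "C \<equiv> {x. (u1 \<bullet> x, u2 \<bullet> x, u3 \<bullet> x, u4 \<bullet> x) \<in> cone_region strict \<sigma> \<nu> \<kappa>} \<inter> cball 0 1"
  shows "C \<in> lmeasurable" "4 * measure lebesgue C = lambert_part \<Lambda> \<nu> \<kappa>"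
proof -
  let ?P = "(lborel :: real measure) \<Otimes>\<^sub>M ((lborel :: real measure) \<Otimes>\<^sub>M ((lborel :: real measure) \<Otimes>\<^sub>M (lborel :: real measure)))"
  let ?h = "\<lambda>(a, b, c, d). vector [a, b, c, d] :: real^4"
  define C0 where "C0 = {x :: real^4. (x $ 1, x $ 2, x $ 3, x $ 4) \<in> cone_region strict \<sigma> \<nu> \<kappa>} \<inter> cball 0 1"
  have \<sigma>_meas: "\<sigma> \<in> borel_measurable borel" unfolding \<sigma>_def by measurable
  have norm_le: "norm x \<le> 1 \<longleftrightarrow> (x $ 1)\<^sup>2 + (x $ 2)\<^sup>2 + (x $ 3)\<^sup>2 + (x $ 4)\<^sup>2 \<le> 1" for x :: "real^4"
  proof -
    have "norm x \<le> 1 \<longleftrightarrow> x \<bullet> x \<le> 1" by (simp add: norm_eq_sqrt_inner)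
    then show ?thesis by (simp add: inner_vec4 power2_eq_square)
  qed
  have C0: "C0 \<in> sets borel"
  proof -
    have "continuous_on UNIV (\<lambda>x :: real^4. (x $ 1, x $ 2, x $ 3, x $ 4))"
      by (intro continuous_intros)
    then have "(\<lambda>x :: real^4. (x $ 1, x $ 2, x $ 3, x $ 4)) \<in> borel_measurable borel"
      by (rule borel_measurable_continuous_onI)
    from measurable_sets[OF this cone_region_measurable[OF \<sigma>_meas]]
    have "{x :: real^4. (x $ 1, x $ 2, x $ 3, x $ 4) \<in> cone_region strict \<sigma> \<nu> \<kappa>} \<in> sets borel"
      by (simp add: vimage_def)
    then show ?thesis unfolding C0_def by auto
  qed
  have im: "C = frame_map u1 u2 u3 u4 ` C0"
  proof -
    have "x \<in> C \<longleftrightarrow> x \<in> frame_map u1 u2 u3 u4 ` C0" for x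
    proof -
      obtain z where x: "x = frame_map u1 u2 u3 u4 z" by (rule frame_map_surj)
      have "inj (frame_map u1 u2 u3 u4)"
        using frame_map_orthogonal by (rule orthogonal_transformation_inj)
      then have "x \<in> frame_map u1 u2 u3 u4 ` C0 \<longleftrightarrow> z \<in> C0"
        unfolding x by (rule inj_image_mem_iff)
      also have "\<dots> \<longleftrightarrow> x \<in> C"
        using frame_map_orthogonal by (simp add: x C0_def C_def frame_map_inner orthogonal_transformation_norm)
      finally show ?thesis by simp
    qed
    then show ?thesis by blast
  qed
  have C0_bdd: "C0 \<in> lmeasurable"
    by (rule bounded_set_imp_lmeasurable)
       (use C0 bounded_subset[OF bounded_cball] in \<open>auto simp: C0_def\<close>)
  then show "C \<in> lmeasurable"
    unfolding im using frame_map_orthogonal by (rule measurable_orthogonal_image[rotated])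
  define g where "g t = \<kappa> / ((1 + t\<^sup>2) * sqrt (1 + \<kappa>\<^sup>2 + t\<^sup>2)) *
     arctan ((\<kappa>\<^sup>2 + 1 + \<nu> * t) / (\<kappa> * \<Lambda> * sqrt (1 + \<kappa>\<^sup>2 + t\<^sup>2)))" for t
  have g_int: "g integrable_on {0..\<nu>}"
    unfolding g_def[abs_def] using pos
    by (intro integrable_continuous_real lambert_part_integrand_continuous_on)
  have g_nonneg: "g t \<ge> 0" if "t \<in> {0..\<nu>}" for t
    using that pos unfolding g_def
    by (intro mult_nonneg_nonneg divide_nonneg_nonneg) (auto simp: zero_le_arctan_iff intro!: divide_nonneg_nonneg mult_nonneg_nonneg add_nonneg_nonneg)
  have arg: "\<kappa> * \<sigma> t / sqrt (1 + \<kappa>\<^sup>2 + t\<^sup>2) = (\<kappa>\<^sup>2 + 1 + \<nu> * t) / (\<kappa> * \<Lambda> * sqrt (1 + \<kappa>\<^sup>2 + t\<^sup>2))" for t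
    using pos by (simp add: \<sigma>_def power2_eq_square)
  have "emeasure lborel C0 = emeasure (distr ?P borel ?h) C0"
    by (simp only: lborel_vec4_eq)
  also have "\<dots> = emeasure ?P (?h -` C0 \<inter> space ?P)"
    using measurable_vector_4 C0 by (rule emeasure_distr)
  also have "?h -` C0 \<inter> space ?P = cone_region strict \<sigma> \<nu> \<kappa> \<inter> {(a, b, c, d). a\<^sup>2 + b\<^sup>2 + c\<^sup>2 + d\<^sup>2 \<le> 1}"
    by (auto simp: C0_def norm_le space_pair_measure)
  also have "emeasure ?P \<dots> = (\<integral>\<^sup>+t. ennreal (\<kappa> / ((1 + t\<^sup>2) * sqrt (1 + \<kappa>\<^sup>2 + t\<^sup>2)) * arctan (\<kappa> * \<sigma> t / sqrt (1 + \<kappa>\<^sup>2 + t\<^sup>2)) / 8)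
       * indicator {0..\<nu>} t \<partial>lborel)"
    using pos by (intro emeasure_cone_region \<sigma>_meas) (auto simp: \<sigma>_def)
  also have "\<dots> = (\<integral>\<^sup>+t. ennreal (indicator {0..\<nu>} t * (g t / 8)) \<partial>lborel)"
    by (intro nn_integral_cong) (simp add: arg g_def indicator_def)
  also have "\<dots> = ennreal (integral {0..\<nu>} g / 8)"
  proof (rule nn_integral_has_integral_lebesgue)
    have "(g has_integral integral {0..\<nu>} g) {0..\<nu>}"
      using g_int by (rule integrable_integral)
    then show "((\<lambda>t. g t / 8) has_integral integral {0..\<nu>} g / 8) {0..\<nu>}"
      by (rule has_integral_divide)
  qed (use g_nonneg in simp)
  finally have "emeasure lborel C0 = ennreal (integral {0..\<nu>} g / 8)" .
  moreover have "integral {0..\<nu>} g \<ge> 0"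
    using g_int g_nonneg by (rule integral_nonneg)
  ultimately have "measure lborel C0 = integral {0..\<nu>} g / 8"
    by (simp add: measure_def)
  moreover have "measure lebesgue C = measure lebesgue C0"
    unfolding im using frame_map_orthogonal C0_bdd by (rule measure_orthogonal_image)
  moreover have "measure lebesgue C0 = measure lborel C0"
    using C0 by simp
  ultimately show "4 * measure lebesgue C = lambert_part \<Lambda> \<nu> \<kappa>"
    by (simp add: lambert_part_def g_def[abs_def])
qed

end

text \<open>The cone over a Lambert cube in a frame adapted to the edge with angle \<alpha>:
  \<open>c\<close>, \<open>s\<close> are cosine and sine of the length of this edge,
  \<open>a\<^sub>1\<close>, \<open>a\<^sub>2\<close> those of \<alpha>. The inequalities come in
  pairs: the faces at the ends of the edge, the faces containing it, and the two outer
  faces.\<close>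

definition lambert_sector :: "real \<Rightarrow> real \<Rightarrow> real \<Rightarrow> real \<Rightarrow> real \<Rightarrow> real \<Rightarrow> (real \<times> real \<times> real \<times> real) set" where
  "lambert_sector c s a\<^sub>1 a\<^sub>2 \<kappa> \<kappa>' = {(y1, y2, y3, y4). 0 \<le> y2 \<and> c * y2 \<le> s * y1 \<and> 0 \<le> y4 \<and> a\<^sub>1 * y4 \<le> a\<^sub>2 * y3 \<and>
     y3 \<le> \<kappa> * y1 \<and> a\<^sub>1 * y3 + a\<^sub>2 * y4 \<le> \<kappa>' * (c * y1 + s * y2)}"

text \<open>The map acts on the plane of the edge and on its orthogonal complement by a reflection
  each. It exchanges the ends of the edge and the two faces through it, hence also
  \<open>\<kappa>\<close> and \<open>\<kappa>'\<close>.\<close>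

lemma lambert_sector_reflect:
  assumes "c\<^sup>2 + s\<^sup>2 = 1" "a\<^sub>1\<^sup>2 + a\<^sub>2\<^sup>2 = 1"
  shows "(c * y1 + s * y2, s * y1 - c * y2, a\<^sub>1 * y3 + a\<^sub>2 * y4, a\<^sub>2 * y3 - a\<^sub>1 * y4) \<in> lambert_sector c s a\<^sub>1 a\<^sub>2 \<kappa>' \<kappa>
     \<longleftrightarrow> (y1, y2, y3, y4) \<in> lambert_sector c s a\<^sub>1 a\<^sub>2 \<kappa> \<kappa>'"
proof -
  have "c * (c * y1 + s * y2) + s * (s * y1 - c * y2) = (c\<^sup>2 + s\<^sup>2) * y1"
    and "s * (c * y1 + s * y2) - c * (s * y1 - c * y2) = (c\<^sup>2 + s\<^sup>2) * y2"
    and "a\<^sub>1 * (a\<^sub>1 * y3 + a\<^sub>2 * y4) + a\<^sub>2 * (a\<^sub>2 * y3 - a\<^sub>1 * y4) = (a\<^sub>1\<^sup>2 + a\<^sub>2\<^sup>2) * y3"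
    and "a\<^sub>2 * (a\<^sub>1 * y3 + a\<^sub>2 * y4) - a\<^sub>1 * (a\<^sub>2 * y3 - a\<^sub>1 * y4) = (a\<^sub>1\<^sup>2 + a\<^sub>2\<^sup>2) * y4"
    by algebra+
  then have 1: "c * (c * y1 + s * y2) + s * (s * y1 - c * y2) = y1"
    and 2: "s * (c * y1 + s * y2) - c * (s * y1 - c * y2) = y2"
    and 3: "a\<^sub>1 * (a\<^sub>1 * y3 + a\<^sub>2 * y4) + a\<^sub>2 * (a\<^sub>2 * y3 - a\<^sub>1 * y4) = y3"
    and 4: "a\<^sub>2 * (a\<^sub>1 * y3 + a\<^sub>2 * y4) - a\<^sub>1 * (a\<^sub>2 * y3 - a\<^sub>1 * y4) = y4"
    using assms by simp_all
  have "c * (s * y1 - c * y2) \<le> s * (c * y1 + s * y2) \<longleftrightarrow> 0 \<le> y2" using 2 by linarith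
  moreover have "a\<^sub>1 * (a\<^sub>2 * y3 - a\<^sub>1 * y4) \<le> a\<^sub>2 * (a\<^sub>1 * y3 + a\<^sub>2 * y4) \<longleftrightarrow> 0 \<le> y4" using 4 by linarith
  ultimately show ?thesis
    unfolding lambert_sector_def by (auto simp: 1 3)
qed

locale lambert_sector_params =
  fixes c s a\<^sub>1 a\<^sub>2 \<kappa> \<kappa>' :: real
  assumes cs: "c > 0" "s > 0" "c\<^sup>2 + s\<^sup>2 = 1" and a: "a\<^sub>1 < 0" "a\<^sub>2 > 0" "a\<^sub>1\<^sup>2 + a\<^sub>2\<^sup>2 = 1"
    and \<kappa>: "\<kappa> > 0" "\<kappa>' > 0" and rel: "\<kappa> * \<kappa>' * c = - a\<^sub>1"
begin

definition part :: "bool \<Rightarrow> real \<Rightarrow> (real \<times> real \<times> real \<times> real) set" where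
  "part strict k = cone_region strict (\<lambda>t. (k\<^sup>2 + 1 + s / c * t) / (k\<^sup>2 * (- (a\<^sub>2 / a\<^sub>1)))) (s / c) k"

text \<open>By \<open>rel\<close> the slope bound of the cone region takes a form that is symmetric
  under the reflection. It compares the fractions \<open>y3 / (\<kappa> * y1)\<close> and
  \<open>(a\<^sub>1 * y3 + a\<^sub>2 * y4) / (\<kappa>' * (c * y1 + s * y2))\<close>, that is, it
  says that a radial ray from the axis meets the outer face \<open>y3 = \<kappa> * y1\<close> no
  later than the other one.\<close>

lemma part_iff:
  "(y1, y2, y3, y4) \<in> part strict \<kappa> \<longleftrightarrow> 0 < y1 \<and> 0 \<le> y2 \<and> c * y2 \<le> s * y1 \<and> 0 < y3 \<and> y3 \<le> \<kappa> * y1 \<and> 0 \<le> y4 \<and>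
     \<kappa> * y1 * (a\<^sub>1 * y3 + a\<^sub>2 * y4) \<le> \<kappa>' * (c * y1 + s * y2) * y3 \<and>
     (strict \<longrightarrow> \<kappa> * y1 * (a\<^sub>1 * y3 + a\<^sub>2 * y4) \<noteq> \<kappa>' * (c * y1 + s * y2) * y3)"
proof (cases "y1 > 0")
  case True
  define X where "X = y3 * ((\<kappa>\<^sup>2 + 1 + s / c * (y2 / y1)) / (\<kappa>\<^sup>2 * (- (a\<^sub>2 / a\<^sub>1))))"
  have eq: "\<kappa> * a\<^sub>2 * y1 * X = \<kappa>' * (c * y1 + s * y2) * y3 - \<kappa> * y1 * (a\<^sub>1 * y3)"
  proof -
    have k: "\<kappa>' = - a\<^sub>1 / (\<kappa> * c)" using rel \<kappa> cs by (simp add: field_simps)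
    show ?thesis
      unfolding k X_def using \<kappa> cs a True by (simp add: divide_simps power2_eq_square) (simp add: algebra_simps)
  qed
  have r: "\<kappa> * a\<^sub>2 * y1 > 0" using True \<kappa> a by simp
  have "y4 \<le> X \<longleftrightarrow> \<kappa> * a\<^sub>2 * y1 * y4 \<le> \<kappa> * a\<^sub>2 * y1 * X"
    and "y4 < X \<longleftrightarrow> \<kappa> * a\<^sub>2 * y1 * y4 < \<kappa> * a\<^sub>2 * y1 * X"
    by (rule mult_le_cancel_left_pos[OF r, symmetric] mult_less_cancel_left_pos[OF r, symmetric])+
  then have "y4 \<le> X \<longleftrightarrow> \<kappa> * y1 * (a\<^sub>1 * y3 + a\<^sub>2 * y4) \<le> \<kappa>' * (c * y1 + s * y2) * y3"
    and "y4 < X \<longleftrightarrow> \<kappa> * y1 * (a\<^sub>1 * y3 + a\<^sub>2 * y4) < \<kappa>' * (c * y1 + s * y2) * y3"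
    unfolding eq by (simp_all add: algebra_simps)
  moreover have "y2 \<le> s / c * y1 \<longleftrightarrow> c * y2 \<le> s * y1"
    using cs by (simp add: field_simps)
  moreover have "(y1, y2, y3, y4) \<in> part strict \<kappa> \<longleftrightarrow> 0 < y1 \<and> 0 \<le> y2 \<and> y2 \<le> s / c * y1 \<and> 0 < y3 \<and> y3 \<le> \<kappa> * y1 \<and>
      0 \<le> y4 \<and> (if strict then y4 < X else y4 \<le> X)"
    unfolding part_def cone_region_def X_def by simp
  ultimately show ?thesis
    using True by auto
qed (auto simp: part_def cone_region_def)

lemma part_subset: "part strict \<kappa> \<subseteq> lambert_sector c s a\<^sub>1 a\<^sub>2 \<kappa> \<kappa>'"
proof (clarify)
  fix y1 y2 y3 y4
  assume "(y1, y2, y3, y4) \<in> part strict \<kappa>"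
  then have y: "0 < y1" "0 \<le> y2" "c * y2 \<le> s * y1" "0 < y3" "y3 \<le> \<kappa> * y1" "0 \<le> y4"
     "\<kappa> * y1 * (a\<^sub>1 * y3 + a\<^sub>2 * y4) \<le> \<kappa>' * (c * y1 + s * y2) * y3" by (auto simp: part_iff)
  have "a\<^sub>1 * y4 \<le> 0" "0 \<le> a\<^sub>2 * y3" using y a by (auto simp: mult_nonpos_nonneg)
  moreover have "\<kappa>' * (c * y1 + s * y2) * y3 \<le> \<kappa>' * (c * y1 + s * y2) * (\<kappa> * y1)"
    using y cs \<kappa> by (intro mult_left_mono) auto
  with y(7) have "\<kappa> * y1 * (a\<^sub>1 * y3 + a\<^sub>2 * y4) \<le> \<kappa> * y1 * (\<kappa>' * (c * y1 + s * y2))"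
    by (simp add: mult_ac)
  then have "a\<^sub>1 * y3 + a\<^sub>2 * y4 \<le> \<kappa>' * (c * y1 + s * y2)"
    using y(1) \<kappa> by (subst (asm) mult_le_cancel_left_pos) auto
  ultimately show "(y1, y2, y3, y4) \<in> lambert_sector c s a\<^sub>1 a\<^sub>2 \<kappa> \<kappa>'"
    using y by (auto simp: lambert_sector_def)
qed

end

lemma lambert_sector_params_swap:
  "lambert_sector_params c s a\<^sub>1 a\<^sub>2 \<kappa> \<kappa>' \<Longrightarrow> lambert_sector_params c s a\<^sub>1 a\<^sub>2 \<kappa>' \<kappa>"
  by (simp add: lambert_sector_params_def mult_ac)

context lambert_sector_params
begin

interpretation swap: lambert_sector_params c s a\<^sub>1 a\<^sub>2 \<kappa>' \<kappa>
  using lambert_sector_params_axioms by (rule lambert_sector_params_swap)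

text \<open>A radial ray leaves the sector through one of the two outer faces, and ties are assigned
  to the first part by taking the second one strict. The coordinates \<open>w1\<close>, ...,
  \<open>w4\<close> are the reflected ones, so the second part is the first with
  \<open>\<kappa>\<close> and \<open>\<kappa>'\<close> exchanged.\<close>

lemma sector_cover:
  fixes y1 y2 y3 y4 :: real
  defines "w1 \<equiv> c * y1 + s * y2" and "w2 \<equiv> s * y1 - c * y2"
    and "w3 \<equiv> a\<^sub>1 * y3 + a\<^sub>2 * y4" and "w4 \<equiv> a\<^sub>2 * y3 - a\<^sub>1 * y4"
  shows "(w1, w2, w3, w4) \<in> part True \<kappa>' \<Longrightarrow> (y1, y2, y3, y4) \<in> lambert_sector c s a\<^sub>1 a\<^sub>2 \<kappa> \<kappa>'"
    and "\<not> ((y1, y2, y3, y4) \<in> part False \<kappa> \<and> (w1, w2, w3, w4) \<in> part True \<kappa>')"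
    and "(y1, y2, y3, y4) \<in> lambert_sector c s a\<^sub>1 a\<^sub>2 \<kappa> \<kappa>' \<Longrightarrow> y1 \<noteq> 0 \<Longrightarrow> y3 \<noteq> 0 \<Longrightarrow> w1 \<noteq> 0 \<Longrightarrow> w3 \<noteq> 0 \<Longrightarrow>
      (y1, y2, y3, y4) \<in> part False \<kappa> \<or> (w1, w2, w3, w4) \<in> part True \<kappa>'"
proof -
  have sector_refl: "(w1, w2, w3, w4) \<in> lambert_sector c s a\<^sub>1 a\<^sub>2 \<kappa>' \<kappa> \<longleftrightarrow> (y1, y2, y3, y4) \<in> lambert_sector c s a\<^sub>1 a\<^sub>2 \<kappa> \<kappa>'"
    unfolding w1_def w2_def w3_def w4_def using cs(3) a(3) by (rule lambert_sector_reflect)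
  show "(w1, w2, w3, w4) \<in> part True \<kappa>' \<Longrightarrow> (y1, y2, y3, y4) \<in> lambert_sector c s a\<^sub>1 a\<^sub>2 \<kappa> \<kappa>'"
  proof -
    assume "(w1, w2, w3, w4) \<in> part True \<kappa>'"
    with swap.part_subset[of True] have "(w1, w2, w3, w4) \<in> lambert_sector c s a\<^sub>1 a\<^sub>2 \<kappa>' \<kappa>"
      by (rule subsetD)
    then show ?thesis by (simp only: sector_refl)
  qed
  have y_eq: "c * w1 + s * w2 = y1" "a\<^sub>1 * w3 + a\<^sub>2 * w4 = y3"
  proof -
    have "c * w1 + s * w2 = (c\<^sup>2 + s\<^sup>2) * y1" "a\<^sub>1 * w3 + a\<^sub>2 * w4 = (a\<^sub>1\<^sup>2 + a\<^sub>2\<^sup>2) * y3"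
      unfolding w1_def w2_def w3_def w4_def by algebra+
    then show "c * w1 + s * w2 = y1" "a\<^sub>1 * w3 + a\<^sub>2 * w4 = y3" using cs a by simp_all
  qed
  note p = part_iff[of y1 y2 y3 y4 False] swap.part_iff[of w1 w2 w3 w4 True, unfolded y_eq]
  show "\<not> ((y1, y2, y3, y4) \<in> part False \<kappa> \<and> (w1, w2, w3, w4) \<in> part True \<kappa>')"
    unfolding p by (auto simp: w1_def[symmetric] w3_def[symmetric] mult_ac)
  assume y: "(y1, y2, y3, y4) \<in> lambert_sector c s a\<^sub>1 a\<^sub>2 \<kappa> \<kappa>'" and nz: "y1 \<noteq> 0" "y3 \<noteq> 0" "w1 \<noteq> 0" "w3 \<noteq> 0"
  then have h: "0 \<le> y2" "c * y2 \<le> s * y1" "0 \<le> y4" "y3 \<le> \<kappa> * y1" "w3 \<le> \<kappa>' * w1"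
    "0 \<le> w2" "c * w2 \<le> s * w1" "0 \<le> w4"
    using sector_refl by (auto simp: lambert_sector_def w1_def w3_def)
  have "0 \<le> s * y1" using h(1,2) cs(1) by (meson dual_order.trans less_imp_le mult_nonneg_nonneg)
  then have y1: "y1 > 0" using cs(2) nz by (simp add: zero_le_mult_iff)
  have w1: "w1 > 0" using nz y1 h(1) cs unfolding w1_def by (simp add: add_pos_nonneg)
  show "(y1, y2, y3, y4) \<in> part False \<kappa> \<or> (w1, w2, w3, w4) \<in> part True \<kappa>'"
  proof (cases "y3 > 0 \<and> \<kappa> * y1 * w3 \<le> \<kappa>' * w1 * y3")
    case True
    then show ?thesis using h y1 unfolding p by (simp add: w1_def[symmetric] w3_def[symmetric])
  next
    case False
    \<comment> \<open>If \<open>y3\<close> is not positive, the ray does not meet the first outer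
      face at all; then \<open>a\<^sub>1 < 0\<close> and \<open>y4 \<ge> 0\<close> force
      \<open>w3\<close> to be positive.\<close>
    have "w3 > 0 \<and> \<kappa>' * w1 * y3 < \<kappa> * y1 * w3"
    proof (cases "y3 > 0")
      case True
      with False have lt: "\<kappa>' * w1 * y3 < \<kappa> * y1 * w3" by simp
      moreover have "0 < \<kappa>' * w1 * y3" using True \<kappa> w1 by simp
      ultimately have "0 < (\<kappa> * y1) * w3" by simp
      moreover have "0 < \<kappa> * y1" using \<kappa> y1 by simp
      ultimately show ?thesis using lt by (simp add: zero_less_mult_iff)
    next
      case y3: False
      then have "a\<^sub>1 * y3 \<ge> 0" using a by (simp add: mult_nonpos_nonpos)
      then have "w3 \<ge> 0" using h(3) a unfolding w3_def by simp
      with nz have "w3 > 0" by simp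
      moreover have "\<kappa>' * w1 * y3 \<le> 0" using y3 \<kappa> w1 by (simp add: mult_le_0_iff)
      moreover have "0 < \<kappa> * y1 * w3" using \<kappa> y1 \<open>w3 > 0\<close> by simp
      ultimately show ?thesis by simp
    qed
    then show ?thesis using h w1 unfolding p by simp
  qed
qed

end

lemma lambert_sector_measure:
  assumes fr: "orthonormal_frame u1 u2 u3 u4" and par: "lambert_sector_params c s a\<^sub>1 a\<^sub>2 \<kappa> \<kappa>'"
  shows "4 * measure lebesgue ({x. (u1 \<bullet> x, u2 \<bullet> x, u3 \<bullet> x, u4 \<bullet> x) \<in> lambert_sector c s a\<^sub>1 a\<^sub>2 \<kappa> \<kappa>'} \<inter> cball 0 1)
     = lambert_part (- (a\<^sub>2 / a\<^sub>1)) (s / c) \<kappa> + lambert_part (- (a\<^sub>2 / a\<^sub>1)) (s / c) \<kappa>'"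
proof -
  interpret lambert_sector_params c s a\<^sub>1 a\<^sub>2 \<kappa> \<kappa>' by (rule par)
  define w1 w2 w3 w4 where "w1 = c *\<^sub>R u1 + s *\<^sub>R u2" and "w2 = s *\<^sub>R u1 - c *\<^sub>R u2"
    and "w3 = a\<^sub>1 *\<^sub>R u3 + a\<^sub>2 *\<^sub>R u4" and "w4 = a\<^sub>2 *\<^sub>R u3 - a\<^sub>1 *\<^sub>R u4"
  have fr': "orthonormal_frame w1 w2 w3 w4"
    using fr cs(3) a(3) unfolding orthonormal_frame_def w1_def w2_def w3_def w4_def
    by (simp add: inner_add_left inner_add_right inner_diff_left inner_diff_right inner_commute power2_eq_square)
  define K where "K = {x. (u1 \<bullet> x, u2 \<bullet> x, u3 \<bullet> x, u4 \<bullet> x) \<in> lambert_sector c s a\<^sub>1 a\<^sub>2 \<kappa> \<kappa>'} \<inter> cball 0 1"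
  define C where "C = {x. (u1 \<bullet> x, u2 \<bullet> x, u3 \<bullet> x, u4 \<bullet> x) \<in> part False \<kappa>} \<inter> cball 0 1"
  define C' where "C' = {x. (w1 \<bullet> x, w2 \<bullet> x, w3 \<bullet> x, w4 \<bullet> x) \<in> part True \<kappa>'} \<inter> cball 0 1"
  have w: "w1 \<bullet> x = c * (u1 \<bullet> x) + s * (u2 \<bullet> x)" "w2 \<bullet> x = s * (u1 \<bullet> x) - c * (u2 \<bullet> x)"
    "w3 \<bullet> x = a\<^sub>1 * (u3 \<bullet> x) + a\<^sub>2 * (u4 \<bullet> x)" "w4 \<bullet> x = a\<^sub>2 * (u3 \<bullet> x) - a\<^sub>1 * (u4 \<bullet> x)" for x
    by (simp_all add: w1_def w2_def w3_def w4_def inner_add_left inner_diff_left)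
  have pos: "- (a\<^sub>2 / a\<^sub>1) > 0" "s / c > 0" using a cs by (simp_all add: divide_pos_neg)
  have C: "C \<in> lmeasurable" "4 * measure lebesgue C = lambert_part (- (a\<^sub>2 / a\<^sub>1)) (s / c) \<kappa>"
    unfolding C_def part_def using frame_cone_region[OF fr pos \<kappa>(1)] by simp_all
  have C': "C' \<in> lmeasurable" "4 * measure lebesgue C' = lambert_part (- (a\<^sub>2 / a\<^sub>1)) (s / c) \<kappa>'"
    unfolding C'_def part_def using frame_cone_region[OF fr' pos \<kappa>(2)] by simp_all
  have disj: "C \<inter> C' = {}"
    using sector_cover(2) by (auto simp: C_def C'_def w)
  have sub: "C \<union> C' \<subseteq> K"
    using part_subset sector_cover(1) by (auto simp: C_def C'_def K_def w)
  have "u1 \<noteq> 0" "u3 \<noteq> 0" "w1 \<noteq> 0" "w3 \<noteq> 0"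
    using fr fr' by (auto simp: orthonormal_frame_def)
  \<comment> \<open>Points missed by both parts have one of the coordinates that serve as
    denominators in the comparison equal to 0.\<close>
  then have "negligible ({x. u1 \<bullet> x = 0} \<union> {x. u3 \<bullet> x = 0} \<union> {x. w1 \<bullet> x = 0} \<union> {x. w3 \<bullet> x = 0})"
    by (intro negligible_Un negligible_hyperplane) auto
  moreover have "K - (C \<union> C') \<subseteq> {x. u1 \<bullet> x = 0} \<union> {x. u3 \<bullet> x = 0} \<union> {x. w1 \<bullet> x = 0} \<union> {x. w3 \<bullet> x = 0}"
    using sector_cover(3) by (auto simp: C_def C'_def K_def w)
  ultimately have "negligible (K - (C \<union> C'))" by (rule negligible_subset)
  then have "negligible (((C \<union> C') - K) \<union> (K - (C \<union> C')))"
    using sub by (simp add: Diff_eq_empty_iff[THEN iffD2])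
  then have "measure lebesgue K = measure lebesgue (C \<union> C')"
    using C C' by (intro measure_negligible_symdiff) auto
  also have "\<dots> = measure lebesgue C + measure lebesgue C'"
    using C(1) C'(1) disj by (intro measure_Union) (auto simp: fmeasurable_def)
  finally show ?thesis
    using C(2) C'(2) by (simp add: K_def)
qed

section \<open>Faces of the three-dimensional cube\<close>

text \<open>Indexing by a coordinate and a side makes opposite facets those that differ in the side
  only, and adjacent ones those with different coordinates.\<close>

definition cube_facet :: "3 \<times> bool \<Rightarrow> (real^3) set" where
  "cube_facet f = {x \<in> cbox 0 One. x $ fst f = of_bool (snd f)}"

lemma sum_Basis_nth [simp]: "(\<Sum>x\<in>Basis. (x :: real^'n) $ i) = 1"
proof -
  have "(One :: real^'n) \<bullet> axis i 1 = 1" by (simp add: axis_in_Basis_iff)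
  then show ?thesis by (simp add: inner_axis)
qed

lemma mem_unit_cube: "x \<in> cbox 0 (One :: real^3) \<longleftrightarrow> (\<forall>i. 0 \<le> x $ i \<and> x $ i \<le> 1)"
  by (simp add: mem_box_cart)

lemma cube_facet_face_of: "cube_facet f face_of cbox 0 One"
proof (cases f)
  case (Pair i b)
  have "(cbox 0 One \<inter> {x :: real^3. axis i 1 \<bullet> x = of_bool b}) face_of cbox 0 One"
    by (cases b; rule face_of_Int_supporting_hyperplane_le face_of_Int_supporting_hyperplane_ge)
       (auto simp: inner_axis' mem_unit_cube)
  moreover have "cbox 0 One \<inter> {x :: real^3. axis i 1 \<bullet> x = of_bool b} = cube_facet f"
    by (auto simp: cube_facet_def Pair inner_axis')
  ultimately show ?thesis by simp
qed

text \<open>A face inside no facet contains, for each coordinate and side, a point off that facet.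
  Averaging these points gives a point of the face in the interior of the cube, which a proper face
  cannot have.\<close>

lemma cube_face_subset_facet:
  assumes F: "F face_of cbox 0 (One :: real^3)" and ne: "F \<noteq> cbox 0 One"
  shows "\<exists>f. F \<subseteq> cube_facet f"
proof (rule ccontr)
  assume contra: "\<nexists>f. F \<subseteq> cube_facet f"
  have sub: "F \<subseteq> cbox 0 One" using F by (rule face_of_imp_subset)
  have "convex F" using F by (rule face_of_imp_convex)
  have ex: "\<exists>x\<in>F. x $ i \<noteq> of_bool b" for i b
    using contra sub unfolding cube_facet_def by (metis (mono_tags, lifting) fst_conv snd_conv mem_Collect_eq subset_iff)
  then obtain w where w: "\<And>i b. w i b \<in> F" "\<And>i b. w i b $ i \<noteq> of_bool b" by metis
  define m :: "3 \<Rightarrow> real^3" where "m i = (1 / 2) *\<^sub>R w i True + (1 / 2) *\<^sub>R w i False" for i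
  have m: "m i \<in> F" for i
    unfolding m_def using w by (intro convexD[OF \<open>convex F\<close>]) auto
  have box: "0 \<le> x $ j" "x $ j \<le> 1" if "x \<in> F" for x j
    using that sub mem_unit_cube by auto
  have mi: "0 < m i $ i" "m i $ i < 1" for i
    using w(2)[of i True] w(2)[of i False] box[OF w(1)[of i True], of i] box[OF w(1)[of i False], of i]
    by (auto simp: m_def)
  \<comment> \<open>The barycentre of \<open>m 1\<close>, \<open>m 2\<close>, \<open>m 3\<close>,
    nested so that only binary convex combinations occur.\<close>
  define z where "z = (1 / 3) *\<^sub>R m 1 + (2 / 3) *\<^sub>R ((1 / 2) *\<^sub>R m 2 + (1 / 2) *\<^sub>R m 3)"
  have "z \<in> F"
    unfolding z_def using m by (intro convexD[OF \<open>convex F\<close>]) auto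
  have z: "z $ i = (m 1 $ i + m 2 $ i + m 3 $ i) / 3" for i
    by (simp add: z_def field_simps)
  have "0 < z $ i \<and> z $ i < 1" for i
    using exhaust_3[of i] mi[of i] box[OF m[of 1], of i] box[OF m[of 2], of i] box[OF m[of 3], of i]
    unfolding z by auto
  then have "z \<in> interior (cbox 0 One)"
    by (simp add: interior_cbox mem_box_cart)
  with face_of_disjoint_interior[OF F ne] \<open>z \<in> F\<close> show False by blast
qed

lemma cube_third: assumes "i \<noteq> (j :: 3)" obtains k where "i \<noteq> k" "j \<noteq> k"
proof -
  have "card {i, j} \<noteq> CARD(3)" using assms by simp
  then have "{i, j} \<noteq> UNIV" by metis
  then obtain k where "k \<notin> {i, j}" by blast
  then show ?thesis using that[of k] by auto
qed

lemma cube_indices: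
  assumes "i \<noteq> j" "i \<noteq> k" "j \<noteq> (k :: 3)"
  shows "l = i \<or> l = j \<or> l = k"
proof -
  have "card {i, j, k} = CARD(3)" using assms by simp
  then have "{i, j, k} = UNIV" by (simp add: card_eq_UNIV_imp_eq_UNIV)
  then show ?thesis by blast
qed

lemma cube_vertex:
  assumes "i \<noteq> j" "i \<noteq> k" "j \<noteq> (k :: 3)"
  obtains x where "x \<in> cube_facet (i, b)" "x \<in> cube_facet (j, c)" "x \<in> cube_facet (k, d)"
    "\<And>f. x \<in> cube_facet f \<Longrightarrow> f \<in> {(i, b), (j, c), (k, d)}"
proof
  let ?x = "(\<chi> l. of_bool (if l = i then b else if l = j then c else d)) :: real^3"
  show "?x \<in> cube_facet (i, b)" "?x \<in> cube_facet (j, c)" "?x \<in> cube_facet (k, d)"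
    using assms by (auto simp: cube_facet_def mem_unit_cube)
  fix f assume f: "?x \<in> cube_facet f"
  have "l = i \<or> l = j \<or> l = k" for l
    using cube_indices[OF assms] .
  then show "f \<in> {(i, b), (j, c), (k, d)}"
    using f assms by (cases f) (auto simp: cube_facet_def split: if_splits)
qed

lemma cube_facet_disjoint: "b \<noteq> c \<Longrightarrow> cube_facet (i, b) \<inter> cube_facet (i, c) = {}"
  by (auto simp: cube_facet_def)

text \<open>The two end vertices of the edge differ in the third coordinate, so only the two given
  facets contain both.\<close>

lemma cube_edge_subset:
  assumes "i \<noteq> j" "cube_facet (i, b) \<inter> cube_facet (j, c) \<subseteq> cube_facet f"
  shows "f = (i, b) \<or> f = (j, c)"
proof -
  obtain k where k: "i \<noteq> k" "j \<noteq> k" using cube_third[OF assms(1)] by metis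
  obtain x y where x: "x \<in> cube_facet (i, b)" "x \<in> cube_facet (j, c)" "x \<in> cube_facet f \<Longrightarrow> f \<in> {(i, b), (j, c), (k, True)}"
    and y: "y \<in> cube_facet (i, b)" "y \<in> cube_facet (j, c)" "y \<in> cube_facet f \<Longrightarrow> f \<in> {(i, b), (j, c), (k, False)}"
    using cube_vertex[OF assms(1) k] by metis
  then show ?thesis using assms(2) by auto
qed

text \<open>A chain of five faces; transported to the spherical polyhedron its strictness determines
  all dimensions, see \<open>flag_dims\<close>.\<close>

lemma cube_flag:
  assumes "i \<noteq> j" "i \<noteq> k" "j \<noteq> k"
  shows "{} \<subset> cube_facet (i, b) \<inter> cube_facet (j, c) \<inter> cube_facet (k, d)"
    "cube_facet (i, b) \<inter> cube_facet (j, c) \<inter> cube_facet (k, d) \<subset> cube_facet (i, b) \<inter> cube_facet (j, c)"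
    "cube_facet (i, b) \<inter> cube_facet (j, c) \<subset> cube_facet (i, b)"
    "cube_facet (i, b) \<subset> cbox 0 One"
proof -
  obtain x where x: "x \<in> cube_facet (i, b)" "x \<in> cube_facet (j, c)" "x \<in> cube_facet (k, d)"
    using cube_vertex[OF assms] by metis
  obtain y where y: "y \<in> cube_facet (i, b)" "y \<in> cube_facet (j, c)" "y \<in> cube_facet (k, \<not> d)"
    using cube_vertex[OF assms] by metis
  obtain z where z: "z \<in> cube_facet (i, b)" "z \<in> cube_facet (j, \<not> c)"
    using cube_vertex[OF assms] by metis
  obtain w where w: "w \<in> cube_facet (i, \<not> b)"
    using cube_vertex[OF assms] by metis
  show "{} \<subset> cube_facet (i, b) \<inter> cube_facet (j, c) \<inter> cube_facet (k, d)" using x by blast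
  show "cube_facet (i, b) \<inter> cube_facet (j, c) \<inter> cube_facet (k, d) \<subset> cube_facet (i, b) \<inter> cube_facet (j, c)"
    using y cube_facet_disjoint[of d "\<not> d" k] by blast
  show "cube_facet (i, b) \<inter> cube_facet (j, c) \<subset> cube_facet (i, b)"
    using z cube_facet_disjoint[of c "\<not> c" j] by blast
  show "cube_facet (i, b) \<subset> cbox 0 One"
    using w cube_facet_disjoint[of b "\<not> b" i] by (auto simp: cube_facet_def)
qed

section \<open>Spherical polyhedra with the face lattice of the cube\<close>

lemma spherical_polyhedron_cone:
  assumes "spherical_polyhedron P"
  obtains H where "finite H" "0 \<notin> H" "conic hull P = {x. \<forall>a\<in>H. a \<bullet> x \<le> 0}"
    "P = conic hull P \<inter> sphere 0 1" "interior (conic hull P) \<noteq> {}"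
proof -
  obtain H where H: "finite H" "0 \<notin> H" "P = {x \<in> sphere 0 1. \<forall>a\<in>H. a \<bullet> x \<le> 0}"
    and int: "interior (conic hull P) \<noteq> {}"
    using assms unfolding spherical_polyhedron_def by blast
  have "P \<noteq> {}" using int by auto
  have "conic hull P = {x. \<forall>a\<in>H. a \<bullet> x \<le> 0}"
  proof (intro set_eqI iffI)
    fix x assume "x \<in> conic hull P"
    then obtain c y where "x = c *\<^sub>R y" "0 \<le> c" "y \<in> P" by (auto simp: conic_hull_explicit)
    then show "x \<in> {x. \<forall>a\<in>H. a \<bullet> x \<le> 0}" by (auto simp: H(3) mult_nonneg_nonpos)
  next
    fix x assume x: "x \<in> {x. \<forall>a\<in>H. a \<bullet> x \<le> 0}"
    show "x \<in> conic hull P"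
    proof (cases "x = 0")
      case True
      then show ?thesis using \<open>P \<noteq> {}\<close> by (simp add: conic_hull_contains_0)
    next
      case False
      have "(1 / norm x) *\<^sub>R x \<in> P"
        using x False by (auto simp: H(3) divide_le_0_iff)
      moreover have "x = norm x *\<^sub>R ((1 / norm x) *\<^sub>R x)" using False by simp
      ultimately show ?thesis
        unfolding conic_hull_explicit by (metis (mono_tags, lifting) mem_Collect_eq norm_ge_zero)
    qed
  qed
  moreover from this have "P = conic hull P \<inter> sphere 0 1" using H(3) by blast
  ultimately show ?thesis using that H int by blast
qed

locale spherical_cube =
  fixes P :: "(real^4) set" and \<phi> :: "(real^4) set \<Rightarrow> (real^3) set"
  assumes poly: "spherical_polyhedron P"
    and bij: "bij_betw \<phi> {F. spherical_face P F} {F. F face_of cbox 0 One}"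
    and mono: "spherical_face P F \<Longrightarrow> spherical_face P G \<Longrightarrow> F \<subseteq> G \<longleftrightarrow> \<phi> F \<subseteq> \<phi> G"
begin

abbreviation "K \<equiv> conic hull P"

definition \<psi> :: "(real^3) set \<Rightarrow> (real^4) set" where
  "\<psi> = inv_into {F. spherical_face P F} \<phi>"

lemma \<psi>_face: "X face_of cbox 0 One \<Longrightarrow> spherical_face P (\<psi> X)"
  and \<phi>_\<psi>: "X face_of cbox 0 One \<Longrightarrow> \<phi> (\<psi> X) = X"
  and \<psi>_\<phi>: "spherical_face P F \<Longrightarrow> \<psi> (\<phi> F) = F"
  and \<phi>_face: "spherical_face P F \<Longrightarrow> \<phi> F face_of cbox 0 One"
  using bij_betw_inv_into[OF bij] bij_betw_inv_into_right[OF bij] bij_betw_inv_into_left[OF bij] bij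
  unfolding \<psi>_def[symmetric] by (auto dest: bij_betwE)

lemma \<psi>_subset: "X face_of cbox 0 One \<Longrightarrow> Y face_of cbox 0 One \<Longrightarrow> \<psi> X \<subseteq> \<psi> Y \<longleftrightarrow> X \<subseteq> Y"
  using mono \<psi>_face \<phi>_\<psi> by metis

lemma \<psi>_psubset: "X face_of cbox 0 One \<Longrightarrow> Y face_of cbox 0 One \<Longrightarrow> X \<subset> Y \<Longrightarrow> \<psi> X \<subset> \<psi> Y"
  using \<psi>_subset by (metis psubset_eq subset_antisym)

lemma convex_K: "convex K" and closed_K: "closed K" and conic_K: "conic K"
  and interior_K: "interior K \<noteq> {}" and P_eq: "P = K \<inter> sphere 0 1"
proof -
  obtain H where "finite H" "0 \<notin> H" and H: "K = {x. \<forall>a\<in>H. a \<bullet> x \<le> 0}" "P = K \<inter> sphere 0 1" "interior K \<noteq> {}"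
    by (rule spherical_polyhedron_cone[OF poly])
  have K: "K = (\<Inter>a\<in>H. {x. a \<bullet> x \<le> 0})" using H(1) by auto
  show "convex K" unfolding K by (intro convex_INT convex_halfspace_le)
  show "closed K" unfolding K by (intro closed_INT ballI closed_halfspace_le)
  show "conic K" by (rule conic_conic_hull)
  show "interior K \<noteq> {}" "P = K \<inter> sphere 0 1" by (fact H)+
qed

lemma spherical_face_Int: "spherical_face P F \<Longrightarrow> spherical_face P G \<Longrightarrow> spherical_face P (F \<inter> G)"
proof -
  assume "spherical_face P F" "spherical_face P G"
  then obtain F' G' where "F' face_of K" "G' face_of K" "F = F' \<inter> sphere 0 1" "G = G' \<inter> sphere 0 1"
    by (auto simp: spherical_face_def)
  then show ?thesis
    unfolding spherical_face_def by (intro exI[of _ "F' \<inter> G'"]) (auto intro: face_of_Int)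
qed

lemma spherical_face_empty: "spherical_face P {}"
  unfolding spherical_face_def by (rule exI[of _ "{}"]) auto

lemma spherical_face_P: "spherical_face P P"
  unfolding spherical_face_def using P_eq face_of_refl[OF convex_K] by blast

lemma spherical_face_subset: "spherical_face P F \<Longrightarrow> F \<subseteq> P"
  unfolding spherical_face_def using P_eq face_of_imp_subset by blast

text \<open>Intersections are meets in both face lattices, and an order isomorphism preserves meets.
  This carries incidences of facets over without any geometric information about
  \<open>\<phi>\<close>.\<close>

lemma \<psi>_Int:
  assumes "X face_of cbox 0 One" "Y face_of cbox 0 One"
  shows "\<psi> (X \<inter> Y) = \<psi> X \<inter> \<psi> Y"
proof
  have XY: "X \<inter> Y face_of cbox 0 One" using assms by (rule face_of_Int)
  then show "\<psi> (X \<inter> Y) \<subseteq> \<psi> X \<inter> \<psi> Y" using assms \<psi>_subset by simp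
  have f: "spherical_face P (\<psi> X \<inter> \<psi> Y)" using assms \<psi>_face spherical_face_Int by blast
  have "\<phi> (\<psi> X \<inter> \<psi> Y) \<subseteq> \<phi> (\<psi> X)" "\<phi> (\<psi> X \<inter> \<psi> Y) \<subseteq> \<phi> (\<psi> Y)"
    using f \<psi>_face assms mono by (metis Int_lower1, metis Int_lower2)
  then have "\<phi> (\<psi> X \<inter> \<psi> Y) \<subseteq> X \<inter> Y" using assms \<phi>_\<psi> by simp
  then have "\<psi> (\<phi> (\<psi> X \<inter> \<psi> Y)) \<subseteq> \<psi> (X \<inter> Y)" using \<psi>_subset \<phi>_face[OF f] XY by blast
  then show "\<psi> X \<inter> \<psi> Y \<subseteq> \<psi> (X \<inter> Y)" using \<psi>_\<phi>[OF f] by simp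
qed

lemma \<psi>_empty: "\<psi> {} = {}"
proof -
  have e: "{} face_of cbox 0 (One :: real^3)" by simp
  have "\<phi> {} \<subseteq> \<phi> (\<psi> {})" using mono[OF spherical_face_empty \<psi>_face[OF e]] by simp
  then have "\<phi> {} = {}" using \<phi>_\<psi>[OF e] by simp
  then show ?thesis using \<psi>_\<phi>[OF spherical_face_empty] by simp
qed

lemma cone_face_nonneg_scale:
  assumes "G face_of K" "x \<in> G" "0 \<le> c"
  shows "c *\<^sub>R x \<in> G"
  using face_of_conic[OF conic_K assms(1)] assms by (auto simp: conic_def)

lemma cone_face_normalize:
  assumes G: "G face_of K" and x: "x \<in> G" "x \<noteq> 0"
  shows "(1 / norm x) *\<^sub>R x \<in> G \<inter> sphere 0 1"
  using cone_face_nonneg_scale[OF G x(1), of "1 / norm x"] x(2) by simp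

lemma dim_spherical_face:
  assumes G: "G face_of K"
  shows "dim (G \<inter> sphere 0 1) = dim G"
proof -
  have "x \<in> span (G \<inter> sphere 0 1)" if "x \<in> G" for x
  proof (cases "x = 0")
    case False
    then have "norm x *\<^sub>R ((1 / norm x) *\<^sub>R x) \<in> span (G \<inter> sphere 0 1)"
      using cone_face_normalize[OF G that] by (intro span_scale span_base)
    then show ?thesis using False by simp
  qed (simp add: span_zero)
  then have "span (G \<inter> sphere 0 1) = span G"
    by (intro subset_antisym span_mono span_minimal) (auto intro: subspace_span)
  then show ?thesis by (metis dim_span)
qed

text \<open>Proper faces of a convex set have smaller affine dimension; for the faces of the cone,
  which contain 0, affine and linear dimension agree.\<close>

lemma dim_spherical_face_less:
  assumes F: "spherical_face P F" and F': "spherical_face P F'" and less: "F \<subset> F'"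
  shows "dim F < dim F'"
proof -
  obtain G G' where G: "G face_of K" "F = G \<inter> sphere 0 1" and G': "G' face_of K" "F' = G' \<inter> sphere 0 1"
    using F F' by (auto simp: spherical_face_def)
  show ?thesis
  \<comment> \<open>The empty face is treated apart because its cone may be \<open>{}\<close>, which
    does not contain 0.\<close>
  proof (cases "F = {}")
    case True
    obtain x where "x \<in> F'" using less by blast
    then have "\<not> F' \<subseteq> {0}" using G' by auto
    then have "dim F' \<noteq> 0" by (simp add: dim_eq_0)
    then show ?thesis using True by (metis dim_empty gr0I)
  next
    case False
    obtain y where "y \<in> F" using False by blast
    then have zero: "0 \<in> G" using cone_face_nonneg_scale[OF G(1), of y 0] G by simp
    have sub: "G \<subseteq> G'"
    proof
      fix x assume x: "x \<in> G"
      obtain y where "y \<in> F'" using less by blast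
      then have "0 \<in> G'" using cone_face_nonneg_scale[OF G'(1), of y 0] G' by auto
      show "x \<in> G'"
      proof (cases "x = 0")
        case False
        then have "(1 / norm x) *\<^sub>R x \<in> G'"
          using cone_face_normalize[OF G(1) x] less G G' by blast
        from cone_face_nonneg_scale[OF G'(1) this norm_ge_zero[of x]] False show ?thesis by simp
      qed (use \<open>0 \<in> G'\<close> in simp)
    qed
    have "G face_of G'"
      using G(1) sub face_of_imp_subset[OF G'(1)] by (rule face_of_subset)
    moreover have "convex G'" using G'(1) by (rule face_of_imp_convex)
    moreover have "G \<noteq> G'" using less G G' by blast
    ultimately have "aff_dim G < aff_dim G'" by (intro face_of_aff_dim_lt)
    moreover have "aff_dim G = dim G" "aff_dim G' = dim G'"
      using zero sub by (auto intro!: aff_dim_zero hull_inc)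
    ultimately show ?thesis
      using dim_spherical_face[OF G(1)] dim_spherical_face[OF G'(1)] G G' by simp
  qed
qed

definition facet :: "3 \<times> bool \<Rightarrow> (real^4) set" where "facet f = \<psi> (cube_facet f)"

lemma facet_face: "spherical_face P (facet f)"
  unfolding facet_def by (intro \<psi>_face cube_facet_face_of)

text \<open>The isomorphism of face lattices says nothing about dimensions. But empty face, vertex,
  edge, facet and \<open>P\<close> form a strict chain whose dimensions increase strictly from 0 to
  at most 4, so they must be 0, 1, 2, 3, 4.\<close>

lemma flag_dims:
  assumes ijk: "i \<noteq> j" "i \<noteq> k" "j \<noteq> k"
  shows "facet (i, b) \<inter> facet (j, c) \<inter> facet (k, d) \<noteq> {}"
    "dim (facet (i, b) \<inter> facet (j, c)) = 2" "dim (facet (i, b)) = 3" "dim P = 4"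
proof -
  let ?v = "cube_facet (i, b) \<inter> cube_facet (j, c) \<inter> cube_facet (k, d)"
    and ?e = "cube_facet (i, b) \<inter> cube_facet (j, c)"
  note fl = cube_flag(1)[OF ijk, of b c d] cube_flag(2)[OF ijk, of b c d] cube_flag(3)[OF ijk, of b c] cube_flag(4)[OF ijk, of b]
  have f: "?v face_of cbox 0 One" "?e face_of cbox 0 One"
    by (intro face_of_Int cube_facet_face_of)+
  have v: "\<psi> ?v = facet (i, b) \<inter> facet (j, c) \<inter> facet (k, d)" and e: "\<psi> ?e = facet (i, b) \<inter> facet (j, c)"
    using f by (simp_all add: \<psi>_Int cube_facet_face_of facet_def)
  have top: "cbox 0 (One :: real^3) face_of cbox 0 One" by (simp add: face_of_refl)
  have "{} \<subset> \<psi> ?v" using \<psi>_psubset[OF _ f(1) fl(1)] by (simp add: \<psi>_empty)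
  then show "facet (i, b) \<inter> facet (j, c) \<inter> facet (k, d) \<noteq> {}" using v by auto
  have 1: "dim ({} :: (real^4) set) < dim (\<psi> ?v)"
    using \<open>{} \<subset> \<psi> ?v\<close> by (intro dim_spherical_face_less spherical_face_empty \<psi>_face f)
  have 2: "dim (\<psi> ?v) < dim (\<psi> ?e)"
    by (intro dim_spherical_face_less \<psi>_face \<psi>_psubset f fl)
  have 3: "dim (\<psi> ?e) < dim (facet (i, b))"
    unfolding facet_def by (intro dim_spherical_face_less \<psi>_face \<psi>_psubset f fl cube_facet_face_of)
  have "\<psi> (cbox 0 One) \<subseteq> P" by (intro spherical_face_subset \<psi>_face top)
  moreover have "facet (i, b) \<subset> \<psi> (cbox 0 One)"
    unfolding facet_def by (intro \<psi>_psubset top fl cube_facet_face_of)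
  ultimately have 4: "dim (facet (i, b)) < dim P"
    by (intro dim_spherical_face_less facet_face spherical_face_P) blast
  have "dim P \<le> 4" using dim_subset_UNIV[of P] by simp
  with 1 2 3 4 show "dim (facet (i, b) \<inter> facet (j, c)) = 2" "dim (facet (i, b)) = 3" "dim P = 4"
    unfolding e by simp_all
qed

lemma ex_indices: "\<exists>j k. (i :: 3) \<noteq> j \<and> i \<noteq> k \<and> j \<noteq> k"
proof -
  have "card {i} \<noteq> CARD(3)" by simp
  then have "{i} \<noteq> UNIV" by metis
  then obtain j where "j \<notin> {i}" by blast
  then have "i \<noteq> j" by simp
  then show ?thesis using cube_third[of i j] by metis
qed

lemma facet_dim: "dim (facet f) = 3" "dim P = 4"
proof -
  obtain i b where f: "f = (i, b)" by fastforce
  obtain j k where "i \<noteq> j" "i \<noteq> k" "j \<noteq> k" using ex_indices[of i] by metis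
  from flag_dims[OF this] show "dim (facet f) = 3" "dim P = 4" by (simp_all add: f)
qed

lemma edge_dim: "i \<noteq> j \<Longrightarrow> dim (facet (i, b) \<inter> facet (j, c)) = 2"
  using cube_third[of i j] flag_dims(2) by metis

lemma spherical_facet_facet: "spherical_facet P (facet f)"
  by (simp add: spherical_facet_def facet_face facet_dim)

lemma spherical_edge_facets: "i \<noteq> j \<Longrightarrow> spherical_edge P (facet (i, b) \<inter> facet (j, c))"
  by (simp add: spherical_edge_def edge_dim spherical_face_Int facet_face)

lemma face_subset_facet:
  assumes F: "spherical_face P F" and "F \<noteq> P"
  obtains f where "F \<subseteq> facet f"
proof -
  have "\<phi> F \<noteq> cbox 0 One"
  proof
    assume eq: "\<phi> F = cbox 0 One"
    have "\<phi> P \<subseteq> cbox 0 One" using \<phi>_face[OF spherical_face_P] by (rule face_of_imp_subset)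
    then have "P \<subseteq> F" using mono[OF spherical_face_P F] eq by simp
    then show False using \<open>F \<noteq> P\<close> spherical_face_subset[OF F] by blast
  qed
  then obtain f where "\<phi> F \<subseteq> cube_facet f" using cube_face_subset_facet[OF \<phi>_face[OF F]] by blast
  then have "\<psi> (\<phi> F) \<subseteq> facet f"
    unfolding facet_def by (subst \<psi>_subset) (auto intro: \<phi>_face F cube_facet_face_of)
  then show ?thesis using that \<psi>_\<phi>[OF F] by simp
qed

lemma spherical_facet_obtain:
  assumes "spherical_facet P F"
  obtains f where "F = facet f"
proof -
  have F: "spherical_face P F" "dim F = 3" using assms by (auto simp: spherical_facet_def)
  then have "F \<noteq> P" using facet_dim by auto
  then obtain f where f: "F \<subseteq> facet f" using face_subset_facet F by blast
  have "\<not> F \<subset> facet f"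
    using dim_spherical_face_less[OF F(1) facet_face, of f] F(2) facet_dim by auto
  then show ?thesis using that f by blast
qed

lemma facet_opposite: "b \<noteq> c \<Longrightarrow> facet (i, b) \<inter> facet (i, c) = {}"
  unfolding facet_def using \<psi>_Int[OF cube_facet_face_of cube_facet_face_of, of "(i, b)" "(i, c)"]
  by (simp add: cube_facet_disjoint \<psi>_empty)

lemma edge_subset_facet:
  assumes "i \<noteq> j" "facet (i, b) \<inter> facet (j, c) \<subseteq> facet f"
  shows "f = (i, b) \<or> f = (j, c)"
proof -
  have "\<psi> (cube_facet (i, b) \<inter> cube_facet (j, c)) \<subseteq> \<psi> (cube_facet f)"
    using assms by (simp add: \<psi>_Int cube_facet_face_of facet_def)
  then have "cube_facet (i, b) \<inter> cube_facet (j, c) \<subseteq> cube_facet f"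
    by (subst (asm) \<psi>_subset) (auto intro: face_of_Int cube_facet_face_of)
  then show ?thesis by (rule cube_edge_subset[OF assms(1)])
qed

text \<open>The two facets that define the angle cannot be opposite, since opposite facets are
  disjoint and the edge has dimension 2. The angle is restated by its cosine, which is what the
  computations with normals use.\<close>

lemma dihedral_edge:
  assumes "dim e = 2" "has_dihedral_angle P e a"
  obtains i b j c m n where "i \<noteq> j" "e = facet (i, b) \<inter> facet (j, c)"
    "outward_unit_normal P (facet (i, b)) m" "outward_unit_normal P (facet (j, c)) n" "m \<bullet> n = - cos a"
proof -
  obtain F G m n where FG: "spherical_facet P F" "spherical_facet P G" "F \<noteq> G" "e = F \<inter> G"
    and mn: "outward_unit_normal P F m" "outward_unit_normal P G n" and a: "a = pi - arccos (m \<bullet> n)"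
    using assms unfolding has_dihedral_angle_def by blast
  obtain f g where fg: "F = facet f" "G = facet g" using FG spherical_facet_obtain by metis
  obtain i b j c where ij: "f = (i, b)" "g = (j, c)" by fastforce
  have "i \<noteq> j"
  proof
    assume "i = j"
    then have "b \<noteq> c" using FG fg ij by auto
    then have "e = {}" using FG fg ij \<open>i = j\<close> facet_opposite by simp
    then show False using assms by simp
  qed
  have "norm m = 1" "norm n = 1" using mn by (auto simp: outward_unit_normal_def)
  then have "\<bar>m \<bullet> n\<bar> \<le> 1" using Cauchy_Schwarz_ineq2[of m n] by simp
  then have "m \<bullet> n = - cos a" by (simp add: a cos_diff cos_arccos_abs)
  then show ?thesis using that[OF \<open>i \<noteq> j\<close>] FG mn fg ij by simp
qed

text \<open>A facet spans a hyperplane, so two normals agree up to sign; opposite signs would put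
  all of \<open>P\<close> into this hyperplane and make the facet equal to \<open>P\<close>.
  Uniqueness is needed because each dihedral angle comes with its own choice of normals.\<close>

lemma outward_unit_normal_unique:
  assumes "outward_unit_normal P (facet f) m" "outward_unit_normal P (facet f) n"
  shows "m = n"
proof -
  have m: "norm m = 1" "\<And>x. x \<in> P \<Longrightarrow> m \<bullet> x \<le> 0" "facet f = {x \<in> P. m \<bullet> x = 0}"
    and n: "norm n = 1" "\<And>x. x \<in> P \<Longrightarrow> n \<bullet> x \<le> 0" "facet f = {x \<in> P. n \<bullet> x = 0}"
    using assms by (auto simp: outward_unit_normal_def)
  have hyper: "span (facet f) = {x. w \<bullet> x = 0}" if w: "norm w = 1" "facet f = {x \<in> P. w \<bullet> x = 0}" for w
  proof (rule subspace_dim_equal)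
    have "w \<noteq> 0" using w by auto
    then have "dim {x. w \<bullet> x = 0} = 3" using dim_hyperplane[of w] by simp
    then show "dim {x. w \<bullet> x = 0} \<le> dim (span (facet f))" by (simp add: facet_dim)
    show "span (facet f) \<subseteq> {x. w \<bullet> x = 0}"
      by (rule span_minimal) (use w subspace_hyperplane in auto)
  qed (auto simp: subspace_hyperplane)
  have eq: "m \<bullet> x = 0 \<longleftrightarrow> n \<bullet> x = 0" for x
    using hyper[OF m(1,3)] hyper[OF n(1,3)] by blast
  have mm: "m \<bullet> m = 1" "n \<bullet> n = 1" using m n by (simp_all add: norm_eq_1)
  define t where "t = m \<bullet> n"
  have "m \<bullet> (n - t *\<^sub>R m) = 0" by (simp add: inner_diff_right t_def mm)
  then have "n \<bullet> (n - t *\<^sub>R m) = 0" using eq by blast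
  then have "t * t = 1" by (simp add: inner_diff_right t_def mm inner_commute)
  have "(n - t *\<^sub>R m) \<bullet> (n - t *\<^sub>R m) = 0"
    using \<open>t * t = 1\<close> by (simp add: inner_diff_right inner_diff_left mm inner_commute t_def[symmetric])
  then have nt: "n = t *\<^sub>R m" by simp
  have "t \<noteq> - 1"
  proof
    assume "t = - 1"
    then have "m \<bullet> x = 0" if "x \<in> P" for x using m(2)[OF that] n(2)[OF that] nt by simp
    then have "facet f = P" using m(3) by auto
    then show False using facet_dim(1)[of f] facet_dim(2) by simp
  qed
  moreover have "t = 1 \<or> t = - 1" using \<open>t * t = 1\<close> by (simp add: square_eq_1_iff)
  ultimately show ?thesis using nt by simp
qed

end

section \<open>The normals of the six facets, and the cone and vertices they determine\<close>

context spherical_cube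
begin

lemma dihedral_facets:
  assumes "i \<noteq> j" "has_dihedral_angle P (facet (i, b) \<inter> facet (j, c)) a"
  obtains m n where "outward_unit_normal P (facet (i, b)) m" "outward_unit_normal P (facet (j, c)) n" "m \<bullet> n = - cos a"
proof -
  obtain i' b' j' c' m n where ij: "i' \<noteq> j'" and e: "facet (i, b) \<inter> facet (j, c) = facet (i', b') \<inter> facet (j', c')"
    and mn: "outward_unit_normal P (facet (i', b')) m" "outward_unit_normal P (facet (j', c')) n" "m \<bullet> n = - cos a"
    using dihedral_edge[OF edge_dim[OF assms(1)] assms(2)] by metis
  have "(i', b') = (i, b) \<or> (i', b') = (j, c)" "(j', c') = (i, b) \<or> (j', c') = (j, c)"
    using e by (intro edge_subset_facet[OF assms(1)]; blast)+
  then consider "(i', b') = (i, b)" "(j', c') = (j, c)" | "(i', b') = (j, c)" "(j', c') = (i, b)"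
    using ij assms(1) by auto
  then show ?thesis
    using that mn by cases (auto simp: inner_commute)
qed

text \<open>The half-spaces that define \<open>P\<close> may be redundant or repeated, so they are
  not matched with facets directly. A point outside \<open>K\<close> satisfying all six inequalities
  is joined to an interior point; where the segment leaves \<open>K\<close> a defining inequality is
  tight, hence the exit point lies in a proper face and so in a facet, although all six inequalities
  are strict there.\<close>

lemma cone_eq_normals:
  assumes nrm: "\<And>f. outward_unit_normal P (facet f) (nrm f)"
  shows "K = {x. \<forall>f. nrm f \<bullet> x \<le> 0}"
proof (intro subset_antisym subsetI)
  fix x assume "x \<in> K"
  then obtain c y where "x = c *\<^sub>R y" "0 \<le> c" "y \<in> P" by (auto simp: conic_hull_explicit)
  then show "x \<in> {x. \<forall>f. nrm f \<bullet> x \<le> 0}"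
    using nrm by (auto simp: outward_unit_normal_def mult_nonneg_nonpos)
next
  fix x assume "x \<in> {x. \<forall>f. nrm f \<bullet> x \<le> 0}"
  then have x: "nrm f \<bullet> x \<le> 0" for f by blast
  have n1: "norm (nrm f) = 1" for f using nrm by (simp add: outward_unit_normal_def)
  have nK: "nrm f \<bullet> y \<le> 0" if "y \<in> K" for f y
  proof -
    from that obtain c z where "y = c *\<^sub>R z" "0 \<le> c" "z \<in> P" by (auto simp: conic_hull_explicit)
    then show ?thesis using nrm[of f] by (auto simp: outward_unit_normal_def mult_nonneg_nonpos)
  qed
  obtain H where H: "finite H" "0 \<notin> H" "K = {x. \<forall>a\<in>H. a \<bullet> x \<le> 0}"
    by (rule spherical_polyhedron_cone[OF poly])
  obtain p where p: "p \<in> interior K" using interior_K by blast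
  \<comment> \<open>A small step from the interior point \<open>p\<close> in the direction
    \<open>a\<close> stays in \<open>K\<close>, so \<open>a \<bullet> p\<close> cannot be 0. This is
    applied to the normals and to the tight inequality.\<close>
  have neg: "a \<bullet> p < 0" if "a \<noteq> 0" "\<And>y. y \<in> K \<Longrightarrow> a \<bullet> y \<le> 0" for a
  proof -
    obtain e where e: "e > 0" "ball p e \<subseteq> K" using p by (meson mem_interior)
    define y where "y = p + (e / 2 / norm a) *\<^sub>R a"
    have "dist p y = e / 2" using that e by (simp add: y_def dist_norm)
    then have "y \<in> K" using e by (auto simp: subset_iff)
    from that(2)[OF this] have "a \<bullet> p + (e / 2 / norm a) * (a \<bullet> a) \<le> 0" by (simp add: y_def inner_add_right)
    moreover have "(e / 2 / norm a) * (a \<bullet> a) > 0" using that e by simp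
    ultimately show ?thesis by linarith
  qed
  have np: "nrm f \<bullet> p < 0" for f
    using neg nK n1 by (metis norm_zero zero_neq_one)
  show "x \<in> K"
  proof (rule ccontr)
    assume "x \<notin> K"
    have "closed_segment p x \<inter> frontier K \<noteq> {}"
    proof (rule connected_Int_frontier)
      show "closed_segment p x \<inter> K \<noteq> {}" using p interior_subset by fastforce
      show "closed_segment p x - K \<noteq> {}" using \<open>x \<notin> K\<close> by auto
    qed simp
    then obtain y where y: "y \<in> closed_segment p x" "y \<in> frontier K" by blast
    have yK: "y \<in> K" using y(2) closed_K by (simp add: frontier_def closure_closed)
    obtain a where a: "a \<in> H" "a \<bullet> y = 0"
    proof -
      have "\<exists>a\<in>H. a \<bullet> y = 0"
      proof (rule ccontr)
        assume no: "\<not> (\<exists>a\<in>H. a \<bullet> y = 0)"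
        have "a \<bullet> y < 0" if "a \<in> H" for a
          using no yK H(3) that by (metis (mono_tags, lifting) mem_Collect_eq order_le_less)
        then have "y \<in> (\<Inter>a\<in>H. {x. a \<bullet> x < 0})" by simp
        moreover have "open (\<Inter>a\<in>H. {x. a \<bullet> x < 0})"
          using H(1) by (intro open_INT ballI open_halfspace_lt)
        moreover have "(\<Inter>a\<in>H. {x. a \<bullet> x < 0}) \<subseteq> K" unfolding H(3) by (auto intro: less_imp_le)
        ultimately have "y \<in> interior K" using interior_maximal by blast
        then show False using y(2) by (simp add: frontier_def)
      qed
      then show ?thesis using that by blast
    qed
    obtain t where t: "0 \<le> t" "t \<le> 1" "y = (1 - t) *\<^sub>R p + t *\<^sub>R x"
      using y(1) by (auto simp: in_segment)
    have "t \<noteq> 1" using t yK \<open>x \<notin> K\<close> by auto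
    have ny: "nrm f \<bullet> y < 0" for f
    proof -
      have "nrm f \<bullet> y = (1 - t) * (nrm f \<bullet> p) + t * (nrm f \<bullet> x)" by (simp add: t inner_add_right)
      moreover have "(1 - t) * (nrm f \<bullet> p) < 0" using \<open>t \<noteq> 1\<close> t np[of f] by (intro mult_pos_neg) auto
      moreover have "t * (nrm f \<bullet> x) \<le> 0" using t x[of f] by (intro mult_nonneg_nonpos) auto
      ultimately show ?thesis by linarith
    qed
    have "y \<noteq> 0" using ny[of undefined] by auto
    define G where "G = K \<inter> {x. a \<bullet> x = 0}"
    have G: "G face_of K"
      unfolding G_def using a H(3) by (intro face_of_Int_supporting_hyperplane_le convex_K) auto
    define F where "F = G \<inter> sphere 0 1"
    have F: "spherical_face P F" using G by (auto simp: spherical_face_def F_def)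
    have ap: "a \<bullet> p < 0" using a H by (intro neg) auto
    have "F \<noteq> P"
    proof
      assume "F = P"
      have "p \<in> K" using p interior_subset by blast
      moreover have "p \<noteq> 0" using ap by auto
      ultimately have "(1 / norm p) *\<^sub>R p \<in> P"
        using cone_face_normalize[OF face_of_refl[OF convex_K]] P_eq by blast
      with \<open>F = P\<close> have "(1 / norm p) *\<^sub>R p \<in> F" by simp
      then have "a \<bullet> ((1 / norm p) *\<^sub>R p) = 0"
        by (simp only: F_def G_def Int_iff mem_Collect_eq)
      then show False using ap \<open>p \<noteq> 0\<close> by simp
    qed
    then obtain f where f: "F \<subseteq> facet f" using face_subset_facet[OF F] by blast
    have "y \<in> G" using yK a by (simp add: G_def)
    then have "(1 / norm y) *\<^sub>R y \<in> facet f"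
      using cone_face_normalize[OF G _ \<open>y \<noteq> 0\<close>] f unfolding F_def by blast
    then have "nrm f \<bullet> ((1 / norm y) *\<^sub>R y) = 0" using nrm[of f] by (simp add: outward_unit_normal_def)
    then show False using ny[of f] \<open>y \<noteq> 0\<close> by simp
  qed
qed

text \<open>A vertex avoids the opposites of its three facets, and this turns weak inequalities into
  strict ones; the strict signs later orient the frame.\<close>

lemma vertex_point:
  assumes nrm: "\<And>f. outward_unit_normal P (facet f) (nrm f)"
    and ijk: "i \<noteq> j" "i \<noteq> k" "j \<noteq> k"
  obtains p where "nrm (i, b) \<bullet> p = 0" "nrm (j, c) \<bullet> p = 0" "nrm (k, d) \<bullet> p = 0"
    "nrm (i, \<not> b) \<bullet> p < 0" "nrm (j, \<not> c) \<bullet> p < 0" "nrm (k, \<not> d) \<bullet> p < 0"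
proof -
  obtain p where p: "p \<in> facet (i, b)" "p \<in> facet (j, c)" "p \<in> facet (k, d)"
    using flag_dims(1)[OF ijk, of b c d] by blast
  have n: "nrm f \<bullet> x \<le> 0" "x \<in> facet f \<longleftrightarrow> nrm f \<bullet> x = 0" if "x \<in> P" for f x
    using nrm[of f] that by (auto simp: outward_unit_normal_def)
  have "p \<in> P" using p spherical_face_subset[OF facet_face] by blast
  have "p \<notin> facet (l, \<not> e)" if "p \<in> facet (l, e)" for l e
    using that facet_opposite[of e "\<not> e" l] by blast
  then show ?thesis
    using that[of p] p n[OF \<open>p \<in> P\<close>] by (metis order_le_less)
qed

end

text \<open>Up to relabelling, a perfect matching of the facets of the cube without opposite pairs is
  cyclic.\<close>
lemma cyclic_matching:
  fixes i1 j1 i2 j2 i3 j3 :: 3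
  assumes ne: "i1 \<noteq> j1" "i2 \<noteq> j2" "i3 \<noteq> j3"
    and disj: "{(i1, b1), (j1, c1)} \<inter> {(i2, b2), (j2, c2)} = {}" "{(i1, b1), (j1, c1)} \<inter> {(i3, b3), (j3, c3)} = {}"
      "{(i2, b2), (j2, c2)} \<inter> {(i3, b3), (j3, c3)} = {}"
  obtains i j k b c d where "i \<noteq> j" "i \<noteq> k" "j \<noteq> k" "{(i1, b1), (j1, c1)} = {(i, b), (j, \<not> c)}"
    "{(i2, b2), (j2, c2)} = {(j, c), (k, \<not> d)}" "{(i3, b3), (j3, c3)} = {(k, d), (i, \<not> b)}"
proof -
  obtain k where k: "i1 \<noteq> k" "j1 \<noteq> k" using cube_third[OF ne(1)] by metis
  note idx = cube_indices[OF ne(1) k]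
  have pair: "\<exists>p u v. {(l, x), (m, y)} = {(p, u), (k, v)} \<and> p \<noteq> k" if "l \<noteq> m" "l = k \<or> m = k"
    for l m :: 3 and x y :: bool
  proof (cases "l = k")
    case True
    then show ?thesis
      using that by (intro exI[of _ m] exI[of _ y] exI[of _ x]) (simp add: insert_commute)
  next
    case False
    then show ?thesis
      using that by (intro exI[of _ l] exI[of _ x] exI[of _ y]) simp
  qed
  \<comment> \<open>Otherwise the first two pairs would use up the four facets of the other two
    coordinates and leave two opposite facets for the third pair.\<close>
  have "i2 = k \<or> j2 = k"
    using idx[of i2] idx[of j2] idx[of i3] idx[of j3] ne disj by auto
  from pair[OF ne(2) this, of b2 c2] obtain p u v where 2: "{(i2, b2), (j2, c2)} = {(p, u), (k, v)}" "p \<noteq> k"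
    by metis
  have "i3 = k \<or> j3 = k"
    using idx[of i2] idx[of j2] idx[of i3] idx[of j3] ne disj by auto
  from pair[OF ne(3) this, of b3 c3] obtain p' u' v' where 3: "{(i3, b3), (j3, c3)} = {(p', u'), (k, v')}" "p' \<noteq> k"
    by metis
  have d: "(p, u) \<noteq> (i1, b1)" "(p, u) \<noteq> (j1, c1)" "(p', u') \<noteq> (i1, b1)" "(p', u') \<noteq> (j1, c1)" "(p, u) \<noteq> (p', u')" "v' = (\<not> v)"
    using disj unfolding 2(1) 3(1) by auto
  consider "p = j1" "p' = i1" | "p = i1" "p' = j1"
    using idx[of p] idx[of p'] 2(2) 3(2) d by auto
  then show ?thesis
  proof cases
    case 1
    with d have "u = (\<not> c1)" "u' = (\<not> b1)" "v = (\<not> v')" by auto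
    with 1 show ?thesis
      using ne(1) k 2(1) 3(1) by (intro that[of i1 j1 k b1 u v']) (simp_all add: insert_commute)
  next
    case swapped: 2
    with d have "u = (\<not> b1)" "u' = (\<not> c1)" "v = (\<not> v')" by auto
    with swapped show ?thesis
      using ne(1) k 2(1) 3(1) by (intro that[of j1 i1 k c1 u v']) (simp_all add: insert_commute)
  qed
qed

section \<open>The normals of a Lambert cube\<close>

text \<open>Connects the angle as computed from the normals with the form it has in
  \<open>lambert_part_add\<close>: for the arctangent's argument \<open>y\<close>,
  \<open>1 + y^2 = 1 / (b * s)^2\<close>.\<close>

lemma angle_from_cosine:
  fixes b b' c s \<beta> :: real
  assumes "b > 0" "b' > 0" "b\<^sup>2 + b'\<^sup>2 = 1" "c > 0" "s > 0" "c\<^sup>2 + s\<^sup>2 = 1"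
    and "cos \<beta> = - (b * s)" "0 \<le> \<beta>" "\<beta> \<le> pi"
  shows "pi - arctan (sqrt (1 + (b / b')\<^sup>2 + (s / c)\<^sup>2) / (s / c * (b / b'))) = \<beta>"
proof -
  define y where "y = sqrt (1 + (b / b')\<^sup>2 + (s / c)\<^sup>2) / (s / c * (b / b'))"
  have "y\<^sup>2 = (1 + (b / b')\<^sup>2 + (s / c)\<^sup>2) / (s / c * (b / b'))\<^sup>2"
  proof -
    have "1 + (b / b')\<^sup>2 + (s / c)\<^sup>2 \<ge> 0" by simp
    then show ?thesis
      unfolding y_def power_divide[of "sqrt (1 + (b / b')\<^sup>2 + (s / c)\<^sup>2)"] by (simp only: real_sqrt_pow2)
  qed
  also have "\<dots> = (b'\<^sup>2 * c\<^sup>2 + b\<^sup>2 * c\<^sup>2 + s\<^sup>2 * b'\<^sup>2) / (b * s)\<^sup>2"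
    using assms(1-2,4-5) by (simp add: divide_simps power2_eq_square) (simp add: algebra_simps)
  also have "b'\<^sup>2 * c\<^sup>2 + b\<^sup>2 * c\<^sup>2 + s\<^sup>2 * b'\<^sup>2 = (b\<^sup>2 + b'\<^sup>2) * (c\<^sup>2 + s\<^sup>2) - (b * s)\<^sup>2"
    by (simp add: algebra_simps power_mult_distrib)
  finally have "1 + y\<^sup>2 = 1 / (b * s)\<^sup>2"
    using assms by (simp add: diff_divide_distrib)
  then have "sqrt (1 + y\<^sup>2) = 1 / (b * s)"
    using assms by (simp add: real_sqrt_divide)
  then have "cos (pi - arctan y) = cos \<beta>"
    using assms by (simp add: cos_arctan cos_diff)
  moreover have "0 \<le> pi - arctan y" "pi - arctan y \<le> pi"
  proof -
    have "y \<ge> 0" using assms by (simp add: y_def)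
    then show "pi - arctan y \<le> pi" by simp
    show "0 \<le> pi - arctan y" using arctan_ubound[of y] pi_gt_zero by linarith
  qed
  ultimately have "pi - arctan y = \<beta>"
    using assms by (metis cos_inj_pi)
  then show ?thesis by (simp add: y_def)
qed

text \<open>Elimination of the edge length: \<open>l = cos\<^sup>2 \<alpha>\<close>, \<open>P = cos\<^sup>2 \<beta>\<close>, \<open>R = cos\<^sup>2 \<gamma>\<close>, and \<open>\<sigma>\<close> is the
  squared sine of the length of the edge with angle \<open>\<alpha>\<close>.\<close>
lemma principal_parameter_equation:
  fixes l P R \<sigma> :: real
  assumes "l > 0" "P > 0" "R > 0" "\<sigma> > 0" and E: "P * R * (1 - \<sigma>) = (\<sigma> - P) * (\<sigma> - R) * l"
  defines "L \<equiv> (1 - l) / l" and "M \<equiv> (1 - P) / P" and "N \<equiv> (1 - R) / R"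
  defines "X \<equiv> L * ((1 - \<sigma>) / \<sigma>)"
  shows "X * (X + (L + M + N + 1)) = L * M * N"
proof -
  define W where "W = P * R / l - P * R - \<sigma> * (P * R) + \<sigma> * (P + R)"
  have "(1 - \<sigma>) * (P * R / l) = (\<sigma> - P) * (\<sigma> - R)"
    using E \<open>l > 0\<close> by (simp add: field_simps)
  then have W: "(1 - \<sigma>) * W = \<sigma>\<^sup>2 * ((1 - P) * (1 - R))"
    unfolding W_def by algebra
  have "X + (L + M + N + 1) = W / (\<sigma> * P * R)"
    unfolding X_def L_def M_def N_def W_def using assms(1-4)
    by (simp add: divide_simps) (simp add: algebra_simps)
  then have "X * (X + (L + M + N + 1)) = L * ((1 - \<sigma>) * W) / (\<sigma>\<^sup>2 * P * R)"
    using \<open>\<sigma> > 0\<close> by (simp add: X_def power2_eq_square)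
  also have "\<dots> = L * M * N"
    unfolding W using assms(1-4) by (simp add: M_def N_def)
  finally show ?thesis .
qed

lemma tan_squared_cos: "cos x \<noteq> 0 \<Longrightarrow> (tan x)\<^sup>2 = (1 - (cos x)\<^sup>2) / (cos x)\<^sup>2"
  by (simp add: tan_def power_divide sin_squared_eq)

text \<open>The Gram matrix of the six normals is given except for the products of opposite ones.
  Orthogonality leaves each normal in a coordinate plane of a frame adapted to the edge of
  \<open>A\<close> and \<open>B'\<close> or of its reflection. The points \<open>p\<close> and
  \<open>q\<close> lie on the rays of two vertices and settle the signs that the Gram matrix leaves
  open.\<close>

lemma lambert_cone_volume:
  fixes A A' B B' C C' p q :: "real^4"
  assumes unit: "A \<bullet> A = 1" "A' \<bullet> A' = 1" "B \<bullet> B = 1" "B' \<bullet> B' = 1" "C \<bullet> C = 1" "C' \<bullet> C' = 1"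
    and orth: "A \<bullet> B = 0" "A \<bullet> C = 0" "A \<bullet> C' = 0" "A' \<bullet> B = 0" "A' \<bullet> B' = 0" "A' \<bullet> C' = 0"
      "B \<bullet> C = 0" "B' \<bullet> C = 0" "B' \<bullet> C' = 0"
    and ess: "A \<bullet> B' = - cos \<alpha>" "B \<bullet> C' = - cos \<beta>" "C \<bullet> A' = - cos \<gamma>"
    and \<alpha>: "pi / 2 < \<alpha>" "\<alpha> < pi" and \<beta>: "pi / 2 < \<beta>" "\<beta> < pi" and \<gamma>: "pi / 2 < \<gamma>" "\<gamma> < pi"
    and p: "A \<bullet> p = 0" "B' \<bullet> p = 0" "C' \<bullet> p = 0" "A' \<bullet> p < 0" "B \<bullet> p < 0"
    and q: "A \<bullet> q = 0" "B \<bullet> q = 0" "C \<bullet> q = 0" "B' \<bullet> q \<le> 0" "C' \<bullet> q < 0"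
    and LMN: "L = tan \<alpha>" "M = tan \<beta>" "N = tan \<gamma>" "r = (L\<^sup>2 + M\<^sup>2 + N\<^sup>2 + 1) / 2"
    and \<theta>: "pi / 2 < \<theta>" "\<theta> < pi" and tan\<theta>: "(tan \<theta>)\<^sup>2 = - r + sqrt (r\<^sup>2 + L\<^sup>2 * M\<^sup>2 * N\<^sup>2)"
  shows "4 * measure lebesgue ({x. \<forall>n\<in>{A, A', B, B', C, C'}. n \<bullet> x \<le> 0} \<inter> cball 0 1) =
    (delta \<alpha> \<theta> + delta \<beta> \<theta> + delta \<gamma> \<theta> - 2 * delta (pi / 2) \<theta> - delta 0 \<theta>) / 4"
proof -
  define a1 a2 where "a1 = cos \<alpha>" and "a2 = sin \<alpha>"
  have cneg: "cos x < 0" if "pi / 2 < x" "x < pi" for x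
    using cos_gt_zero_pi[of "pi - x"] that by simp
  have a: "a1 < 0" "a2 > 0" "a1\<^sup>2 + a2\<^sup>2 = 1"
    using cneg[OF \<alpha>] \<alpha> sin_gt_zero[of \<alpha>] by (simp_all add: a1_def a2_def)
  have cb: "cos \<beta> < 0" "cos \<gamma> < 0" using cneg \<beta> \<gamma> by auto
  \<comment> \<open>\<open>u1\<close> and \<open>u2\<close> span the plane of the edge of
    \<open>A\<close> and \<open>B'\<close>, with \<open>u1\<close> its end on the face of
    \<open>C\<close>; \<open>u3\<close> and \<open>u4\<close> span the orthogonal complement, with
    \<open>u3\<close> pointing along the face of \<open>A\<close>. The numbers \<open>c\<close> and
    \<open>s\<close> become cosine and sine of the length of the edge.\<close>
  define u2 u4 where "u2 = - C" and "u4 = - A"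
  define u3 where "u3 = (1 / a2) *\<^sub>R (a1 *\<^sub>R u4 - B')"
  define c where "c = C' \<bullet> u2"
  define D where "D = C' - c *\<^sub>R u2"
  define s where "s = norm D"
  define u1 where "u1 = - (1 / s) *\<^sub>R D"
  have orth': "B \<bullet> A = 0" "C \<bullet> A = 0" "C' \<bullet> A = 0" "B \<bullet> A' = 0" "B' \<bullet> A' = 0" "C' \<bullet> A' = 0"
      "C \<bullet> B = 0" "C \<bullet> B' = 0" "C' \<bullet> B' = 0" "B' \<bullet> A = - a1" "C' \<bullet> B = - cos \<beta>" "A' \<bullet> C = - cos \<gamma>"
    using orth ess by (simp_all add: inner_commute a1_def)
  have AB': "A \<bullet> B' = - a1" using ess by (simp add: a1_def)
  have Cc: "C \<bullet> C' = - c" "C' \<bullet> C = - c" by (simp_all add: c_def u2_def inner_commute)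
  have D_inner: "D \<bullet> B = - cos \<beta>" "D \<bullet> D = 1 - c\<^sup>2" "D \<bullet> A = 0" "D \<bullet> B' = 0" "D \<bullet> C = 0" "D \<bullet> C' = 1 - c\<^sup>2"
      "D \<bullet> A' = c * cos \<gamma> * - 1"
    using unit orth orth' Cc ess
    by (simp_all add: D_def u2_def inner_diff_left inner_diff_right power2_eq_square algebra_simps)
  \<comment> \<open>Here \<beta> not being a right angle keeps \<open>C'\<close> from being parallel
    to \<open>C\<close>.\<close>
  have "D \<noteq> 0" using D_inner(1) cb by auto
  then have s: "s > 0" "s\<^sup>2 = 1 - c\<^sup>2"
    using D_inner(2) by (simp_all add: s_def power2_norm_eq_inner)
  have u1_inner: "u1 \<bullet> x = - (D \<bullet> x) / s" for x by (simp add: u1_def)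
  have u1_inner': "x \<bullet> u1 = - (D \<bullet> x) / s" for x by (simp add: u1_def inner_commute)
  have fr: "orthonormal_frame u1 u2 u3 u4"
  proof -
    have 1: "u1 \<bullet> u1 = 1"
    proof -
      have "u1 \<bullet> u1 = (D \<bullet> D) / s\<^sup>2" by (simp add: u1_def power2_eq_square)
      moreover have "D \<bullet> D = s\<^sup>2" using s D_inner(2) by simp
      ultimately show ?thesis using s(1) by simp
    qed
    have 2: "u1 \<bullet> u2 = 0" "u1 \<bullet> u4 = 0" "u1 \<bullet> u3 = 0"
      using D_inner by (simp_all add: u1_inner u2_def u3_def u4_def inner_diff_right)
    have 3: "u2 \<bullet> u2 = 1" "u4 \<bullet> u4 = 1" "u2 \<bullet> u3 = 0" "u2 \<bullet> u4 = 0"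
      using unit orth orth' by (simp_all add: u2_def u3_def u4_def inner_diff_right)
    have 4: "u3 \<bullet> u4 = 0"
      using unit orth orth' by (simp add: u3_def u4_def inner_diff_left)
    have "(a1 *\<^sub>R u4 - B') \<bullet> (a1 *\<^sub>R u4 - B') = 1 - a1\<^sup>2"
      using unit orth' AB' by (simp add: u4_def inner_diff_left inner_diff_right inner_add_left inner_add_right power2_eq_square)
    also have "\<dots> = a2\<^sup>2" using a by simp
    finally have 5: "u3 \<bullet> u3 = 1" using a(2) by (simp add: u3_def power2_eq_square)
    show ?thesis using 1 2 3 4 5 by (simp add: orthonormal_frame_def)
  qed
  \<comment> \<open>\<open>B\<close> lies in the plane of \<open>u1\<close> and \<open>u3\<close>,
    and \<open>A'\<close> in the plane of the reflected vectors
    \<open>c *\<^sub>R u1 + s *\<^sub>R u2\<close> and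
    \<open>a1 *\<^sub>R u3 + a2 *\<^sub>R u4\<close>; these are the coordinates there, with signs
    chosen so that all four turn out positive.\<close>
  define b b' where "b = - (u1 \<bullet> B)" and "b' = u3 \<bullet> B"
  define g g' where "g = - cos \<gamma> / s" and "g' = a1 * (u3 \<bullet> A') + a2 * (u4 \<bullet> A')"
  have b: "b = - cos \<beta> / s" "b > 0" using D_inner s cb by (simp_all add: b_def u1_inner divide_neg_pos)
  have g: "g > 0" using cb s by (simp add: g_def divide_neg_pos)
  have B'_eq: "B' \<bullet> x = - a2 * (u3 \<bullet> x) + a1 * (u4 \<bullet> x)" for x
    using a by (simp add: u3_def inner_diff_left)
  have C'_eq: "C' \<bullet> x = - s * (u1 \<bullet> x) + c * (u2 \<bullet> x)" for x
    using s by (simp add: u1_def D_def inner_diff_left)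
  have A_eq: "A \<bullet> x = - (u4 \<bullet> x)" and C_eq: "C \<bullet> x = - (u2 \<bullet> x)" for x
    by (simp_all add: u2_def u4_def)
  have B_co: "u2 \<bullet> B = 0" "u4 \<bullet> B = 0" using orth orth' by (simp_all add: u2_def u4_def)
  have B_eq: "B \<bullet> x = - b * (u1 \<bullet> x) + b' * (u3 \<bullet> x)" for x
    by (subst frame_inner[OF fr]) (simp add: b_def b'_def B_co)
  have A'_co: "u1 \<bullet> A' = - g * c" "u2 \<bullet> A' = - g * s" "u3 \<bullet> A' = g' * a1" "u4 \<bullet> A' = g' * a2"
  proof -
    show "u1 \<bullet> A' = - g * c" using D_inner s by (simp add: u1_inner g_def)
    show "u2 \<bullet> A' = - g * s" using ess s by (simp add: u2_def g_def)
    have e: "a2 * (u3 \<bullet> A') = a1 * (u4 \<bullet> A')" using B'_eq[of A'] orth' by simp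
    have "g' * a1 = (a1\<^sup>2 + a2\<^sup>2) * (u3 \<bullet> A')" "g' * a2 = (a1\<^sup>2 + a2\<^sup>2) * (u4 \<bullet> A')"
      unfolding g'_def using e by algebra+
    then show "u3 \<bullet> A' = g' * a1" "u4 \<bullet> A' = g' * a2" using a by simp_all
  qed
  have A'_eq: "A' \<bullet> x = - g * (c * (u1 \<bullet> x) + s * (u2 \<bullet> x)) + g' * (a1 * (u3 \<bullet> x) + a2 * (u4 \<bullet> x))" for x
    by (subst frame_inner[OF fr]) (simp add: A'_co algebra_simps)
  have bb: "b\<^sup>2 + b'\<^sup>2 = 1" using B_eq[of B] unit by (simp add: b_def b'_def power2_eq_square)
  have gg: "g\<^sup>2 + g'\<^sup>2 = 1"
  proof -
    have "1 = g\<^sup>2 * (c\<^sup>2 + s\<^sup>2) + g'\<^sup>2 * (a1\<^sup>2 + a2\<^sup>2)"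
      using A'_eq[of A'] unit unfolding A'_co by (simp add: algebra_simps power2_eq_square)
    then show ?thesis using a s by simp
  qed
  have rel: "g * b * c + g' * b' * a1 = 0"
    using B_eq[of A'] orth' unfolding A'_co by (simp add: algebra_simps)
  \<comment> \<open>The axis is shorter than a right angle: \<open>p\<close> is a multiple of
    \<open>c *\<^sub>R u1 + s *\<^sub>R u2\<close>, the other end of the edge; \<open>A'\<close>
    shows that the factor \<open>t\<close> is positive, and then \<open>B\<close> gives the sign of
    \<open>c\<close>.\<close>
  have c: "c > 0"
  proof -
    have p34: "u4 \<bullet> p = 0" "u3 \<bullet> p = 0" using p A_eq[of p] B'_eq[of p] a by auto
    have e: "s * (u1 \<bullet> p) = c * (u2 \<bullet> p)" using p C'_eq[of p] by simp
    define t where "t = c * (u1 \<bullet> p) + s * (u2 \<bullet> p)"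
    have "u1 \<bullet> p = c * t"
    proof -
      have "c * t = (c\<^sup>2 + s\<^sup>2) * (u1 \<bullet> p)" unfolding t_def using e by algebra
      then show ?thesis using s by simp
    qed
    have "g * t > 0" using p(4) A'_eq[of p] p34 by (simp add: t_def)
    then have "t > 0" using g by (simp add: zero_less_mult_iff)
    have "b * (c * t) > 0" using p(5) B_eq[of p] p34 \<open>u1 \<bullet> p = c * t\<close> by simp
    then show ?thesis using b(2) \<open>t > 0\<close> by (simp add: zero_less_mult_iff)
  qed
  \<comment> \<open>\<open>q\<close> spans the common ray of the faces \<open>A\<close>,
    \<open>B\<close>, \<open>C\<close>, thus it lies in the plane of \<open>u1\<close> and
    \<open>u3\<close>; the faces \<open>B'\<close> and \<open>C'\<close> place it in the right
    quadrant.\<close>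
  have b': "b' > 0"
  proof -
    have q24: "u2 \<bullet> q = 0" "u4 \<bullet> q = 0" using q A_eq[of q] C_eq[of q] by auto
    have "u3 \<bullet> q \<ge> 0" using q(4) B'_eq[of q] q24 a by (simp add: zero_le_mult_iff)
    have "s * (u1 \<bullet> q) > 0" using q(5) C'_eq[of q] q24 by simp
    then have "u1 \<bullet> q > 0" using s by (simp add: zero_less_mult_iff)
    then have "b' * (u3 \<bullet> q) > 0" using q(2) B_eq[of q] b(2) by simp
    then show ?thesis using \<open>u3 \<bullet> q \<ge> 0\<close> by (simp add: zero_less_mult_iff)
  qed
  have g': "g' > 0"
  proof -
    have "g' * (b' * - a1) = g * b * c" using rel by (simp add: algebra_simps)
    also have "\<dots> > 0" using g b(2) c by simp
    finally have "0 < g' * (b' * - a1)" .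
    moreover have "0 < b' * - a1" using b' a by (intro mult_pos_pos) auto
    ultimately show ?thesis by (rule zero_less_mult_pos2)
  qed
  define \<kappa> \<kappa>' where "\<kappa> = b / b'" and "\<kappa>' = g / g'"
  have \<kappa>\<kappa>: "\<kappa> * \<kappa>' * c = - a1"
    using rel b' g' by (simp add: \<kappa>_def \<kappa>'_def field_simps)
  have par: "lambert_sector_params c s a1 a2 \<kappa> \<kappa>'"
  proof
    show "\<kappa> > 0" "\<kappa>' > 0" using b(2) b' g g' by (simp_all add: \<kappa>_def \<kappa>'_def)
  qed (use a c s \<kappa>\<kappa> in auto)
  have K: "{x. \<forall>n\<in>{A, A', B, B', C, C'}. n \<bullet> x \<le> 0} =
      {x. (u1 \<bullet> x, u2 \<bullet> x, u3 \<bullet> x, u4 \<bullet> x) \<in> lambert_sector c s a1 a2 \<kappa> \<kappa>'}"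
  proof -
    have "B \<bullet> x \<le> 0 \<longleftrightarrow> u3 \<bullet> x \<le> \<kappa> * (u1 \<bullet> x)" for x
      using b' by (simp add: B_eq \<kappa>_def field_simps)
    moreover have "A' \<bullet> x \<le> 0 \<longleftrightarrow> a1 * (u3 \<bullet> x) + a2 * (u4 \<bullet> x) \<le> \<kappa>' * (c * (u1 \<bullet> x) + s * (u2 \<bullet> x))" for x
    proof -
      define w z where "w = a1 * (u3 \<bullet> x) + a2 * (u4 \<bullet> x)" and "z = c * (u1 \<bullet> x) + s * (u2 \<bullet> x)"
      have e: "A' \<bullet> x = - g * z + g' * w" by (simp add: A'_eq w_def z_def)
      show ?thesis unfolding e w_def[symmetric] z_def[symmetric]
        using g' by (simp add: \<kappa>'_def field_simps)
    qed
    moreover have "A \<bullet> x \<le> 0 \<longleftrightarrow> 0 \<le> u4 \<bullet> x" "C \<bullet> x \<le> 0 \<longleftrightarrow> 0 \<le> u2 \<bullet> x"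
      "B' \<bullet> x \<le> 0 \<longleftrightarrow> a1 * (u4 \<bullet> x) \<le> a2 * (u3 \<bullet> x)" "C' \<bullet> x \<le> 0 \<longleftrightarrow> c * (u2 \<bullet> x) \<le> s * (u1 \<bullet> x)" for x
      by (simp_all add: A_eq C_eq B'_eq C'_eq)
    ultimately show ?thesis by (auto simp: lambert_sector_def)
  qed
  have cos_b: "cos \<beta> = - (b * s)" "cos \<gamma> = - (g * s)" using s by (simp_all add: b g_def)
  have tan\<alpha>: "tan \<alpha> < 0" "tan \<theta> < 0" using tan_neg \<alpha> \<theta> by auto
  \<comment> \<open>\<open>X\<close> is the squared tangent that \<theta> should have. It is a
    positive root of the quadratic equation whose positive root defines \<theta>, and the sign of
    the tangent is known on both sides.\<close>
  have \<nu>: "s / c = tan \<alpha> / tan \<theta>"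
  proof -
    define X where "X = L\<^sup>2 * (c\<^sup>2 / s\<^sup>2)"
    have Xpos: "X > 0" using tan\<alpha> c s(1) by (simp add: X_def LMN)
    have c2: "c\<^sup>2 = 1 - s\<^sup>2" using s by simp
    have "X * (X + (L\<^sup>2 + M\<^sup>2 + N\<^sup>2 + 1)) = L\<^sup>2 * M\<^sup>2 * N\<^sup>2"
    proof -
      \<comment> \<open>Squaring \<open>rel\<close> and eliminating \<open>g'\<close> and
        \<open>b'\<close> by the unit lengths leaves only the squared sine of the edge length and
        the squared cosines of the three angles.\<close>
      have "(cos \<beta>)\<^sup>2 * (cos \<gamma>)\<^sup>2 * (1 - s\<^sup>2) = (s\<^sup>2 - (cos \<beta>)\<^sup>2) * (s\<^sup>2 - (cos \<gamma>)\<^sup>2) * (cos \<alpha>)\<^sup>2"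
      proof -
        have "(g * b * c)\<^sup>2 = (g' * b' * a1)\<^sup>2" using rel by algebra
        then have "g\<^sup>2 * b\<^sup>2 * c\<^sup>2 = g'\<^sup>2 * b'\<^sup>2 * a1\<^sup>2" by (simp add: power_mult_distrib)
        moreover have "g'\<^sup>2 = 1 - g\<^sup>2" "b'\<^sup>2 = 1 - b\<^sup>2" using gg bb by simp_all
        ultimately show ?thesis
          unfolding cos_b c2[symmetric] a1_def[symmetric] by algebra
      qed
      from principal_parameter_equation[OF _ _ _ _ this]
      show ?thesis
        using cneg[OF \<alpha>] cb s unfolding X_def c2 LMN by (simp add: tan_squared_cos)
    qed
    then have "(X + r)\<^sup>2 = r\<^sup>2 + L\<^sup>2 * M\<^sup>2 * N\<^sup>2"
      using LMN(4) by (simp add: power2_eq_square algebra_simps)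
    moreover have "X + r \<ge> 0" using Xpos by (simp add: LMN(4))
    ultimately have "X + r = sqrt (r\<^sup>2 + L\<^sup>2 * M\<^sup>2 * N\<^sup>2)"
      by (metis real_sqrt_abs abs_of_nonneg)
    then have "(tan \<theta>)\<^sup>2 = X" using tan\<theta> by simp
    also have "X = (tan \<alpha> * (c / s))\<^sup>2" by (simp add: X_def LMN power_mult_distrib power_divide)
    finally have "tan \<theta> = tan \<alpha> * (c / s) \<or> tan \<theta> = - (tan \<alpha> * (c / s))"
      by (simp only: power2_eq_iff)
    moreover have "tan \<alpha> * (c / s) < 0"
      using tan\<alpha> c s(1) by (intro mult_neg_pos) auto
    ultimately have "tan \<theta> = tan \<alpha> * (c / s)" using tan\<alpha> by linarith
    then show ?thesis using tan\<alpha> c s(1) by simp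
  qed
  have \<Lambda>: "- (a2 / a1) = - tan \<alpha>" by (simp add: a1_def a2_def tan_def)
  have "4 * measure lebesgue ({x. \<forall>n\<in>{A, A', B, B', C, C'}. n \<bullet> x \<le> 0} \<inter> cball 0 1)
      = lambert_part (- tan \<alpha>) (tan \<alpha> / tan \<theta>) \<kappa> + lambert_part (- tan \<alpha>) (tan \<alpha> / tan \<theta>) \<kappa>'"
    unfolding K lambert_sector_measure[OF fr par] \<Lambda> \<nu> ..
  also have "\<dots> = (delta \<alpha> \<theta> + delta \<beta> \<theta> + delta \<gamma> \<theta> - 2 * delta (pi / 2) \<theta> - delta 0 \<theta>) / 4"
  proof -
    have 1: "pi - arctan (sqrt (1 + \<kappa>\<^sup>2 + (s / c)\<^sup>2) / (s / c * \<kappa>)) = \<beta>"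
      unfolding \<kappa>_def using b(2) b' bb c s cos_b \<beta> by (intro angle_from_cosine) auto
    have 2: "pi - arctan (sqrt (1 + \<kappa>'\<^sup>2 + (s / c)\<^sup>2) / (s / c * \<kappa>')) = \<gamma>"
      unfolding \<kappa>'_def using g g' gg c s cos_b \<gamma> by (intro angle_from_cosine) auto
    have "\<kappa>\<^sup>2 * \<kappa>'\<^sup>2 * (1 + (- tan \<alpha>)\<^sup>2) = 1 + (s / c)\<^sup>2"
    proof -
      have "\<kappa>\<^sup>2 * \<kappa>'\<^sup>2 * c\<^sup>2 = a1\<^sup>2" using \<kappa>\<kappa> by algebra
      then have e: "\<kappa>\<^sup>2 * \<kappa>'\<^sup>2 = a1\<^sup>2 / c\<^sup>2" using c by (simp add: field_simps)
      have "1 + (- tan \<alpha>)\<^sup>2 = 1 / a1\<^sup>2"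
        using a by (simp add: tan_squared_cos a1_def diff_divide_distrib)
      moreover have "1 + (s / c)\<^sup>2 = 1 / c\<^sup>2" using c s by (simp add: power_divide diff_divide_distrib)
      ultimately show ?thesis using e a by simp
    qed
    then show ?thesis
      using lambert_part_add[OF \<alpha> \<theta>, of \<kappa> \<kappa>'] b(2) b' g g' 1 2
      unfolding \<nu> by (simp add: \<kappa>_def \<kappa>'_def)
  qed
  finally show ?thesis .
qed

section \<open>The volume formula\<close>

theorem theorem1:
  fixes \<alpha> \<beta> \<gamma> \<theta> L M N p :: real and Q :: "(real^4) set"
  assumes "pi / 2 < \<alpha>" "\<alpha> < pi"
    and "pi / 2 < \<beta>" "\<beta> < pi"
    and "pi / 2 < \<gamma>" "\<gamma> < pi"
    and "spherical_lambert_cube Q \<alpha> \<beta> \<gamma>"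
    and "L = tan \<alpha>" "M = tan \<beta>" "N = tan \<gamma>"
    and "p = (L\<^sup>2 + M\<^sup>2 + N\<^sup>2 + 1) / 2"
    and "pi / 2 < \<theta>" "\<theta> < pi"
    and "(tan \<theta>)\<^sup>2 = - p + sqrt (p\<^sup>2 + L\<^sup>2 * M\<^sup>2 * N\<^sup>2)"
  shows "spherical_volume Q =
    1 / 4 * (delta \<alpha> \<theta> + delta \<beta> \<theta> + delta \<gamma> \<theta> - 2 * delta (pi / 2) \<theta> - delta 0 \<theta>)"
proof -
  obtain e1 e2 e3 where poly: "spherical_polyhedron Q" and cube: "combinatorial_cube Q"
    and edges: "spherical_edge Q e1" "spherical_edge Q e2" "spherical_edge Q e3"
    and ncp: "\<not> face_coplanar Q e1 e2" "\<not> face_coplanar Q e1 e3" "\<not> face_coplanar Q e2 e3"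
    and ang: "has_dihedral_angle Q e1 \<alpha>" "has_dihedral_angle Q e2 \<beta>" "has_dihedral_angle Q e3 \<gamma>"
    and right: "\<And>e. spherical_edge Q e \<Longrightarrow> e \<notin> {e1, e2, e3} \<Longrightarrow> has_dihedral_angle Q e (pi / 2)"
    using assms(7) unfolding spherical_lambert_cube_def by blast
  obtain \<phi> where "bij_betw \<phi> {F. spherical_face Q F} {F. F face_of cbox 0 (One :: real^3)}"
    "\<And>F G. spherical_face Q F \<Longrightarrow> spherical_face Q G \<Longrightarrow> F \<subseteq> G \<longleftrightarrow> \<phi> F \<subseteq> \<phi> G"
    using cube unfolding combinatorial_cube_def by blast
  then interpret spherical_cube Q \<phi> using poly by unfold_locales
  have share: "face_coplanar Q e e'" if "e \<subseteq> facet f" "e' \<subseteq> facet f" for e e' f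
    unfolding face_coplanar_def using that spherical_facet_facet[of f] span_superset[of "facet f"] by blast
  have dim2: "dim e1 = 2" "dim e2 = 2" "dim e3 = 2" using edges by (auto simp: spherical_edge_def)
  obtain i1 b1 j1 c1 where e1: "i1 \<noteq> j1" "e1 = facet (i1, b1) \<inter> facet (j1, c1)"
    by (rule dihedral_edge[OF dim2(1) ang(1)])
  obtain i2 b2 j2 c2 where e2: "i2 \<noteq> j2" "e2 = facet (i2, b2) \<inter> facet (j2, c2)"
    by (rule dihedral_edge[OF dim2(2) ang(2)])
  obtain i3 b3 j3 c3 where e3: "i3 \<noteq> j3" "e3 = facet (i3, b3) \<inter> facet (j3, c3)"
    by (rule dihedral_edge[OF dim2(3) ang(3)])
  \<comment> \<open>A facet common to two of the edges would make them coplanar, so the three edges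
    match the six facets in pairs.\<close>
  have "{(i1, b1), (j1, c1)} \<inter> {(i2, b2), (j2, c2)} = {}" "{(i1, b1), (j1, c1)} \<inter> {(i3, b3), (j3, c3)} = {}"
      "{(i2, b2), (j2, c2)} \<inter> {(i3, b3), (j3, c3)} = {}"
    using ncp share e1 e2 e3 by blast+
  then obtain i j k b c d where ijk: "i \<noteq> j" "i \<noteq> k" "j \<noteq> k"
    and lab: "{(i1, b1), (j1, c1)} = {(i, b), (j, \<not> c)}" "{(i2, b2), (j2, c2)} = {(j, c), (k, \<not> d)}"
      "{(i3, b3), (j3, c3)} = {(k, d), (i, \<not> b)}"
    by (rule cyclic_matching[OF e1(1) e2(1) e3(1)])
  have E: "e1 = facet (i, b) \<inter> facet (j, \<not> c)" "e2 = facet (j, c) \<inter> facet (k, \<not> d)" "e3 = facet (k, d) \<inter> facet (i, \<not> b)"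
    using lab e1 e2 e3 by (auto simp: doubleton_eq_iff)
  define angle where "angle e = (if e = e1 then \<alpha> else if e = e2 then \<beta> else if e = e3 then \<gamma> else pi / 2)" for e
  have angle: "has_dihedral_angle Q e (angle e)" if "spherical_edge Q e" for e
    using ang right[OF that] by (auto simp: angle_def)
  \<comment> \<open>Existence of a normal needs no construction: every facet has an adjacent one,
    and the dihedral angle at their common edge comes with normals.\<close>
  have "\<exists>n. outward_unit_normal Q (facet f) n" for f
  proof -
    obtain l t where f: "f = (l, t)" by fastforce
    obtain m where "l \<noteq> m" using ex_indices[of l] by blast
    from dihedral_facets[OF this angle[OF spherical_edge_facets[OF this]]] show ?thesis
      unfolding f by metis
  qed
  then obtain nrm where nrm: "\<And>f. outward_unit_normal Q (facet f) (nrm f)" by metis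
  \<comment> \<open>By uniqueness, the normals hidden in each dihedral angle are the chosen
    ones.\<close>
  have inner: "nrm (l, t) \<bullet> nrm (m, u) = - cos (angle (facet (l, t) \<inter> facet (m, u)))" if "l \<noteq> m" for l t m u
    using dihedral_facets[OF that angle[OF spherical_edge_facets[OF that]]] outward_unit_normal_unique nrm by metis
  have edge_eq: "(l, t) \<in> {(l', t'), (m', u')} \<and> (m, u) \<in> {(l', t'), (m', u')}"
    if "l' \<noteq> m'" "facet (l, t) \<inter> facet (m, u) = facet (l', t') \<inter> facet (m', u')" for l t m u l' t' m' u'
    using edge_subset_facet[OF that(1), of t' u' "(l, t)"] edge_subset_facet[OF that(1), of t' u' "(m, u)"] that(2) by blast
  have orth: "nrm (l, t) \<bullet> nrm (m, u) = 0"
    if "l \<noteq> m" "\<not> ((l, t) \<in> {(i, b), (j, \<not> c)} \<and> (m, u) \<in> {(i, b), (j, \<not> c)})"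
      "\<not> ((l, t) \<in> {(j, c), (k, \<not> d)} \<and> (m, u) \<in> {(j, c), (k, \<not> d)})"
      "\<not> ((l, t) \<in> {(k, d), (i, \<not> b)} \<and> (m, u) \<in> {(k, d), (i, \<not> b)})" for l t m u
  proof -
    have "facet (l, t) \<inter> facet (m, u) \<notin> {e1, e2, e3}"
      unfolding E using that edge_eq ijk by (metis empty_iff insert_iff)
    then show ?thesis using inner[OF that(1), of t u] by (simp add: angle_def)
  qed
  have distinct: "e1 \<noteq> e2" "e1 \<noteq> e3" "e2 \<noteq> e3"
    using ncp share E by (metis Int_lower1)+
  have unit: "nrm f \<bullet> nrm f = 1" for f using nrm[of f] by (simp add: outward_unit_normal_def norm_eq_1)
  \<comment> \<open>This vertex is the end of the \<alpha>-edge on the face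
    \<open>(k, \<not> d)\<close>; the next one is the common point of the faces
    \<open>(i, b)\<close>, \<open>(j, c)\<close>, \<open>(k, d)\<close>.\<close>
  obtain p where p: "nrm (i, b) \<bullet> p = 0" "nrm (j, \<not> c) \<bullet> p = 0" "nrm (k, \<not> d) \<bullet> p = 0"
    "nrm (i, \<not> b) \<bullet> p < 0" "nrm (j, \<not> \<not> c) \<bullet> p < 0" "nrm (k, \<not> \<not> d) \<bullet> p < 0"
    by (rule vertex_point[OF nrm ijk])
  obtain q where q: "nrm (i, b) \<bullet> q = 0" "nrm (j, c) \<bullet> q = 0" "nrm (k, d) \<bullet> q = 0"
    "nrm (i, \<not> b) \<bullet> q < 0" "nrm (j, \<not> c) \<bullet> q < 0" "nrm (k, \<not> d) \<bullet> q < 0"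
    by (rule vertex_point[OF nrm ijk])
  have all: "(\<forall>f. nrm f \<bullet> x \<le> 0) \<longleftrightarrow> (\<forall>n\<in>{nrm (i, b), nrm (i, \<not> b), nrm (j, c), nrm (j, \<not> c), nrm (k, d), nrm (k, \<not> d)}. n \<bullet> x \<le> 0)" for x
  proof
    assume "\<forall>f. nrm f \<bullet> x \<le> 0"
    then show "\<forall>n\<in>{nrm (i, b), nrm (i, \<not> b), nrm (j, c), nrm (j, \<not> c), nrm (k, d), nrm (k, \<not> d)}. n \<bullet> x \<le> 0"
      by blast
  next
    assume h: "\<forall>n\<in>{nrm (i, b), nrm (i, \<not> b), nrm (j, c), nrm (j, \<not> c), nrm (k, d), nrm (k, \<not> d)}. n \<bullet> x \<le> 0"
    show "\<forall>f. nrm f \<bullet> x \<le> 0"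
    proof
      fix f
      have "f \<in> {(i, b), (i, \<not> b), (j, c), (j, \<not> c), (k, d), (k, \<not> d)}"
        using cube_indices[OF ijk, of "fst f"] by (cases f) auto
      then have "nrm f \<in> {nrm (i, b), nrm (i, \<not> b), nrm (j, c), nrm (j, \<not> c), nrm (k, d), nrm (k, \<not> d)}"
        by auto
      with h show "nrm f \<bullet> x \<le> 0" by blast
    qed
  qed
  have "spherical_volume Q = 4 * measure lebesgue ({x. \<forall>n\<in>{nrm (i, b), nrm (i, \<not> b), nrm (j, c), nrm (j, \<not> c), nrm (k, d), nrm (k, \<not> d)}. n \<bullet> x \<le> 0} \<inter> cball 0 1)"
    by (simp only: spherical_volume_def cone_eq_normals[OF nrm] all)
  also have "\<dots> = (delta \<alpha> \<theta> + delta \<beta> \<theta> + delta \<gamma> \<theta> - 2 * delta (pi / 2) \<theta> - delta 0 \<theta>) / 4"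
  proof (rule lambert_cone_volume)
    show "nrm (i, b) \<bullet> nrm (j, \<not> c) = - cos \<alpha>"
      using inner[OF ijk(1), of b "\<not> c"] by (simp add: E[symmetric] angle_def)
    show "nrm (j, c) \<bullet> nrm (k, \<not> d) = - cos \<beta>"
      using inner[OF ijk(3), of c "\<not> d"] distinct by (simp add: E[symmetric] angle_def)
    show "nrm (k, d) \<bullet> nrm (i, \<not> b) = - cos \<gamma>"
      using inner[OF ijk(2)[symmetric], of d "\<not> b"] distinct by (simp add: E[symmetric] angle_def)
    show "nrm (j, \<not> c) \<bullet> q \<le> 0" using q by simp
    show "nrm (j, c) \<bullet> p < 0" using p by simp
  qed (use unit orth ijk p q assms in auto)
  finally show ?thesis by simp
qed

end
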